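(* Fix $x=(x_1,x_2,x_3,x_4)\in\mathbb R^4$ such that $$x_1\le 1,\quad x_2\le 0,\quad x_3\le 0,\quad x_1+x_2>0,\quad x_3+x_4\ge 0.$$ Let $N$ be a non-abelian nilpotent Lie group with a left-invariant Hermitian structure $(g,J)$, and let $\mathfrak z$ be the center of its Lie algebra. Assume that $\mathfrak z\cap J\mathfrak z\neq 0$. Then there are no left-invariant Hermitian metrics $g$ on $(N,J)$ satisfying the static equation $$K^x(g)=\lambda\, g$$ for some $\lambda\in\mathbb R$.
   Context: Here $J$ is a left-invariant (integrable) complex structure on $N$. For a Hermitian metric $g$ let $\nabla$ be its Chern connection (the unique connection with $\nabla J=\nabla g=0$ whose torsion $T$ has vanishing $(1,1)$-part) and $\Omega$ its curvature. In a $(1,0)$-frame put $T_{ij\bar k}=g_{a\bar k}T_{ij}^a$ (with $T_{\bar i\bar j k}=\overline{T_{ij\bar k}}$), $S_{i\bar j}=g^{k\bar l}\Omega_{k\bar l i\bar j}$, where $\Omega_{k\bar l i\bar j}=g(\nabla_k\nabla_{\bar l}Z_i-\nabla_{\bar l}\nabla_kZ_i-\nabla_{[Z_k,Z_{\bar l}]}Z_i,Z_{\bar j})$, and $Q^1_{i\bar j}=g^{k\bar l}g^{m\bar n}T_{ik\bar n}T_{\bar j\bar l m}$, $Q^2_{i\bar j}=g^{\bar l k}g^{\bar n m}T_{\bar l\bar n i}T_{km\bar j}$, $Q^3_{i\bar j}=g^{\bar l k}g^{\bar n m}T_{ik\bar l}T_{\bar j\bar n m}$, $Q^4_{i\bar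 j}=\frac12 g^{\bar l k}g^{\bar n m}(T_{mk\bar l}T_{\bar n\bar j i}+T_{\bar n\bar l k}T_{mi\bar j})$. For $x\in\mathbb R^4$ define $K^x(g)=S-x_1Q^1-x_2Q^2-x_3Q^3-x_4Q^4$. *)

theory Defs
  imports
    "HOL-Analysis.Analysis"
    "HOL-Algebra.Group"
    "HOL-Library.Function_Algebras"
begin

section \<open>Smooth manifolds and Lie groups\<close>

text \<open>Only meaningful for open \<open>S\<close> in a finite-dimensional space: the derivatives are not taken
  within \<open>S\<close>, and order \<open>k + 1\<close> asks each directional derivative to be of order \<open>k\<close>.\<close>

fun Ck_on :: "nat \<Rightarrow> 'a::real_normed_vector set \<Rightarrow> ('a \<Rightarrow> 'b::real_normed_vector) \<Rightarrow> bool" where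
  "Ck_on 0 S f \<longleftrightarrow> continuous_on S f"
| "Ck_on (Suc k) S f \<longleftrightarrow>
     (\<forall>x\<in>S. f differentiable (at x)) \<and>
     (\<forall>v. Ck_on k S (\<lambda>x. frechet_derivative f (at x) v))"

definition smooth_on :: "'a::real_normed_vector set \<Rightarrow> ('a \<Rightarrow> 'b::real_normed_vector) \<Rightarrow> bool" where
  "smooth_on S f \<longleftrightarrow> (\<forall>k. Ck_on k S f)"

type_synonym ('g, 'e) chart = "'g set \<times> ('g \<Rightarrow> 'e)"

definition smooth_atlas :: "('g::{t2_space, second_countable_topology}, 'e::euclidean_space) chart set \<Rightarrow> bool" where
  "smooth_atlas A \<longleftrightarrow>
     (\<forall>(U, \<phi>)\<in>A. open U \<and> open (\<phi> ` U) \<and> homeomorphism U (\<phi> ` U) \<phi> (inv_into U \<phi>)) \<and>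
     (\<Union>(U, \<phi>)\<in>A. U) = UNIV \<and>
     (\<forall>(U, \<phi>)\<in>A. \<forall>(V, \<psi>)\<in>A. smooth_on (\<phi> ` (U \<inter> V)) (\<lambda>u. \<psi> (inv_into U \<phi> u)))"

definition product_atlas ::
  "('g, 'e) chart set \<Rightarrow> ('h, 'f) chart set \<Rightarrow> ('g \<times> 'h, 'e \<times> 'f) chart set" where
  "product_atlas A B = {(U \<times> V, map_prod \<phi> \<psi>) | U \<phi> V \<psi>. (U, \<phi>) \<in> A \<and> (V, \<psi>) \<in> B}"

definition smooth_map ::
  "('g::topological_space, 'e::real_normed_vector) chart set \<Rightarrow>
   ('h::topological_space, 'f::real_normed_vector) chart set \<Rightarrow> ('g \<Rightarrow> 'h) \<Rightarrow> bool" where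
  "smooth_map A B F \<longleftrightarrow>
     continuous_on UNIV F \<and>
     (\<forall>(U, \<phi>)\<in>A. \<forall>(V, \<psi>)\<in>B. smooth_on (\<phi> ` (U \<inter> F -` V)) (\<lambda>u. \<psi> (F (inv_into U \<phi> u))))"

definition lie_group ::
  "'g::{t2_space, second_countable_topology} monoid \<Rightarrow> ('g, 'e::euclidean_space) chart set \<Rightarrow> bool" where
  "lie_group N A \<longleftrightarrow>
     group N \<and> carrier N = UNIV \<and> smooth_atlas A \<and>
     smooth_map (product_atlas A A) A (\<lambda>(a, b). a \<otimes>\<^bsub>N\<^esub> b) \<and>
     smooth_map A A (\<lambda>a. inv\<^bsub>N\<^esub> a)"


section \<open>Vector fields\<close>

text \<open>
  Everything is set up on the complexified tangent bundle.  Complex vector fields are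
  the derivations of the algebra of smooth complex functions (extended by 0 to functions
  that are not smooth, so that equality of fields is equality of functions).  The real fields
  are the ones commuting with complex conjugation; real tensors and connections
  are represented by their complex (multi)linear extensions, which likewise
  commute with conjugation.
\<close>

definition smooth_funs :: "('g, 'e::real_normed_vector) chart set \<Rightarrow> ('g \<Rightarrow> complex) set" where
  "smooth_funs A = {f. \<forall>(U, \<phi>)\<in>A. smooth_on (\<phi> ` U) (\<lambda>u. f (inv_into U \<phi> u))}"

type_synonym 'g field = "('g \<Rightarrow> complex) \<Rightarrow> ('g \<Rightarrow> complex)"

definition mult_field :: "('g \<Rightarrow> complex) \<Rightarrow> 'g field \<Rightarrow> 'g field" (infixr "\<cdot>\<^sub>F" 75) where
  "f \<cdot>\<^sub>F X = (\<lambda>h. f * X h)"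

definition vector_fields :: "('g, 'e::real_normed_vector) chart set \<Rightarrow> 'g field set" where
  "vector_fields A = {X.
     (\<forall>f\<in>smooth_funs A. X f \<in> smooth_funs A) \<and>
     (\<forall>f. f \<notin> smooth_funs A \<longrightarrow> X f = 0) \<and>
     (\<forall>f\<in>smooth_funs A. \<forall>h\<in>smooth_funs A. X (f + h) = X f + X h) \<and>
     (\<forall>c. \<forall>f\<in>smooth_funs A. X ((\<lambda>_. c) * f) = (\<lambda>_. c) * X f) \<and>
     (\<forall>f\<in>smooth_funs A. \<forall>h\<in>smooth_funs A. X (f * h) = f * X h + h * X f)}"

definition cnj_fun :: "('g \<Rightarrow> complex) \<Rightarrow> ('g \<Rightarrow> complex)" where
  "cnj_fun f = (\<lambda>p. cnj (f p))"

definition cnj_field :: "'g field \<Rightarrow> 'g field" where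
  "cnj_field X = (\<lambda>f. cnj_fun (X (cnj_fun f)))"

definition real_field :: "'g field \<Rightarrow> bool" where
  "real_field X \<longleftrightarrow> cnj_field X = X"

definition lie_bracket :: "'g field \<Rightarrow> 'g field \<Rightarrow> 'g field" where
  "lie_bracket X Y = (\<lambda>f. X (Y f) - Y (X f))"

text \<open>The pushforward of a field under the left translation by \<open>a\<close>.\<close>

definition left_translate :: "'g monoid \<Rightarrow> 'g \<Rightarrow> 'g field \<Rightarrow> 'g field" where
  "left_translate N a X = (\<lambda>f p. X (\<lambda>q. f (a \<otimes>\<^bsub>N\<^esub> q)) (inv\<^bsub>N\<^esub> a \<otimes>\<^bsub>N\<^esub> p))"

definition left_invariant_field :: "'g monoid \<Rightarrow> 'g field \<Rightarrow> bool" where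
  "left_invariant_field N X \<longleftrightarrow> (\<forall>a. left_translate N a X = X)"


section \<open>The Lie algebra of a Lie group\<close>

definition lie_algebra :: "'g monoid \<Rightarrow> ('g, 'e::real_normed_vector) chart set \<Rightarrow> 'g field set" where
  "lie_algebra N A = {X \<in> vector_fields A. real_field X \<and> left_invariant_field N X}"

definition lie_center :: "'g monoid \<Rightarrow> ('g, 'e::real_normed_vector) chart set \<Rightarrow> 'g field set" where
  "lie_center N A = {X \<in> lie_algebra N A. \<forall>Y\<in>lie_algebra N A. lie_bracket X Y = 0}"

inductive_set real_span :: "'g field set \<Rightarrow> 'g field set" for B where
  zero: "0 \<in> real_span B"
| step: "X \<in> B \<Longrightarrow> Y \<in> real_span B \<Longrightarrow> (\<lambda>_. complex_of_real c) \<cdot>\<^sub>F X + Y \<in> real_span B"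

fun lower_central_series ::
  "'g monoid \<Rightarrow> ('g, 'e::real_normed_vector) chart set \<Rightarrow> nat \<Rightarrow> 'g field set" where
  "lower_central_series N A 0 = lie_algebra N A"
| "lower_central_series N A (Suc k) =
     real_span {lie_bracket X Y | X Y. X \<in> lie_algebra N A \<and> Y \<in> lower_central_series N A k}"

text \<open>
  A Lie group is called nilpotent or abelian according to its Lie algebra; for
  connected groups this agrees with the group-theoretic notions.
\<close>

definition nilpotent_lie_group ::
  "'g::{t2_space, second_countable_topology} monoid \<Rightarrow> ('g, 'e::euclidean_space) chart set \<Rightarrow> bool" where
  "nilpotent_lie_group N A \<longleftrightarrow> lie_group N A \<and> (\<exists>k. lower_central_series N A k = {0})"

definition abelian_lie_group ::
  "'g::{t2_space, second_countable_topology} monoid \<Rightarrow> ('g, 'e::euclidean_space) chart set \<Rightarrow> bool" where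
  "abelian_lie_group N A \<longleftrightarrow>
     lie_group N A \<and> (\<forall>X\<in>lie_algebra N A. \<forall>Y\<in>lie_algebra N A. lie_bracket X Y = 0)"


section \<open>Left-invariant Hermitian structures\<close>

definition left_invariant_complex_structure ::
  "'g monoid \<Rightarrow> ('g, 'e::real_normed_vector) chart set \<Rightarrow> ('g field \<Rightarrow> 'g field) \<Rightarrow> bool" where
  "left_invariant_complex_structure N A J \<longleftrightarrow>
     (\<forall>X\<in>vector_fields A. J X \<in> vector_fields A) \<and>
     (\<forall>X\<in>vector_fields A. \<forall>Y\<in>vector_fields A. J (X + Y) = J X + J Y) \<and>
     (\<forall>f\<in>smooth_funs A. \<forall>X\<in>vector_fields A. J (f \<cdot>\<^sub>F X) = f \<cdot>\<^sub>F J X) \<and>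
     (\<forall>X\<in>vector_fields A. J (cnj_field X) = cnj_field (J X)) \<and>
     (\<forall>X\<in>vector_fields A. J (J X) = - X) \<and>
     (\<forall>X\<in>vector_fields A. \<forall>Y\<in>vector_fields A.
        lie_bracket (J X) (J Y) - J (lie_bracket (J X) Y) - J (lie_bracket X (J Y))
          - lie_bracket X Y = 0) \<and>
     (\<forall>a. \<forall>X\<in>vector_fields A. left_translate N a (J X) = J (left_translate N a X))"

text \<open>
  \<open>g\<close> is the complex bilinear extension of the Riemannian metric.  A field \<open>X\<close> is nonzero
  at \<open>p\<close> iff \<open>X f p \<noteq> 0\<close> for some smooth \<open>f\<close>.
\<close>

definition left_invariant_hermitian_metric ::
  "'g monoid \<Rightarrow> ('g, 'e::real_normed_vector) chart set \<Rightarrow> ('g field \<Rightarrow> 'g field) \<Rightarrow>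
   ('g field \<Rightarrow> 'g field \<Rightarrow> 'g \<Rightarrow> complex) \<Rightarrow> bool" where
  "left_invariant_hermitian_metric N A J g \<longleftrightarrow>
     (\<forall>X\<in>vector_fields A. \<forall>Y\<in>vector_fields A. g X Y \<in> smooth_funs A) \<and>
     (\<forall>X\<in>vector_fields A. \<forall>Y\<in>vector_fields A. g X Y = g Y X) \<and>
     (\<forall>X\<in>vector_fields A. \<forall>Y\<in>vector_fields A. \<forall>W\<in>vector_fields A. g (X + Y) W = g X W + g Y W) \<and>
     (\<forall>f\<in>smooth_funs A. \<forall>X\<in>vector_fields A. \<forall>Y\<in>vector_fields A. g (f \<cdot>\<^sub>F X) Y = f * g X Y) \<and>
     (\<forall>X\<in>vector_fields A. \<forall>Y\<in>vector_fields A. g (cnj_field X) (cnj_field Y) = cnj_fun (g X Y)) \<and>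
     (\<forall>X\<in>vector_fields A. real_field X \<longrightarrow>
        (\<forall>p. (\<exists>f\<in>smooth_funs A. X f p \<noteq> 0) \<longrightarrow> Re (g X X p) > 0)) \<and>
     (\<forall>X\<in>vector_fields A. \<forall>Y\<in>vector_fields A. g (J X) (J Y) = g X Y) \<and>
     (\<forall>a. \<forall>X\<in>vector_fields A. \<forall>Y\<in>vector_fields A. \<forall>p.
        g (left_translate N a X) (left_translate N a Y) p = g X Y (inv\<^bsub>N\<^esub> a \<otimes>\<^bsub>N\<^esub> p))"

definition type_10_fields ::
  "('g, 'e::real_normed_vector) chart set \<Rightarrow> ('g field \<Rightarrow> 'g field) \<Rightarrow> 'g field set" where
  "type_10_fields A J = {Z \<in> vector_fields A. J Z = (\<lambda>_. \<i>) \<cdot>\<^sub>F Z}"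

text \<open>A (1,0)-frame is a basis of the \<open>C\<^sup>\<infinity>\<close>-module of fields of type (1,0).\<close>

definition left_invariant_frame ::
  "'g monoid \<Rightarrow> ('g, 'e::real_normed_vector) chart set \<Rightarrow> ('g field \<Rightarrow> 'g field) \<Rightarrow>
   nat \<Rightarrow> (nat \<Rightarrow> 'g field) \<Rightarrow> bool" where
  "left_invariant_frame N A J n Z \<longleftrightarrow>
     (\<forall>i<n. Z i \<in> type_10_fields A J \<and> left_invariant_field N (Z i)) \<and>
     (\<forall>W\<in>type_10_fields A J. \<exists>c. (\<forall>i<n. c i \<in> smooth_funs A) \<and> W = (\<Sum>i<n. c i \<cdot>\<^sub>F Z i)) \<and>
     (\<forall>c. (\<forall>i<n. c i \<in> smooth_funs A) \<longrightarrow> (\<Sum>i<n. c i \<cdot>\<^sub>F Z i) = 0 \<longrightarrow> (\<forall>i<n. c i = 0))"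


section \<open>The Chern connection\<close>

definition affine_connection ::
  "('g, 'e::real_normed_vector) chart set \<Rightarrow> ('g field \<Rightarrow> 'g field \<Rightarrow> 'g field) \<Rightarrow> bool" where
  "affine_connection A D \<longleftrightarrow>
     (\<forall>X\<in>vector_fields A. \<forall>Y\<in>vector_fields A. D X Y \<in> vector_fields A) \<and>
     (\<forall>X\<in>vector_fields A. \<forall>Y\<in>vector_fields A. \<forall>W\<in>vector_fields A. D (X + Y) W = D X W + D Y W) \<and>
     (\<forall>X\<in>vector_fields A. \<forall>Y\<in>vector_fields A. \<forall>W\<in>vector_fields A. D X (Y + W) = D X Y + D X W) \<and>
     (\<forall>f\<in>smooth_funs A. \<forall>X\<in>vector_fields A. \<forall>Y\<in>vector_fields A. D (f \<cdot>\<^sub>F X) Y = f \<cdot>\<^sub>F D X Y) \<and>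
     (\<forall>f\<in>smooth_funs A. \<forall>X\<in>vector_fields A. \<forall>Y\<in>vector_fields A.
        D X (f \<cdot>\<^sub>F Y) = X f \<cdot>\<^sub>F Y + f \<cdot>\<^sub>F D X Y) \<and>
     (\<forall>X\<in>vector_fields A. \<forall>Y\<in>vector_fields A. D (cnj_field X) (cnj_field Y) = cnj_field (D X Y))"

definition torsion :: "('g field \<Rightarrow> 'g field \<Rightarrow> 'g field) \<Rightarrow> 'g field \<Rightarrow> 'g field \<Rightarrow> 'g field" where
  "torsion D X Y = D X Y - D Y X - lie_bracket X Y"

definition curvature ::
  "('g field \<Rightarrow> 'g field \<Rightarrow> 'g field) \<Rightarrow> 'g field \<Rightarrow> 'g field \<Rightarrow> 'g field \<Rightarrow> 'g field" where
  "curvature D X Y W = D X (D Y W) - D Y (D X W) - D (lie_bracket X Y) W"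

definition chern_connection ::
  "('g, 'e::real_normed_vector) chart set \<Rightarrow> ('g field \<Rightarrow> 'g field) \<Rightarrow>
   ('g field \<Rightarrow> 'g field \<Rightarrow> 'g \<Rightarrow> complex) \<Rightarrow> ('g field \<Rightarrow> 'g field \<Rightarrow> 'g field) \<Rightarrow> bool" where
  "chern_connection A J g D \<longleftrightarrow>
     affine_connection A D \<and>
     (\<forall>X\<in>vector_fields A. \<forall>Y\<in>vector_fields A. D X (J Y) = J (D X Y)) \<and>
     (\<forall>X\<in>vector_fields A. \<forall>Y\<in>vector_fields A. \<forall>W\<in>vector_fields A.
        X (g Y W) = g (D X Y) W + g Y (D X W)) \<and>
     (\<forall>Z\<in>type_10_fields A J. \<forall>W\<in>type_10_fields A J. torsion D Z (cnj_field W) = 0)"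


section \<open>Components in a (1,0)-frame\<close>

text \<open>
  Bars on indices are not displayed: each definition fixes which of its arguments stand for
  barred indices, i.e. refer to \<open>cnj_field (Z k)\<close> instead of \<open>Z k\<close>.  In the sums
  \<open>l\<close> and \<open>r\<close> are the barred summation indices.
\<close>

context
  fixes g :: "'g field \<Rightarrow> 'g field \<Rightarrow> 'g \<Rightarrow> complex"
    and D :: "'g field \<Rightarrow> 'g field \<Rightarrow> 'g field"
    and n :: nat
    and Z :: "nat \<Rightarrow> 'g field"
begin

definition metric_comp :: "nat \<Rightarrow> nat \<Rightarrow> 'g \<Rightarrow> complex" where
  "metric_comp i j p = g (Z i) (cnj_field (Z j)) p"

text \<open>\<open>metric_inv k l\<close> is the coefficient with upper indices \<open>k\<close> and \<open>l\<close>-bar; it is uniquely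
  determined for \<open>k, l < n\<close>.\<close>

definition metric_inv :: "nat \<Rightarrow> nat \<Rightarrow> 'g \<Rightarrow> complex" where
  "metric_inv k l p =
     (SOME H. \<forall>i<n. \<forall>k<n. (\<Sum>l<n. H k l * metric_comp i l p) = (if i = k then 1 else 0)) k l"

text \<open>The component of the torsion with indices \<open>i\<close>, \<open>j\<close>, \<open>k\<close>-bar, obtained by lowering the upper
  index with \<open>g\<close>; and its conjugate, with indices \<open>i\<close>-bar, \<open>j\<close>-bar, \<open>k\<close>.\<close>

definition torsion_comp :: "nat \<Rightarrow> nat \<Rightarrow> nat \<Rightarrow> 'g \<Rightarrow> complex" where
  "torsion_comp i j k p = g (torsion D (Z i) (Z j)) (cnj_field (Z k)) p"

definition torsion_comp_bar :: "nat \<Rightarrow> nat \<Rightarrow> nat \<Rightarrow> 'g \<Rightarrow> complex" where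
  "torsion_comp_bar i j k p = cnj (torsion_comp i j k p)"

definition curvature_comp :: "nat \<Rightarrow> nat \<Rightarrow> nat \<Rightarrow> nat \<Rightarrow> 'g \<Rightarrow> complex" where
  "curvature_comp k l i j p =
     g (curvature D (Z k) (cnj_field (Z l)) (Z i)) (cnj_field (Z j)) p"

definition S_tensor :: "nat \<Rightarrow> nat \<Rightarrow> 'g \<Rightarrow> complex" where
  "S_tensor i j p = (\<Sum>k<n. \<Sum>l<n. metric_inv k l p * curvature_comp k l i j p)"

definition Q1 :: "nat \<Rightarrow> nat \<Rightarrow> 'g \<Rightarrow> complex" where
  "Q1 i j p = (\<Sum>k<n. \<Sum>l<n. \<Sum>m<n. \<Sum>r<n. metric_inv k l p * metric_inv m r p *
     torsion_comp i k r p * torsion_comp_bar j l m p)"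

definition Q2 :: "nat \<Rightarrow> nat \<Rightarrow> 'g \<Rightarrow> complex" where
  "Q2 i j p = (\<Sum>k<n. \<Sum>l<n. \<Sum>m<n. \<Sum>r<n. metric_inv k l p * metric_inv m r p *
     torsion_comp_bar l r i p * torsion_comp k m j p)"

definition Q3 :: "nat \<Rightarrow> nat \<Rightarrow> 'g \<Rightarrow> complex" where
  "Q3 i j p = (\<Sum>k<n. \<Sum>l<n. \<Sum>m<n. \<Sum>r<n. metric_inv k l p * metric_inv m r p *
     torsion_comp i k l p * torsion_comp_bar j r m p)"

definition Q4 :: "nat \<Rightarrow> nat \<Rightarrow> 'g \<Rightarrow> complex" where
  "Q4 i j p = 1 / 2 * (\<Sum>k<n. \<Sum>l<n. \<Sum>m<n. \<Sum>r<n. metric_inv k l p * metric_inv m r p *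
     (torsion_comp m k l p * torsion_comp_bar r j i p +
      torsion_comp_bar r l k p * torsion_comp m i j p))"

definition K_tensor :: "real ^ 4 \<Rightarrow> nat \<Rightarrow> nat \<Rightarrow> 'g \<Rightarrow> complex" where
  "K_tensor x i j p = S_tensor i j p
     - complex_of_real (x $ 1) * Q1 i j p - complex_of_real (x $ 2) * Q2 i j p
     - complex_of_real (x $ 3) * Q3 i j p - complex_of_real (x $ 4) * Q4 i j p"

end

text \<open>
  The equation \<open>K\<^sup>x(g) = \<mu> g\<close>.  The Chern connection exists and is unique, left-invariant
  (1,0)-frames exist on every Lie group with a left-invariant complex structure, and the
  equation is tensorial; so it does not depend on the choice of \<open>D\<close>, \<open>n\<close> and \<open>Z\<close>.
\<close>

definition static_equation ::
  "'g monoid \<Rightarrow> ('g, 'e::real_normed_vector) chart set \<Rightarrow> ('g field \<Rightarrow> 'g field) \<Rightarrow>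
   real ^ 4 \<Rightarrow> ('g field \<Rightarrow> 'g field \<Rightarrow> 'g \<Rightarrow> complex) \<Rightarrow> real \<Rightarrow> bool" where
  "static_equation N A J x g \<mu> \<longleftrightarrow>
     (\<exists>D n Z. chern_connection A J g D \<and> left_invariant_frame N A J n Z \<and>
        (\<forall>i<n. \<forall>j<n. \<forall>p. K_tensor g D n Z x i j p = complex_of_real \<mu> * metric_comp g Z i j p))"

end

theory Submission
  imports Defs
begin

text \<open>
  On left-invariant fields the metric has constant coefficients, so the static equation becomes an
  identity of sesquilinear forms on the space of (1,0) vectors of the complexified Lie algebra, with
  contractions over a unitary basis \<open>B\<close>.  Write \<open>D\<close> for the Chern connection, \<open>T\<close> for its torsion and
  \<open>h U V = g(U, cnj V)\<close>.  The proof compares two consequences of \<open>K = \<mu> h\<close>.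

  First, if \<open>X\<close> is a nonzero central vector with \<open>J X\<close> central, then \<open>W = (X - \<i> J X) / 2\<close> is a nonzero
  central vector of type (1,0).  Covariant differentiation in the directions of \<open>W\<close> and of its conjugate
  kills all (1,0) vectors, and \<open>W\<close> is holomorphic, so both \<open>S(W,W)\<close> and \<open>Q\<^sup>1(W,W)\<close> equal the sum of the
  \<open>h (D e W) (D e W)\<close> over \<open>e\<close> in \<open>B\<close>, while \<open>Q\<^sup>4(W,W) = 0\<close>; and \<open>Q\<^sup>2\<close>, \<open>Q\<^sup>3\<close> are always nonnegative on the diagonal.
  The sign conditions on \<open>x\<^sub>1, x\<^sub>2, x\<^sub>3\<close> therefore force \<open>\<mu> \<ge> 0\<close> (\<open>K_central_nonneg\<close>).

  Second, take the trace.  The trace of \<open>S\<close> is the Chern scalar curvature, which vanishes on a nilpotent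
  algebra; \<open>Q\<^sup>1\<close> and \<open>Q\<^sup>2\<close> both have trace \<open>|T|\<^sup>2\<close>, and \<open>Q\<^sup>3\<close> and \<open>Q\<^sup>4\<close> both have trace \<open>|\<tau>|\<^sup>2\<close>, where \<open>\<tau>\<close> is the
  trace of \<open>T\<close> (\<open>trace_K\<close>).  Hence \<open>\<mu>\<close> times the dimension is
  \<open>- (x\<^sub>1 + x\<^sub>2) |T|\<^sup>2 - (x\<^sub>3 + x\<^sub>4) |\<tau>|\<^sup>2\<close>, and since this is both nonnegative and at most
  \<open>- (x\<^sub>1 + x\<^sub>2) |T|\<^sup>2\<close> with \<open>x\<^sub>1 + x\<^sub>2 > 0\<close>, the torsion is zero: the metric is Kaehler.  A nilpotent Lie algebra
  with a Kaehler metric is abelian (\<open>kaehler_nilpotent_imp_abelian\<close>), contrary to assumption.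

  Nilpotency enters through traces of nilpotent endomorphisms.  These are computed in a unitary basis
  adapted to the filtration of the (1,0) vectors by the lower central series: an operator that moves
  each step of the filtration into the next one has zero diagonal entries in such a basis, so
  no theory of the trace is involved.
\<close>

section \<open>Hermitian Lie algebras and unitary bases\<close>

text \<open>
  The complexification \<open>L\<close> of a real Lie algebra: the real algebra is the set of vectors fixed by the
  conjugation \<open>cj\<close>, and \<open>J\<close> and \<open>g\<close> are the complex linear extensions of an integrable complex
  structure and of a compatible metric.  \<open>L\<close> is a carrier set in a larger vector space, because in the
  application it consists of the left-invariant fields among all complex vector fields.
\<close>

locale hermitian_lie_algebra = vector_space scale
  for scale :: "complex \<Rightarrow> 'v::ab_group_add \<Rightarrow> 'v" (infixr "*\<^sub>C" 75) +
  fixes L :: "'v set"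
    and br :: "'v \<Rightarrow> 'v \<Rightarrow> 'v"
    and cj :: "'v \<Rightarrow> 'v"
    and J :: "'v \<Rightarrow> 'v"
    and g :: "'v \<Rightarrow> 'v \<Rightarrow> complex"
  assumes L_subspace: "subspace L"
    and br_closed [simp]: "\<lbrakk>X \<in> L; Y \<in> L\<rbrakk> \<Longrightarrow> br X Y \<in> L"
    and br_add_left [simp]: "\<lbrakk>X \<in> L; Y \<in> L; W \<in> L\<rbrakk> \<Longrightarrow> br (X + Y) W = br X W + br Y W"
    and br_scale_left [simp]: "\<lbrakk>X \<in> L; Y \<in> L\<rbrakk> \<Longrightarrow> br (c *\<^sub>C X) Y = c *\<^sub>C br X Y"
    and br_swap: "\<lbrakk>X \<in> L; Y \<in> L\<rbrakk> \<Longrightarrow> br Y X = - br X Y"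
    and jacobi: "\<lbrakk>X \<in> L; Y \<in> L; W \<in> L\<rbrakk> \<Longrightarrow> br X (br Y W) = br (br X Y) W + br Y (br X W)"
    and cj_closed [simp]: "X \<in> L \<Longrightarrow> cj X \<in> L"
    and cj_add [simp]: "\<lbrakk>X \<in> L; Y \<in> L\<rbrakk> \<Longrightarrow> cj (X + Y) = cj X + cj Y"
    and cj_scale [simp]: "X \<in> L \<Longrightarrow> cj (c *\<^sub>C X) = cnj c *\<^sub>C cj X"
    and cj_cj [simp]: "X \<in> L \<Longrightarrow> cj (cj X) = X"
    and cj_br [simp]: "\<lbrakk>X \<in> L; Y \<in> L\<rbrakk> \<Longrightarrow> cj (br X Y) = br (cj X) (cj Y)"
    and J_closed [simp]: "X \<in> L \<Longrightarrow> J X \<in> L"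
    and J_add [simp]: "\<lbrakk>X \<in> L; Y \<in> L\<rbrakk> \<Longrightarrow> J (X + Y) = J X + J Y"
    and J_scale [simp]: "X \<in> L \<Longrightarrow> J (c *\<^sub>C X) = c *\<^sub>C J X"
    and J_J [simp]: "X \<in> L \<Longrightarrow> J (J X) = - X"
    and J_cj: "X \<in> L \<Longrightarrow> J (cj X) = cj (J X)"
    and integrable: "\<lbrakk>X \<in> L; Y \<in> L\<rbrakk> \<Longrightarrow> br (J X) (J Y) - J (br (J X) Y) - J (br X (J Y)) - br X Y = 0"
    and g_sym: "\<lbrakk>X \<in> L; Y \<in> L\<rbrakk> \<Longrightarrow> g X Y = g Y X"
    and g_add_left [simp]: "\<lbrakk>X \<in> L; Y \<in> L; W \<in> L\<rbrakk> \<Longrightarrow> g (X + Y) W = g X W + g Y W"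
    and g_scale_left [simp]: "\<lbrakk>X \<in> L; Y \<in> L\<rbrakk> \<Longrightarrow> g (c *\<^sub>C X) Y = c * g X Y"
    and g_cj: "\<lbrakk>X \<in> L; Y \<in> L\<rbrakk> \<Longrightarrow> g (cj X) (cj Y) = cnj (g X Y)"
    and g_J: "\<lbrakk>X \<in> L; Y \<in> L\<rbrakk> \<Longrightarrow> g (J X) (J Y) = g X Y"
    and g_pos: "\<lbrakk>X \<in> L; cj X = X; X \<noteq> 0\<rbrakk> \<Longrightarrow> Re (g X X) > 0"
begin

lemma L_closed [simp]:
  "0 \<in> L" "\<lbrakk>X \<in> L; Y \<in> L\<rbrakk> \<Longrightarrow> X + Y \<in> L" "X \<in> L \<Longrightarrow> c *\<^sub>C X \<in> L"
  "X \<in> L \<Longrightarrow> - X \<in> L" "\<lbrakk>X \<in> L; Y \<in> L\<rbrakk> \<Longrightarrow> X - Y \<in> L"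
  using L_subspace by (auto simp: subspace_0 subspace_add subspace_scale subspace_neg subspace_diff)

lemma br_left [simp]:
  "\<lbrakk>X \<in> L; W \<in> L\<rbrakk> \<Longrightarrow> br (- X) W = - br X W"
  "\<lbrakk>X \<in> L; Y \<in> L; W \<in> L\<rbrakk> \<Longrightarrow> br (X - Y) W = br X W - br Y W"
  "W \<in> L \<Longrightarrow> br 0 W = 0"
  using br_scale_left[of _ W "-1"] br_add_left[of X "-Y" W] br_scale_left[of 0 W 0] by simp_all

lemma br_right [simp]:
  "\<lbrakk>X \<in> L; Y \<in> L; W \<in> L\<rbrakk> \<Longrightarrow> br W (X + Y) = br W X + br W Y"
  "\<lbrakk>X \<in> L; W \<in> L\<rbrakk> \<Longrightarrow> br W (c *\<^sub>C X) = c *\<^sub>C br W X"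
  "\<lbrakk>X \<in> L; W \<in> L\<rbrakk> \<Longrightarrow> br W (- X) = - br W X"
  "\<lbrakk>X \<in> L; Y \<in> L; W \<in> L\<rbrakk> \<Longrightarrow> br W (X - Y) = br W X - br W Y"
  "W \<in> L \<Longrightarrow> br W 0 = 0"
  using br_swap[of _ W] by simp_all

lemma cj_simps [simp]:
  "X \<in> L \<Longrightarrow> cj (- X) = - cj X"
  "\<lbrakk>X \<in> L; Y \<in> L\<rbrakk> \<Longrightarrow> cj (X - Y) = cj X - cj Y"
  "cj 0 = 0"
  using cj_scale[of _ "-1"] cj_add[of X "-Y"] cj_scale[of 0 0] by simp_all

lemma J_simps [simp]:
  "X \<in> L \<Longrightarrow> J (- X) = - J X"
  "\<lbrakk>X \<in> L; Y \<in> L\<rbrakk> \<Longrightarrow> J (X - Y) = J X - J Y"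
  "J 0 = 0"
  using J_scale[of _ "-1"] J_add[of X "-Y"] J_scale[of 0 0] by simp_all

lemma g_left [simp]:
  "\<lbrakk>X \<in> L; W \<in> L\<rbrakk> \<Longrightarrow> g (- X) W = - g X W"
  "\<lbrakk>X \<in> L; Y \<in> L; W \<in> L\<rbrakk> \<Longrightarrow> g (X - Y) W = g X W - g Y W"
  "W \<in> L \<Longrightarrow> g 0 W = 0"
  using g_scale_left[of _ W "-1"] g_add_left[of X "-Y" W] g_scale_left[of 0 W 0] by simp_all

lemma g_right [simp]:
  "\<lbrakk>X \<in> L; Y \<in> L; W \<in> L\<rbrakk> \<Longrightarrow> g W (X + Y) = g W X + g W Y"
  "\<lbrakk>X \<in> L; W \<in> L\<rbrakk> \<Longrightarrow> g W (c *\<^sub>C X) = c * g W X"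
  "\<lbrakk>X \<in> L; W \<in> L\<rbrakk> \<Longrightarrow> g W (- X) = - g W X"
  "\<lbrakk>X \<in> L; Y \<in> L; W \<in> L\<rbrakk> \<Longrightarrow> g W (X - Y) = g W X - g W Y"
  "W \<in> L \<Longrightarrow> g W 0 = 0"
  using g_sym[of W] by simp_all

text \<open>
  \<open>T10\<close> is the space of (1,0) vectors and \<open>part10\<close> the projection onto it along the (0,1) vectors, which
  are the conjugates of (1,0) vectors.  \<open>h\<close> is the Hermitian form of \<open>g\<close>, linear in its first argument.
\<close>

definition T10 :: "'v set" where
  "T10 = {X \<in> L. J X = \<i> *\<^sub>C X}"

definition h :: "'v \<Rightarrow> 'v \<Rightarrow> complex" where
  "h X Y = g X (cj Y)"

definition part10 :: "'v \<Rightarrow> 'v" where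
  "part10 X = (1/2) *\<^sub>C (X - \<i> *\<^sub>C J X)"

lemma T10_L [simp]: "X \<in> T10 \<Longrightarrow> X \<in> L"
  by (simp add: T10_def)

lemma J_T10: "X \<in> T10 \<Longrightarrow> J X = \<i> *\<^sub>C X"
  by (simp add: T10_def del: T10_L)

lemma T10I: "X \<in> L \<Longrightarrow> J X = \<i> *\<^sub>C X \<Longrightarrow> X \<in> T10"
  by (simp add: T10_def del: T10_L)

lemma cj_T10I:
  assumes "X \<in> L" "J X = - (\<i> *\<^sub>C X)"
  shows "cj X \<in> T10"
  using assms by (intro T10I) (simp_all add: J_cj)

lemma T10_subspace: "subspace T10"
  by (rule subspaceI) (simp_all add: T10_def scale_right_distrib mult.commute del: T10_L)

lemma T10_closed [simp]:
  "0 \<in> T10" "\<lbrakk>X \<in> T10; Y \<in> T10\<rbrakk> \<Longrightarrow> X + Y \<in> T10" "X \<in> T10 \<Longrightarrow> c *\<^sub>C X \<in> T10"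
  "X \<in> T10 \<Longrightarrow> - X \<in> T10" "\<lbrakk>X \<in> T10; Y \<in> T10\<rbrakk> \<Longrightarrow> X - Y \<in> T10"
  using T10_subspace by (auto simp: subspace_0 subspace_add subspace_scale subspace_neg subspace_diff)

lemma part10_T10 [simp]: "X \<in> L \<Longrightarrow> part10 X \<in> T10"
  by (rule T10I) (simp_all add: part10_def algebra_simps)

lemma part10_linear:
  "X \<in> L \<Longrightarrow> Y \<in> L \<Longrightarrow> part10 (X + Y) = part10 X + part10 Y"
  "X \<in> L \<Longrightarrow> part10 (c *\<^sub>C X) = c *\<^sub>C part10 X"
  by (simp_all add: part10_def algebra_simps)

lemma half_add_half: "(1/2) *\<^sub>C X + (1/2) *\<^sub>C X = X"
  by (simp flip: scale_left_distrib)

lemma part10_T10_id: "X \<in> T10 \<Longrightarrow> part10 X = X"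
  using half_add_half[of X] by (simp add: part10_def J_T10 scale_right_distrib)

lemma cj_diff_part10_T10 [simp]:
  assumes "X \<in> L"
  shows "cj (X - part10 X) \<in> T10"
proof -
  have "X - part10 X = (1/2) *\<^sub>C X + (1/2) *\<^sub>C X - part10 X" by (simp only: half_add_half)
  also have "\<dots> = (1/2) *\<^sub>C (X + \<i> *\<^sub>C J X)" by (simp add: part10_def algebra_simps)
  finally have *: "X - part10 X = (1/2) *\<^sub>C (X + \<i> *\<^sub>C J X)" .
  show ?thesis
    unfolding * using assms by (intro cj_T10I) (simp_all add: algebra_simps)
qed

lemma type_decomposition:
  assumes "X \<in> L"
  obtains U V where "U \<in> T10" "V \<in> T10" "X = U + cj V"
proof
  show "part10 X \<in> T10" "cj (X - part10 X) \<in> T10" using assms by (rule part10_T10, rule cj_diff_part10_T10)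
  have "X - part10 X \<in> L" using assms by simp
  then show "X = part10 X + cj (cj (X - part10 X))" by (simp only: cj_cj) simp
qed

text \<open>
  \<open>J\<close> is an isometry and acts on both arguments by the same factor \<open>\<plusminus>\<i>\<close>, whose square is \<open>-1\<close>.
\<close>

lemma g_T10_eq_0:
  assumes "X \<in> T10" "Y \<in> T10"
  shows "g X Y = 0" "g (cj X) (cj Y) = 0"
proof -
  have "g X Y = - g X Y"
    using g_J[of X Y] assms by (simp add: J_T10)
  then show 1: "g X Y = 0" by simp
  then show "g (cj X) (cj Y) = 0" using assms by (simp add: g_cj)
qed

lemma h_simps [simp]:
  "\<lbrakk>X \<in> L; Y \<in> L; W \<in> L\<rbrakk> \<Longrightarrow> h (X + Y) W = h X W + h Y W"
  "\<lbrakk>X \<in> L; Y \<in> L; W \<in> L\<rbrakk> \<Longrightarrow> h (X - Y) W = h X W - h Y W"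
  "\<lbrakk>X \<in> L; W \<in> L\<rbrakk> \<Longrightarrow> h (- X) W = - h X W"
  "\<lbrakk>X \<in> L; W \<in> L\<rbrakk> \<Longrightarrow> h (c *\<^sub>C X) W = c * h X W"
  "W \<in> L \<Longrightarrow> h 0 W = 0"
  "\<lbrakk>X \<in> L; Y \<in> L; W \<in> L\<rbrakk> \<Longrightarrow> h W (X + Y) = h W X + h W Y"
  "\<lbrakk>X \<in> L; Y \<in> L; W \<in> L\<rbrakk> \<Longrightarrow> h W (X - Y) = h W X - h W Y"
  "\<lbrakk>X \<in> L; W \<in> L\<rbrakk> \<Longrightarrow> h W (- X) = - h W X"
  "\<lbrakk>X \<in> L; W \<in> L\<rbrakk> \<Longrightarrow> h W (c *\<^sub>C X) = cnj c * h W X"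
  "W \<in> L \<Longrightarrow> h W 0 = 0"
  by (simp_all add: h_def)

lemma h_cnj: "\<lbrakk>X \<in> L; Y \<in> L\<rbrakk> \<Longrightarrow> h Y X = cnj (h X Y)"
  using g_cj[of X "cj Y"] by (simp add: h_def g_sym[of Y])

lemma real_decomposition:
  assumes "X \<in> L"
  obtains A B where "A \<in> L" "B \<in> L" "cj A = A" "cj B = B" "X = A + \<i> *\<^sub>C B"
    "A = (1/2) *\<^sub>C (X + cj X)" "B = (- \<i> / 2) *\<^sub>C (X - cj X)"
proof
  let ?A = "(1/2) *\<^sub>C (X + cj X)" and ?B = "(- \<i> / 2) *\<^sub>C (X - cj X)"
  show "?A \<in> L" "?B \<in> L" using assms by simp_all
  show "cj ?A = ?A" "cj ?B = ?B" using assms by (simp_all add: algebra_simps)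
  have "?A + \<i> *\<^sub>C ?B = (1/2) *\<^sub>C X + (1/2) *\<^sub>C X"
    by (simp add: scale_right_distrib scale_right_diff_distrib)
  also have "\<dots> = X" by (rule half_add_half)
  finally show "X = ?A + \<i> *\<^sub>C ?B" by (rule sym)
qed (rule refl)+

lemma h_real: 
  assumes "X \<in> L" shows "h X X = complex_of_real (Re (h X X))"
  using h_cnj[OF assms assms] by (metis complex_is_Real_iff Reals_cnj_iff of_real_Re)

text \<open>
  With \<open>X = A + \<i> B\<close> and \<open>A\<close>, \<open>B\<close> real, the mixed terms of \<open>g X (cj X)\<close> cancel by symmetry, leaving
  \<open>g A A + g B B\<close>.
\<close>

lemma h_pos:
  assumes "X \<in> L" "X \<noteq> 0"
  shows "Re (h X X) > 0"
proof -
  obtain A B where AB: "A \<in> L" "B \<in> L" "cj A = A" "cj B = B" "X = A + \<i> *\<^sub>C B"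
    using real_decomposition[OF assms(1)] by metis
  have "h X X = g A A + g B B"
    using AB by (simp add: h_def g_sym[of B A] algebra_simps)
  moreover have "Re (g A A) \<ge> 0" "Re (g B B) \<ge> 0" "A \<noteq> 0 \<Longrightarrow> Re (g A A) > 0" "B \<noteq> 0 \<Longrightarrow> Re (g B B) > 0"
    using g_pos[of A] g_pos[of B] AB by (cases "A = 0"; cases "B = 0"; simp)+
  moreover have "A \<noteq> 0 \<or> B \<noteq> 0" using AB assms by auto
  ultimately show ?thesis by fastforce
qed

lemma h_ge_0: "X \<in> L \<Longrightarrow> Re (h X X) \<ge> 0"
  using h_pos[of X] by (cases "X = 0") auto

lemma h_eq_0D: "X \<in> L \<Longrightarrow> h X X = 0 \<Longrightarrow> X = 0"
  using h_pos[of X] by auto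

lemma T10_eqI:
  assumes "X \<in> T10" "Y \<in> T10" "\<And>V. V \<in> T10 \<Longrightarrow> h X V = h Y V"
  shows "X = Y"
proof -
  have "h (X - Y) (X - Y) = h X (X - Y) - h Y (X - Y)"
    using assms by (intro h_simps) simp_all
  also have "\<dots> = 0" using assms(3)[of "X - Y"] assms(1,2) by (simp del: h_simps)
  finally show "X = Y" using h_eq_0D[of "X - Y"] assms by simp
qed

text \<open>
  Pairing with \<open>cj V\<close> does not see the (0,1) part, since \<open>g\<close> vanishes on pairs of (0,1) vectors.
\<close>

lemma h_part10:
  assumes "X \<in> L" "V \<in> T10"
  shows "h (part10 X) V = h X V"
proof -
  have "g (X - part10 X) (cj V) = 0"
    using g_T10_eq_0(2)[of "cj (X - part10 X)" V] assms cj_diff_part10_T10[of X] by (simp del: cj_diff_part10_T10 cj_simps)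
  then show ?thesis using assms by (simp add: h_def)
qed

text \<open>
  For (1,0) vectors the Nijenhuis condition reads \<open>- 2 [X, Y] - 2 \<i> J [X, Y] = 0\<close>.
\<close>

lemma br_T10 [simp]:
  assumes "X \<in> T10" "Y \<in> T10"
  shows "br X Y \<in> T10"
proof (rule T10I)
  let ?B = "br X Y"
  have "- ?B - (\<i> *\<^sub>C J ?B) - (\<i> *\<^sub>C J ?B) - ?B = 0"
    using integrable[of X Y] assms by (simp add: J_T10)
  moreover have double: "(U + V) + (U + V) = - (- U - V - V - U)" for U V :: 'v
    by (simp add: algebra_simps)
  ultimately have "(?B + \<i> *\<^sub>C J ?B) + (?B + \<i> *\<^sub>C J ?B) = 0"
    using double[of ?B "\<i> *\<^sub>C J ?B"] by simp
  then have "(1/2) *\<^sub>C ((?B + \<i> *\<^sub>C J ?B) + (?B + \<i> *\<^sub>C J ?B)) = 0"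
    by simp
  then have "?B + \<i> *\<^sub>C J ?B = 0"
    by (simp only: scale_right_distrib[of "1/2" "?B + \<i> *\<^sub>C J ?B"] half_add_half)
  then have "\<i> *\<^sub>C (?B + \<i> *\<^sub>C J ?B) = 0" by simp
  then show "J ?B = \<i> *\<^sub>C ?B" by (simp add: scale_right_distrib)
qed (use assms in simp)

lemma L_sum [simp]: "(\<And>i. i \<in> I \<Longrightarrow> X i \<in> L) \<Longrightarrow> (\<Sum>i\<in>I. X i) \<in> L"
  by (rule subspace_sum[OF L_subspace])

lemma T10_sum [simp]: "(\<And>i. i \<in> I \<Longrightarrow> X i \<in> T10) \<Longrightarrow> (\<Sum>i\<in>I. X i) \<in> T10"
  by (rule subspace_sum[OF T10_subspace])

lemma h_sum:
  assumes "\<And>i. i \<in> I \<Longrightarrow> X i \<in> L" "W \<in> L"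
  shows "h (\<Sum>i\<in>I. X i) W = (\<Sum>i\<in>I. h (X i) W)" "h W (\<Sum>i\<in>I. X i) = (\<Sum>i\<in>I. h W (X i))"
  using assms by (induction I rule: infinite_finite_induct) simp_all

definition orthonormal :: "'v set \<Rightarrow> bool" where
  "orthonormal B \<longleftrightarrow> finite B \<and> B \<subseteq> T10 \<and> (\<forall>e\<in>B. \<forall>f\<in>B. h e f = (if e = f then 1 else 0))"

lemma orthogonal_span:
  assumes "B \<subseteq> L" "V \<in> L" "\<And>e. e \<in> B \<Longrightarrow> h e V = 0" "X \<in> span B"
  shows "h X V = 0"
proof -
  have "subspace {X \<in> L. h X V = 0}"
    using assms(2) by (intro subspaceI) auto
  then have "span B \<subseteq> {X \<in> L. h X V = 0}"
    using assms(1,3) by (intro span_minimal) auto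
  then show ?thesis using assms(4) by auto
qed

lemma orthonormal_independent:
  assumes "orthonormal B"
  shows "independent B"
  unfolding dependent_def
proof safe
  fix a assume a: "a \<in> B" "a \<in> span (B - {a})"
  have "h a a = 0"
    using assms a by (intro orthogonal_span[of "B - {a}" a a]) (auto simp: orthonormal_def)
  then show False using assms a by (auto simp: orthonormal_def)
qed

lemma orthonormal_expansion:
  assumes "orthonormal B" "X \<in> span B"
  shows "X = (\<Sum>e\<in>B. h X e *\<^sub>C e)"
proof -
  have B: "B \<subseteq> T10" "finite B" using assms(1) by (auto simp: orthonormal_def)
  let ?S = "{X \<in> L. X = (\<Sum>e\<in>B. h X e *\<^sub>C e)}"
  have "subspace ?S"
  proof (rule subspaceI)
    fix X Y assume XY: "X \<in> ?S" "Y \<in> ?S"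
    have "(\<Sum>e\<in>B. h (X + Y) e *\<^sub>C e) = (\<Sum>e\<in>B. h X e *\<^sub>C e) + (\<Sum>e\<in>B. h Y e *\<^sub>C e)"
      using XY B by (subst sum.distrib[symmetric], intro sum.cong refl) (simp add: scale_left_distrib subset_eq)
    then show "X + Y \<in> ?S" using XY by auto
  next
    fix c X assume X: "X \<in> ?S"
    have "(\<Sum>e\<in>B. h (c *\<^sub>C X) e *\<^sub>C e) = c *\<^sub>C (\<Sum>e\<in>B. h X e *\<^sub>C e)"
      unfolding scale_sum_right using X B by (intro sum.cong refl) (simp add: subset_eq)
    then show "c *\<^sub>C X \<in> ?S" using X by auto
  qed (use B in \<open>auto simp: subset_eq\<close>)
  moreover have "B \<subseteq> ?S"
  proof
    fix f assume f: "f \<in> B"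
    have "(\<Sum>e\<in>B. h f e *\<^sub>C e) = (\<Sum>e\<in>B. if e = f then f else 0)"
      using assms(1) f by (intro sum.cong refl) (auto simp: orthonormal_def)
    then show "f \<in> ?S" using f B by auto
  qed
  ultimately show ?thesis using assms(2) span_minimal[of B ?S] by blast
qed

lemma parseval:
  assumes "orthonormal B" "X \<in> span B" "Y \<in> L"
  shows "h X Y = (\<Sum>e\<in>B. h X e * cnj (h Y e))"
proof -
  have B: "e \<in> T10" if "e \<in> B" for e using assms(1) that by (auto simp: orthonormal_def)
  have "h X Y = h (\<Sum>e\<in>B. h X e *\<^sub>C e) Y"
    by (rule arg_cong[OF orthonormal_expansion[OF assms(1,2)], where f = "\<lambda>X. h X Y"])
  also have "\<dots> = (\<Sum>e\<in>B. h (h X e *\<^sub>C e) Y)"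
    using B assms(3) by (intro h_sum(1)) simp_all
  also have "\<dots> = (\<Sum>e\<in>B. h X e * cnj (h Y e))"
    using B assms(3) by (intro sum.cong refl) (simp add: h_cnj[of _ Y])
  finally show ?thesis .
qed

text \<open>
  Gram-Schmidt: subtract from a vector outside the span its projection and normalise the rest.  The
  process stops because an orthonormal set is independent and hence no larger than \<open>Fr\<close>.
\<close>

lemma orthonormal_extension:
  assumes Fr: "finite Fr" "F \<subseteq> span Fr"
    and F: "subspace F" "F \<subseteq> T10"
    and B0: "orthonormal B0" "B0 \<subseteq> F"
  obtains B where "B0 \<subseteq> B" "orthonormal B" "span B = F"
proof -
  have "\<exists>B. B0 \<subseteq> B \<and> orthonormal B \<and> span B = F"
    using B0
  proof (induction "card Fr - card B0" arbitrary: B0 rule: less_induct)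
    case less
    have fin: "finite B0" and sub: "B0 \<subseteq> T10"
      and on: "\<And>e f. e \<in> B0 \<Longrightarrow> f \<in> B0 \<Longrightarrow> h e f = (if e = f then 1 else 0)"
      using less.prems by (auto simp: orthonormal_def)
    have span_sub: "span B0 \<subseteq> F" using less.prems F(1) by (intro span_minimal) auto
    show ?case
    proof (cases "span B0 = F")
      case True then show ?thesis using less.prems by auto
    next
      case False
      then obtain v where v: "v \<in> F" "v \<notin> span B0" using span_sub by blast
      define p where "p = (\<Sum>e\<in>B0. h v e *\<^sub>C e)"
      have p: "p \<in> span B0" unfolding p_def by (intro span_sum span_scale span_base)
      have [simp]: "v \<in> T10" "p \<in> T10" using v p span_sub F by auto
      define w where "w = v - p"
      have w: "w \<in> T10" "w \<noteq> 0" "w \<in> F"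
        using v p span_sub F unfolding w_def by (auto intro: subspace_diff)
      have sub': "e \<in> T10" if "e \<in> B0" for e using sub that by auto
      have hpf: "h p f = h v f" if "f \<in> B0" for f
      proof -
        have "h p f = (\<Sum>e\<in>B0. h (h v e *\<^sub>C e) f)"
          unfolding p_def using that sub' by (intro h_sum(1)) simp_all
        also have "\<dots> = (\<Sum>e\<in>B0. if e = f then h v f else 0)"
          using that sub' on by (intro sum.cong refl) simp
        finally show ?thesis using that fin by simp
      qed
      have wf: "h w f = 0" if "f \<in> B0" for f
        using hpf[OF that] that sub' by (simp add: w_def)
      define r where "r = complex_of_real (1 / sqrt (Re (h w w)))"
      define u where "u = r *\<^sub>C w"
      have pos: "Re (h w w) > 0" using h_pos w by simp
      have hw: "h w w = complex_of_real (Re (h w w))" using h_real[of w] w by simp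
      have u: "u \<in> T10" "u \<in> F" using w F by (auto simp: u_def intro: subspace_scale)
      have uu: "h u u = 1"
      proof -
        have "h u u = r * (cnj r * h w w)" using w by (simp add: u_def)
        also have "\<dots> = complex_of_real (1 / sqrt (Re (h w w)) * (1 / sqrt (Re (h w w)) * Re (h w w)))"
          by (subst hw) (simp only: r_def complex_cnj_complex_of_real of_real_mult)
        also have "1 / sqrt (Re (h w w)) * (1 / sqrt (Re (h w w)) * Re (h w w)) = 1"
          using pos by (simp add: field_simps)
        finally show ?thesis by simp
      qed
      have uf: "h u f = 0" "h f u = 0" if "f \<in> B0" for f
      proof -
        show *: "h u f = 0" using that wf w sub' by (simp add: u_def)
        show "h f u = 0" using h_cnj[of u f] * u that sub' by simp
      qed
      have unot: "u \<notin> B0" using uf uu by fastforce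
      have on': "orthonormal (insert u B0)"
        using fin sub on u uu uf unot by (auto simp: orthonormal_def)
      have "card (insert u B0) \<le> card Fr"
        using independent_span_bound[OF Fr(1) orthonormal_independent[OF on']] Fr(2) u less.prems(2) by blast
      then have "card Fr - card (insert u B0) < card Fr - card B0"
        using unot fin by simp
      then show ?thesis
        using less.hyps[of "insert u B0"] on' less.prems u by auto
    qed
  qed
  then show ?thesis using that by blast
qed

section \<open>The lower central series and adapted bases\<close>

text \<open>
  The lower central series over the complex numbers, and its image in the (1,0) vectors.  The steps
  \<open>lcs k\<close> need not be invariant under \<open>J\<close>, so \<open>filtration k\<close> may be larger than \<open>lcs k \<inter> T10\<close>.
\<close>

primrec lcs :: "nat \<Rightarrow> 'v set" where
  "lcs 0 = L"
| "lcs (Suc k) = span {br X Y | X Y. X \<in> L \<and> Y \<in> lcs k}"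

lemma lcs_L: "lcs k \<subseteq> L"
proof (induction k)
  case (Suc k)
  then show ?case unfolding lcs.simps by (intro span_minimal L_subspace) auto
qed simp

lemma lcs_LD: "X \<in> lcs k \<Longrightarrow> X \<in> L"
  using lcs_L by auto

lemma lcs_subspace: "subspace (lcs k)"
  by (cases k) (auto simp: L_subspace)

lemma br_lcs: "X \<in> L \<Longrightarrow> Y \<in> lcs k \<Longrightarrow> br X Y \<in> lcs (Suc k)"
  by (auto intro: span_base)

lemma lcs_decreasing: "lcs (Suc k) \<subseteq> lcs k"
proof (induction k)
  case 0
  show ?case using lcs_L[of 1] by simp
next
  case (Suc k)
  then have "{br X Y | X Y. X \<in> L \<and> Y \<in> lcs (Suc k)} \<subseteq> lcs (Suc k)"
    using br_lcs by blast
  then show ?case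
    unfolding lcs.simps(2)[of "Suc k"] using lcs_subspace by (rule span_minimal)
qed

definition filtration :: "nat \<Rightarrow> 'v set" where
  "filtration k = part10 ` lcs k"

lemma filtration_T10: "filtration k \<subseteq> T10"
  by (auto simp: filtration_def lcs_LD)

lemma filtration_0: "filtration 0 = T10"
proof
  show "T10 \<subseteq> filtration 0"
  proof
    fix X assume "X \<in> T10"
    then show "X \<in> filtration 0" unfolding filtration_def using part10_T10_id[of X] by (intro image_eqI[of _ _ X]) simp_all
  qed
qed (rule filtration_T10)

lemma filtration_subspace: "subspace (filtration k)"
proof (rule subspaceI)
  have "part10 0 \<in> filtration k" unfolding filtration_def using lcs_subspace by (intro imageI subspace_0)
  then show "0 \<in> filtration k" by (simp add: part10_def)
next
  fix x y assume "x \<in> filtration k" "y \<in> filtration k"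
  then obtain X Y where "x = part10 X" "y = part10 Y" "X \<in> lcs k" "Y \<in> lcs k" by (auto simp: filtration_def)
  then show "x + y \<in> filtration k"
    unfolding filtration_def using lcs_subspace
    by (intro image_eqI[of _ _ "X + Y"]) (auto simp: part10_linear lcs_LD intro: subspace_add)
next
  fix c x assume "x \<in> filtration k"
  then obtain X where "x = part10 X" "X \<in> lcs k" by (auto simp: filtration_def)
  then show "c *\<^sub>C x \<in> filtration k"
    unfolding filtration_def using lcs_subspace
    by (intro image_eqI[of _ _ "c *\<^sub>C X"]) (auto simp: part10_linear lcs_LD intro: subspace_scale)
qed

lemma filtration_decreasing: "filtration (Suc k) \<subseteq> filtration k"
  using lcs_decreasing by (auto simp: filtration_def simp del: lcs.simps)

text \<open>
  Each element of the basis lies in some step of the filtration and is orthogonal to the next step.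
\<close>

definition adapted_basis :: "'v set \<Rightarrow> bool" where
  "adapted_basis B \<longleftrightarrow> orthonormal B \<and> span B = T10 \<and>
     (\<forall>e\<in>B. \<exists>k. e \<in> filtration k \<and> (\<forall>f\<in>filtration (Suc k). h f e = 0))"

text \<open>
  Start with the empty basis of the step that is zero and extend upwards from \<open>filtration (Suc k)\<close> to
  \<open>filtration k\<close>; the vectors added are orthogonal to the basis of \<open>filtration (Suc k)\<close> already there.
\<close>

lemma adapted_basis_exists:
  assumes Fr: "finite Fr" "T10 \<subseteq> span Fr" and K: "lcs K = {0}"
  obtains B where "adapted_basis B"
proof -
  let ?P = "\<lambda>k. \<exists>B. orthonormal B \<and> span B = filtration k \<and>
     (\<forall>e\<in>B. \<exists>k. e \<in> filtration k \<and> (\<forall>f\<in>filtration (Suc k). h f e = 0))"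
  have "?P 0"
  proof (rule inc_induct[of 0 K ?P])
    have "orthonormal {} \<and> span {} = filtration K"
      using K by (auto simp: orthonormal_def filtration_def part10_def)
    then show "?P K" by (intro exI[of _ "{}"]) auto
  next
    fix k assume "?P (Suc k)"
    then obtain B0 where B0: "orthonormal B0" "span B0 = filtration (Suc k)"
      "\<forall>e\<in>B0. \<exists>k. e \<in> filtration k \<and> (\<forall>f\<in>filtration (Suc k). h f e = 0)" by blast
    have "B0 \<subseteq> filtration k" using B0(2) filtration_decreasing span_superset[of B0] by blast
    then obtain B where B: "B0 \<subseteq> B" "orthonormal B" "span B = filtration k"
      using orthonormal_extension[OF Fr(1) subset_trans[OF filtration_T10 Fr(2)] filtration_subspace filtration_T10 B0(1)] by blast
    have "\<exists>k. e \<in> filtration k \<and> (\<forall>f\<in>filtration (Suc k). h f e = 0)" if e: "e \<in> B" for e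
    proof (cases "e \<in> B0")
      case False
      have "h f e = 0" if f: "f \<in> filtration (Suc k)" for f
      proof (rule orthogonal_span[of B0])
        show "B0 \<subseteq> L" "e \<in> L" using B e by (auto simp: orthonormal_def)
        show "f \<in> span B0" using f B0 by simp
        show "h b e = 0" if "b \<in> B0" for b
          using that False e B unfolding orthonormal_def by (metis subsetD)
      qed
      moreover have "e \<in> filtration k" using e B(3) span_base by blast
      ultimately show ?thesis by blast
    qed (use B0 in blast)
    then show "?P k" using B by blast
  qed simp
  then show ?thesis using that filtration_0 by (auto simp: adapted_basis_def)
qed

text \<open>
  This takes the place of the vanishing of the trace of a nilpotent endomorphism: in an adapted
  basis every single diagonal entry is zero.
\<close>

lemma adapted_basis_lower:
  assumes "adapted_basis B" "e \<in> B"
    and "\<And>k u. u \<in> filtration k \<Longrightarrow> A u \<in> filtration (Suc k)"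
  shows "h (A e) e = 0"
  using assms unfolding adapted_basis_def by blast

definition center :: "'v set" where
  "center = {X \<in> L. \<forall>Y\<in>L. br X Y = 0}"

lemma center_L: "X \<in> center \<Longrightarrow> X \<in> L"
  by (simp add: center_def)

lemma br_center:
  assumes "X \<in> center" "Y \<in> L"
  shows "br X Y = 0" "br Y X = 0" "br (cj X) Y = 0" "br Y (cj X) = 0"
proof -
  have X: "X \<in> L" using assms by (simp add: center_def)
  show 1: "br X Y = 0" using assms by (simp add: center_def)
  show "br Y X = 0" using 1 br_swap[of X Y] X assms(2) by simp
  have "br X (cj Y) = 0" using assms by (simp add: center_def)
  then have 2: "cj (br X (cj Y)) = 0" by simp
  show 3: "br (cj X) Y = 0" using 2 X assms(2) by simp
  show "br Y (cj X) = 0" using 3 br_swap[of "cj X" Y] X assms(2) by simp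
qed

lemma cj_center: "X \<in> center \<Longrightarrow> cj X \<in> center"
  using br_center(3) by (auto simp: center_def)

end

section \<open>The Chern connection\<close>

text \<open>
  The Chern connection restricted to left-invariant fields.  Since \<open>g\<close> is constant on these, metric
  compatibility has no derivative term.
\<close>

locale chern_hermitian_lie_algebra = hermitian_lie_algebra scale L br cj J g
  for scale :: "complex \<Rightarrow> 'v::ab_group_add \<Rightarrow> 'v" (infixr "*\<^sub>C" 75)
    and L br cj J g +
  fixes D :: "'v \<Rightarrow> 'v \<Rightarrow> 'v"
  assumes D_closed [simp]: "\<lbrakk>X \<in> L; Y \<in> L\<rbrakk> \<Longrightarrow> D X Y \<in> L"
    and D_add_left [simp]: "\<lbrakk>X \<in> L; Y \<in> L; W \<in> L\<rbrakk> \<Longrightarrow> D (X + Y) W = D X W + D Y W"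
    and D_scale_left [simp]: "\<lbrakk>X \<in> L; Y \<in> L\<rbrakk> \<Longrightarrow> D (c *\<^sub>C X) Y = c *\<^sub>C D X Y"
    and D_add_right [simp]: "\<lbrakk>X \<in> L; Y \<in> L; W \<in> L\<rbrakk> \<Longrightarrow> D X (Y + W) = D X Y + D X W"
    and D_scale_right [simp]: "\<lbrakk>X \<in> L; Y \<in> L\<rbrakk> \<Longrightarrow> D X (c *\<^sub>C Y) = c *\<^sub>C D X Y"
    and D_cj: "\<lbrakk>X \<in> L; Y \<in> L\<rbrakk> \<Longrightarrow> D (cj X) (cj Y) = cj (D X Y)"
    and D_J: "\<lbrakk>X \<in> L; Y \<in> L\<rbrakk> \<Longrightarrow> D X (J Y) = J (D X Y)"
    and D_metric: "\<lbrakk>X \<in> L; Y \<in> L; W \<in> L\<rbrakk> \<Longrightarrow> g (D X Y) W + g Y (D X W) = 0"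
    and D_mixed: "\<lbrakk>U \<in> T10; V \<in> T10\<rbrakk> \<Longrightarrow> D U (cj V) - D (cj V) U - br U (cj V) = 0"
begin

definition tor :: "'v \<Rightarrow> 'v \<Rightarrow> 'v" where
  "tor X Y = D X Y - D Y X - br X Y"

definition curv :: "'v \<Rightarrow> 'v \<Rightarrow> 'v \<Rightarrow> 'v" where
  "curv X Y W = D X (D Y W) - D Y (D X W) - D (br X Y) W"

lemma D_zero [simp]: "X \<in> L \<Longrightarrow> D 0 X = 0" "X \<in> L \<Longrightarrow> D X 0 = 0"
  using D_scale_left[of 0 X 0] D_scale_right[of X 0 0] by simp_all

lemma D_T10 [simp]: "X \<in> L \<Longrightarrow> U \<in> T10 \<Longrightarrow> D X U \<in> T10"
  using D_J[of X U] by (intro T10I) (simp_all add: J_T10)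

lemma tor_T10 [simp]: "U \<in> T10 \<Longrightarrow> V \<in> T10 \<Longrightarrow> tor U V \<in> T10"
  by (simp add: tor_def)

lemma tor_linear [simp]:
  "\<lbrakk>X \<in> L; Y \<in> L; W \<in> L\<rbrakk> \<Longrightarrow> tor (X + Y) W = tor X W + tor Y W"
  "\<lbrakk>X \<in> L; Y \<in> L; W \<in> L\<rbrakk> \<Longrightarrow> tor W (X + Y) = tor W X + tor W Y"
  "\<lbrakk>X \<in> L; W \<in> L\<rbrakk> \<Longrightarrow> tor (c *\<^sub>C X) W = c *\<^sub>C tor X W"
  "\<lbrakk>X \<in> L; W \<in> L\<rbrakk> \<Longrightarrow> tor W (c *\<^sub>C X) = c *\<^sub>C tor W X"
  by (simp_all add: tor_def scale_right_diff_distrib)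

lemma tor_swap: "X \<in> L \<Longrightarrow> Y \<in> L \<Longrightarrow> tor Y X = - tor X Y"
  using br_swap[of X Y] by (simp add: tor_def)

lemma tor_cj: "X \<in> L \<Longrightarrow> Y \<in> L \<Longrightarrow> tor (cj X) (cj Y) = cj (tor X Y)"
  by (simp add: tor_def D_cj)

lemma curv_closed [simp]: "X \<in> L \<Longrightarrow> Y \<in> L \<Longrightarrow> W \<in> L \<Longrightarrow> curv X Y W \<in> L"
  by (simp add: curv_def)

lemma h_D_skew:
  assumes "X \<in> L" "U \<in> L" "V \<in> L"
  shows "h (D X U) V = - h U (D (cj X) V)"
  using D_metric[of X U "cj V"] D_cj[of "cj X" V] assms
  by (simp add: h_def eq_neg_iff_add_eq_0)

text \<open>
  Vanishing (1,1) torsion determines the connection in (0,1) directions: \<open>D (cj V) U\<close> is the (1,0)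
  part of \<open>[cj V, U]\<close>, because \<open>D U (cj V)\<close> is of type (0,1).
\<close>

lemma h_D_bar:
  assumes "U \<in> T10" "V \<in> T10" "W \<in> T10"
  shows "h (D (cj V) U) W = h (br (cj V) U) W"
proof -
  have "D (cj V) U = cj (D (cj U) V) + br (cj V) U"
    using D_mixed[of U V] D_cj[of "cj U" V] br_swap[of U "cj V"] assms by (simp add: algebra_simps)
  moreover have "h (cj (D (cj U) V)) W = 0"
    unfolding h_def using assms by (intro g_T10_eq_0) simp_all
  ultimately show ?thesis using assms by simp
qed

text \<open>
  On the quotient of \<open>L\<close> by the (0,1) vectors, which \<open>part10\<close> identifies with \<open>T10\<close>, the operator
  \<open>D (cj V)\<close> is induced by the adjoint action of \<open>cj V\<close>; the (0,1) vectors are invariant under this action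
  by integrability.
\<close>

lemma D_bar_part10:
  assumes "V \<in> T10" "X \<in> L"
  shows "D (cj V) (part10 X) = part10 (br (cj V) X)"
proof (rule T10_eqI)
  fix W assume W: "W \<in> T10"
  have V: "V \<in> L" using assms by simp
  have "br (cj V) (X - part10 X) = cj (br V (cj (X - part10 X)))"
    using assms by (simp del: cj_simps br_right)
  then have "h (br (cj V) (X - part10 X)) W = 0"
    unfolding h_def using assms W br_T10[OF assms(1) cj_diff_part10_T10[OF assms(2)]]
    by (simp del: cj_simps br_right cj_br br_T10 add: g_T10_eq_0)
  then have "h (br (cj V) X) W = h (br (cj V) (part10 X)) W"
    using assms W by simp
  then show "h (D (cj V) (part10 X)) W = h (part10 (br (cj V) X)) W"
    using assms W by (simp add: h_part10 h_D_bar)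
qed (use assms in simp_all)

text \<open>
  In (0,1) directions \<open>D\<close> is induced by an adjoint action and lowers the filtration; in (1,0) directions
  it is minus the adjoint of such an operator.
\<close>

lemma h_D_adapted_eq_0:
  assumes "adapted_basis B" "u \<in> B" "X \<in> L"
  shows "h (D X u) u = 0"
proof -
  have u: "u \<in> T10" using assms by (auto simp: adapted_basis_def orthonormal_def)
  have bar: "h (D (cj V) u) u = 0" if V: "V \<in> T10" for V
  proof (rule adapted_basis_lower[OF assms(1,2)])
    fix k x assume "x \<in> filtration k"
    then obtain X where X: "X \<in> lcs k" "x = part10 X" by (auto simp: filtration_def)
    then have "X \<in> L" by (simp add: lcs_LD)
    then have "D (cj V) x = part10 (br (cj V) X)" using V X by (simp add: D_bar_part10)
    then show "D (cj V) x \<in> filtration (Suc k)"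
      unfolding filtration_def using br_lcs[OF _ X(1), of "cj V"] V by (intro image_eqI) simp_all
  qed
  obtain U V where UV: "U \<in> T10" "V \<in> T10" "X = U + cj V"
    using type_decomposition[OF assms(3)] .
  have "h (D U u) u = - cnj (h (D (cj U) u) u)"
    using UV u h_D_skew[of U u u] h_cnj[of "D (cj U) u" u] by simp
  then show ?thesis using UV u bar by simp
qed

section \<open>The static tensor on central vectors and its trace\<close>

text \<open>
  The tensors of the static equation, contracted over a unitary basis \<open>B\<close>, where the inverse metric is
  the identity.
\<close>

definition S_form :: "'v set \<Rightarrow> 'v \<Rightarrow> 'v \<Rightarrow> complex" where
  "S_form B U V = (\<Sum>e\<in>B. h (curv e (cj e) U) V)"

definition Q1_form :: "'v set \<Rightarrow> 'v \<Rightarrow> 'v \<Rightarrow> complex" where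
  "Q1_form B U V = (\<Sum>e\<in>B. \<Sum>f\<in>B. h (tor U e) f * cnj (h (tor V e) f))"

definition Q2_form :: "'v set \<Rightarrow> 'v \<Rightarrow> 'v \<Rightarrow> complex" where
  "Q2_form B U V = (\<Sum>e\<in>B. \<Sum>f\<in>B. cnj (h (tor e f) U) * h (tor e f) V)"

definition Q3_form :: "'v set \<Rightarrow> 'v \<Rightarrow> 'v \<Rightarrow> complex" where
  "Q3_form B U V = (\<Sum>e\<in>B. \<Sum>f\<in>B. h (tor U e) e * cnj (h (tor V f) f))"

definition Q4_form :: "'v set \<Rightarrow> 'v \<Rightarrow> 'v \<Rightarrow> complex" where
  "Q4_form B U V = 1 / 2 * (\<Sum>e\<in>B. \<Sum>f\<in>B.
     h (tor f e) e * cnj (h (tor f V) U) + cnj (h (tor f e) e) * h (tor f U) V)"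

definition K_form :: "'v set \<Rightarrow> real ^ 4 \<Rightarrow> 'v \<Rightarrow> 'v \<Rightarrow> complex" where
  "K_form B x U V = S_form B U V
     - complex_of_real (x $ 1) * Q1_form B U V - complex_of_real (x $ 2) * Q2_form B U V
     - complex_of_real (x $ 3) * Q3_form B U V - complex_of_real (x $ 4) * Q4_form B U V"

lemma central_parallel:
  assumes "W \<in> center" "W \<in> T10" "U \<in> T10"
  shows "D (cj U) W = 0" "D (cj W) U = 0" "D W U = 0"
proof -
  show "D (cj U) W = 0"
    using assms by (intro T10_eqI) (simp_all add: h_D_bar br_center)
  have 1: "D (cj W) V = 0" if "V \<in> T10" for V
    using assms that by (intro T10_eqI) (simp_all add: h_D_bar br_center)
  show "D (cj W) U = 0" using assms(3) by (rule 1)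
  show "D W U = 0"
    using assms 1 by (intro T10_eqI) (simp_all add: h_D_skew)
qed

lemma tor_central:
  assumes "W \<in> center" "W \<in> T10" "U \<in> T10"
  shows "tor W U = - D U W" "tor U W = D U W"
  using assms by (simp_all add: tor_def central_parallel br_center)

lemma h_tor_central_eq_0:
  assumes "W \<in> center" "W \<in> T10" "U \<in> T10"
  shows "h (tor U W) W = 0"
  using assms by (simp add: tor_central h_D_skew central_parallel)

text \<open>
  Only the middle term of the curvature contributes: \<open>D (cj e) W = 0\<close>, and differentiating \<open>W\<close> in
  the direction of a bracket gives something orthogonal to \<open>W\<close>.
\<close>

lemma S_central:
  assumes B: "orthonormal B" and W: "W \<in> center" "W \<in> T10"
  shows "S_form B W W = (\<Sum>e\<in>B. h (D e W) (D e W))"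
  unfolding S_form_def
proof (intro sum.cong refl)
  fix e assume "e \<in> B"
  then have e: "e \<in> T10" using B by (auto simp: orthonormal_def)
  obtain U V where UV: "U \<in> T10" "V \<in> T10" "br e (cj e) = U + cj V"
    using type_decomposition[of "br e (cj e)"] e by auto
  have "h (D (br e (cj e)) W) W = 0"
    using UV W by (simp add: central_parallel h_D_skew[of U])
  then show "h (curv e (cj e) W) W = h (D e W) (D e W)"
    using e W by (simp add: curv_def central_parallel h_D_skew[of "cj e" "D e W"])
qed

text \<open>
  Parseval, as the torsion of \<open>W\<close> and \<open>e\<close> is \<open>- D e W\<close>.
\<close>

lemma Q1_central:
  assumes B: "orthonormal B" "span B = T10" and W: "W \<in> center" "W \<in> T10"
  shows "Q1_form B W W = (\<Sum>e\<in>B. h (D e W) (D e W))"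
  unfolding Q1_form_def
proof (intro sum.cong refl)
  fix e assume "e \<in> B"
  then have e: "e \<in> T10" using B by (auto simp: orthonormal_def)
  have BT: "f \<in> T10" if "f \<in> B" for f using B(1) that by (auto simp: orthonormal_def)
  show "(\<Sum>f\<in>B. h (tor W e) f * cnj (h (tor W e) f)) = h (D e W) (D e W)"
    using parseval[OF B(1), of "D e W" "D e W"] B(2) e W BT by (simp add: tor_central)
qed

lemma Q4_central:
  assumes B: "orthonormal B" and W: "W \<in> center" "W \<in> T10"
  shows "Q4_form B W W = 0"
proof -
  have "h (tor f W) W = 0" if "f \<in> B" for f
    using h_tor_central_eq_0[of W f] W that B by (auto simp: orthonormal_def)
  then show ?thesis by (simp add: Q4_form_def)
qed

lemma mult_cnj_cmod:
  "z * cnj z = complex_of_real ((cmod z)\<^sup>2)" "cnj z * z = complex_of_real ((cmod z)\<^sup>2)"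
  by (simp_all only: complex_norm_square mult.commute)

lemma Q2_diag: "Q2_form B U U = complex_of_real (\<Sum>e\<in>B. \<Sum>f\<in>B. (cmod (h (tor e f) U))\<^sup>2)"
  unfolding Q2_form_def mult_cnj_cmod by simp

lemma Q3_diag: "Q3_form B U U = complex_of_real ((cmod (\<Sum>e\<in>B. h (tor U e) e))\<^sup>2)"
  by (simp only: Q3_form_def complex_norm_square sum_product cnj_sum)

lemma K_central_nonneg:
  assumes B: "orthonormal B" "span B = T10" and W: "W \<in> center" "W \<in> T10"
    and x: "x $ 1 \<le> 1" "x $ 2 \<le> 0" "x $ 3 \<le> 0"
  shows "Re (K_form B x W W) \<ge> 0"
proof -
  define s where "s = (\<Sum>e\<in>B. Re (h (D e W) (D e W)))"
  have "s \<ge> 0" unfolding s_def using B(1) W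
    by (intro sum_nonneg h_ge_0) (auto simp: orthonormal_def)
  have "Re (K_form B x W W) = (1 - x $ 1) * s + (- x $ 2) * (\<Sum>e\<in>B. \<Sum>f\<in>B. (cmod (h (tor e f) W))\<^sup>2)
    + (- x $ 3) * (cmod (\<Sum>e\<in>B. h (tor W e) e))\<^sup>2"
    using S_central[OF B(1) W] Q1_central[OF B W] Q4_central[OF B(1) W]
    by (simp add: K_form_def Q2_diag Q3_diag s_def algebra_simps del: of_real_sum of_real_power)
  also have "\<dots> \<ge> 0"
    using x \<open>s \<ge> 0\<close> by (intro add_nonneg_nonneg mult_nonneg_nonneg sum_nonneg) auto
  finally show ?thesis .
qed

text \<open>
  The Chern scalar curvature is the trace of a commutator of covariant derivatives minus a covariant
  derivative in the direction of a bracket.  The latter has zero diagonal entries in an adapted basis;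
  the former vanishes because \<open>D e\<close> is minus the adjoint of \<open>D (cj e)\<close>, so that both have the same
  Hilbert-Schmidt norm.
\<close>

lemma trace_S:
  assumes B: "adapted_basis B"
  shows "(\<Sum>u\<in>B. S_form B u u) = 0"
proof -
  have on: "orthonormal B" "span B = T10" using B by (auto simp: adapted_basis_def)
  then have BT: "u \<in> T10" if "u \<in> B" for u using that by (auto simp: orthonormal_def)
  have "(\<Sum>u\<in>B. h (curv e (cj e) u) u) = 0" if e: "e \<in> B" for e
  proof -
    have eL: "e \<in> L" "cj e \<in> L" using BT[OF e] by simp_all
    have pars: "h (D X u) (D X u) = (\<Sum>v\<in>B. h (D X u) v * cnj (h (D X u) v))"
      if "u \<in> B" "X \<in> L" for u X
      using that BT on by (intro parseval) simp_all
    have "(\<Sum>u\<in>B. h (curv e (cj e) u) u)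
        = (\<Sum>u\<in>B. h (D e u) (D e u) - h (D (cj e) u) (D (cj e) u))"
    proof (intro sum.cong refl)
      fix u assume u: "u \<in> B"
      show "h (curv e (cj e) u) u = h (D e u) (D e u) - h (D (cj e) u) (D (cj e) u)"
        using h_D_adapted_eq_0[OF B u, of "br e (cj e)"] eL BT[OF u]
          h_D_skew[of e "D (cj e) u" u] h_D_skew[of "cj e" "D e u" u]
        by (simp add: curv_def)
    qed
    also have "\<dots> = (\<Sum>u\<in>B. h (D e u) (D e u)) - (\<Sum>u\<in>B. h (D (cj e) u) (D (cj e) u))"
      by (rule sum_subtractf)
    also have "(\<Sum>u\<in>B. h (D e u) (D e u)) = (\<Sum>u\<in>B. \<Sum>v\<in>B. h (D e u) v * cnj (h (D e u) v))"
      using pars eL by (intro sum.cong refl) simp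
    also have "\<dots> = (\<Sum>u\<in>B. \<Sum>v\<in>B. h (D (cj e) v) u * cnj (h (D (cj e) v) u))"
    proof (intro sum.cong refl)
      fix u v assume uv: "u \<in> B" "v \<in> B"
      have "h (D e u) v = - cnj (h (D (cj e) v) u)"
        using h_D_skew[of e u v] h_cnj[of "D (cj e) v" u] eL BT uv by simp
      then show "h (D e u) v * cnj (h (D e u) v) = h (D (cj e) v) u * cnj (h (D (cj e) v) u)"
        by simp
    qed
    also have "\<dots> = (\<Sum>v\<in>B. \<Sum>u\<in>B. h (D (cj e) v) u * cnj (h (D (cj e) v) u))"
      by (rule sum.swap)
    also have "\<dots> = (\<Sum>u\<in>B. h (D (cj e) u) (D (cj e) u))"
      using pars eL by (intro sum.cong refl) simp
    finally show ?thesis by simp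
  qed
  then show ?thesis
    unfolding S_form_def by (subst sum.swap) simp
qed

lemma trace_K:
  assumes B: "adapted_basis B"
  shows "(\<Sum>u\<in>B. K_form B x u u) =
    complex_of_real (- (x $ 1 + x $ 2) * (\<Sum>u\<in>B. \<Sum>e\<in>B. \<Sum>f\<in>B. (cmod (h (tor u e) f))\<^sup>2)
      - (x $ 3 + x $ 4) * (\<Sum>u\<in>B. (cmod (\<Sum>e\<in>B. h (tor u e) e))\<^sup>2))"
proof -
  let ?N = "\<Sum>u\<in>B. \<Sum>e\<in>B. \<Sum>f\<in>B. (cmod (h (tor u e) f))\<^sup>2"
  let ?M = "\<Sum>u\<in>B. (cmod (\<Sum>e\<in>B. h (tor u e) e))\<^sup>2"
  have Q1: "(\<Sum>u\<in>B. Q1_form B u u) = complex_of_real ?N"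
    unfolding Q1_form_def mult_cnj_cmod by simp
  have "(\<Sum>u\<in>B. Q2_form B u u) = complex_of_real (\<Sum>u\<in>B. \<Sum>e\<in>B. \<Sum>f\<in>B. (cmod (h (tor e f) u))\<^sup>2)"
    by (simp add: Q2_diag)
  also have "(\<Sum>u\<in>B. \<Sum>e\<in>B. \<Sum>f\<in>B. (cmod (h (tor e f) u))\<^sup>2) = ?N"
  proof -
    have "(\<Sum>u\<in>B. \<Sum>e\<in>B. \<Sum>f\<in>B. (cmod (h (tor e f) u))\<^sup>2) = (\<Sum>e\<in>B. \<Sum>u\<in>B. \<Sum>f\<in>B. (cmod (h (tor e f) u))\<^sup>2)"
      by (rule sum.swap)
    also have "\<dots> = ?N" by (intro sum.cong refl sum.swap)
    finally show ?thesis .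
  qed
  finally have Q2: "(\<Sum>u\<in>B. Q2_form B u u) = complex_of_real ?N" .
  have Q3: "(\<Sum>u\<in>B. Q3_form B u u) = complex_of_real ?M"
    by (simp add: Q3_diag)
  define t where "t f = (\<Sum>e\<in>B. h (tor f e) e)" for f
  have "(\<Sum>u\<in>B. Q4_form B u u) = 1/2 * (\<Sum>u\<in>B. \<Sum>e\<in>B. \<Sum>f\<in>B.
     h (tor f e) e * cnj (h (tor f u) u) + cnj (h (tor f e) e) * h (tor f u) u)"
    by (simp add: Q4_form_def sum_distrib_left)
  also have "(\<Sum>u\<in>B. \<Sum>e\<in>B. \<Sum>f\<in>B.
     h (tor f e) e * cnj (h (tor f u) u) + cnj (h (tor f e) e) * h (tor f u) u)
    = (\<Sum>u\<in>B. \<Sum>f\<in>B. \<Sum>e\<in>B.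
     h (tor f e) e * cnj (h (tor f u) u) + cnj (h (tor f e) e) * h (tor f u) u)"
    by (intro sum.cong refl sum.swap)
  also have "\<dots> = (\<Sum>f\<in>B. \<Sum>u\<in>B. \<Sum>e\<in>B.
     h (tor f e) e * cnj (h (tor f u) u) + cnj (h (tor f e) e) * h (tor f u) u)"
    by (rule sum.swap)
  also have "\<dots> = (\<Sum>f\<in>B. t f * cnj (t f) + cnj (t f) * t f)"
  proof (intro sum.cong refl)
    fix f
    have "(\<Sum>u\<in>B. \<Sum>e\<in>B. h (tor f e) e * cnj (h (tor f u) u)) = t f * cnj (t f)"
      unfolding t_def cnj_sum sum_product by (rule sum.swap)
    moreover have "(\<Sum>u\<in>B. \<Sum>e\<in>B. cnj (h (tor f e) e) * h (tor f u) u) = cnj (t f) * t f"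
      unfolding t_def cnj_sum sum_product by (rule sum.swap)
    ultimately show "(\<Sum>u\<in>B. \<Sum>e\<in>B.
     h (tor f e) e * cnj (h (tor f u) u) + cnj (h (tor f e) e) * h (tor f u) u) = t f * cnj (t f) + cnj (t f) * t f"
      by (simp add: sum.distrib)
  qed
  also have "\<dots> = 2 * complex_of_real ?M"
    unfolding mult_cnj_cmod by (simp add: t_def sum_distrib_left)
  finally have Q4: "(\<Sum>u\<in>B. Q4_form B u u) = complex_of_real ?M" by simp
  have "(\<Sum>u\<in>B. K_form B x u u) = (\<Sum>u\<in>B. S_form B u u)
     - complex_of_real (x $ 1) * (\<Sum>u\<in>B. Q1_form B u u) - complex_of_real (x $ 2) * (\<Sum>u\<in>B. Q2_form B u u)
     - complex_of_real (x $ 3) * (\<Sum>u\<in>B. Q3_form B u u) - complex_of_real (x $ 4) * (\<Sum>u\<in>B. Q4_form B u u)"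
    by (simp add: K_form_def sum_subtractf sum_distrib_left)
  then show ?thesis
    unfolding Q1 Q2 Q3 Q4 trace_S[OF B] by (simp add: algebra_simps del: of_real_sum of_real_power)
qed

end

section \<open>Nilpotent Kaehler algebras are abelian\<close>

context hermitian_lie_algebra
begin

lemma g_J_skew: "X \<in> L \<Longrightarrow> Y \<in> L \<Longrightarrow> g (J X) Y = - g X (J Y)"
  using g_J[of X "J Y"] by simp (metis minus_minus)

lemma center_subspace: "subspace center"
  by (rule subspaceI) (auto simp: center_def)

lemma br_J_center:
  assumes "X \<in> center" "U \<in> L"
  shows "br (J X) (J U) = J (br (J X) U)"
  using integrable[of X U] assms br_center[OF assms(1)] by (simp add: center_L)

text \<open>
  Let \<open>A\<close> be the adjoint action of \<open>J X\<close>, which commutes with \<open>J\<close> by integrability, and let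
  \<open>\<omega> U V = g (J U) V\<close>.  Closedness of \<open>\<omega>\<close> with one argument \<open>X\<close> makes all brackets orthogonal to \<open>J X\<close>, and
  with one argument \<open>J X\<close> it expresses \<open>g [U, V] X\<close> as \<open>- \<omega> (A U) V - \<omega> U (A V)\<close>.  The image of \<open>A\<close> is
  orthogonal to \<open>X\<close>, because \<open>g (A V) X = g (A (J V)) (J X)\<close> and \<open>A (J V)\<close> is a
  bracket.  As \<open>A\<close> is a derivation, this turns into \<open>\<omega> (A (A U)) V + 2 \<omega> (A U) (A V) + \<omega> U (A (A V)) = 0\<close>.  For \<open>V = cj U\<close> and \<open>U\<close> in an adapted
  basis the outer terms vanish and the middle one is \<open>2 \<i> h (A U) (A U)\<close>; so \<open>A = 0\<close>, and
  the formula for \<open>g [U, V] X\<close> gives the claim.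
\<close>

lemma central_orthogonal_brackets:
  assumes closed: "\<And>X Y Z. \<lbrakk>X \<in> L; Y \<in> L; Z \<in> L\<rbrakk> \<Longrightarrow>
      g (J (br X Y)) Z + g (J (br Y Z)) X + g (J (br Z X)) Y = 0"
    and B: "adapted_basis B" and X: "X \<in> center" "cj X = X" and UV: "U \<in> L" "V \<in> L"
  shows "g (br U V) X = 0"
proof -
  have on: "orthonormal B" "span B = T10" using B by (auto simp: adapted_basis_def)
  then have BT: "e \<in> T10" if "e \<in> B" for e using that by (auto simp: orthonormal_def)
  have XL [simp]: "X \<in> L" using X(1) by (rule center_L)
  define A where "A = br (J X)"
  have AL [simp]: "A U \<in> L" if "U \<in> L" for U using that by (simp add: A_def)
  have AJ: "A (J U) = J (A U)" if "U \<in> L" for U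
    using br_J_center[OF X(1) that] by (simp add: A_def)
  have Acj: "A (cj U) = cj (A U)" if "U \<in> L" for U
    using that J_cj[of X] X(2) by (simp add: A_def)
  have AT: "A U \<in> T10" if "U \<in> T10" for U
    using that AJ[of U] by (intro T10I) (simp_all add: J_T10 A_def)
  have orthJX: "g (br U V) (J X) = 0" if "U \<in> L" "V \<in> L" for U V
    using closed[of U V X] that br_center[OF X(1)] by (simp add: g_J_skew)
  have gX: "g (br U V) X = g (J (A V)) U - g (J (A U)) V" if "U \<in> L" "V \<in> L" for U V
    using closed[of U V "J X"] that
    by (simp add: g_J A_def br_swap[of "J X" V] algebra_simps)
  have gAX: "g (A V) X = 0" if "V \<in> L" for V
    using orthJX[of "J X" "J V"] that by (simp add: AJ[symmetric] g_J flip: A_def)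
       (simp add: AJ g_J)
  have quad: "2 * g (J (A U)) (A V) + g (J (A (A U))) V = g (J (A (A V))) U"
    if UV: "U \<in> L" "V \<in> L" for U V
  proof -
    have "A (br U V) = br (A U) V + br U (A V)"
      unfolding A_def using UV by (intro jacobi) simp_all
    then have "0 = g (br (A U) V) X + g (br U (A V)) X"
      using gAX[of "br U V"] UV by simp
    then show ?thesis
      using UV gX[of "A U" V] gX[of U "A V"] g_J_skew[of "A V" "A U"] g_sym[of "A V" "J (A U)"]
      by (simp add: algebra_simps)
  qed
  have Apr: "A (part10 Y) = part10 (A Y)" if "Y \<in> L" for Y
    using that AJ[of Y] by (simp add: part10_def A_def)
  have Afil: "A u \<in> filtration (Suc k)" if u: "u \<in> filtration k" for u k
  proof -
    obtain Y where Y: "Y \<in> lcs k" "u = part10 Y" using u by (auto simp: filtration_def)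
    then have "A u = part10 (A Y)" by (simp add: Apr lcs_LD)
    then show ?thesis
      unfolding filtration_def using br_lcs[OF _ Y(1), of "J X"] by (intro image_eqI) (simp_all add: A_def)
  qed
  have Ae: "A e = 0" if e: "e \<in> B" for e
  proof -
    have eT [simp]: "e \<in> T10" using BT[OF e] .
    have "h (A (A e)) e = 0"
      using filtration_decreasing Afil by (intro adapted_basis_lower[OF B e]) blast
    then have "g (J (A (A e))) (cj e) = 0"
      using AT[of e] AT[of "A e"] by (simp add: J_T10 h_def)
    moreover have "g (J (A (A (cj e)))) e = cnj (g (J (A (A e))) (cj e))"
      using g_cj[of "J (A (A e))" "cj e"] by (simp add: Acj J_cj)
    ultimately have "g (J (A e)) (A (cj e)) = 0"
      using quad[of e "cj e"] by simp
    then have "h (A e) (A e) = 0"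
      using AT[of e] by (simp add: J_T10 Acj h_def)
    then show ?thesis using h_eq_0D[of "A e"] by simp
  qed
  have AT0: "A U = 0" if "U \<in> T10" for U
  proof -
    have "subspace {U \<in> L. A U = 0}" by (intro subspaceI) (auto simp: A_def)
    then have "span B \<subseteq> {U \<in> L. A U = 0}" using Ae BT by (intro span_minimal) auto
    then show ?thesis using that on(2) by auto
  qed
  have A0: "A U = 0" if U: "U \<in> L" for U
  proof -
    obtain U' V' where "U' \<in> T10" "V' \<in> T10" "U = U' + cj V'" using type_decomposition[OF U] .
    then show ?thesis using AT0[of U'] AT0[of V'] Acj[of V'] by (simp add: A_def)
  qed
  show ?thesis using gX[OF UV] A0 UV by simp
qed

text \<open>
  The last nonzero step of the lower central series is central.  If it lay in \<open>[L, L]\<close>, it would be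
  orthogonal to itself; hence \<open>[L, L]\<close> is zero.
\<close>

lemma kaehler_nilpotent_imp_abelian:
  assumes closed: "\<And>X Y Z. \<lbrakk>X \<in> L; Y \<in> L; Z \<in> L\<rbrakk> \<Longrightarrow>
      g (J (br X Y)) Z + g (J (br Y Z)) X + g (J (br Z X)) Y = 0"
    and B: "adapted_basis B" and K: "lcs K = {0}" and XY: "X \<in> L" "Y \<in> L"
  shows "br X Y = 0"
proof -
  have orth: "g (br U V) X = 0" if X: "X \<in> center" and UV: "U \<in> L" "V \<in> L" for X U V
  proof -
    obtain A C where AC: "A \<in> L" "C \<in> L" "cj A = A" "cj C = C" "X = A + \<i> *\<^sub>C C"
      "A = (1/2) *\<^sub>C (X + cj X)" "C = (- \<i> / 2) *\<^sub>C (X - cj X)"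
      using real_decomposition[OF center_L[OF X]] .
    have "A \<in> center" "C \<in> center"
      unfolding AC(6,7) using X cj_center[OF X] center_subspace
      by (auto intro!: subspace_scale subspace_add subspace_diff subspace_neg simp del: cj_simps cj_add scale_right_distrib)
    moreover have "g (br U V) Z = 0" if "Z \<in> center" "cj Z = Z" for Z
      using closed B that UV by (rule central_orthogonal_brackets)
    ultimately have "g (br U V) A = 0" "g (br U V) C = 0"
      using AC(3,4) by simp_all
    then show ?thesis using AC(1,2) UV by (simp add: AC(5))
  qed
  have "lcs 1 = {0}"
  proof (rule inc_induct[of 1 "Suc K" "\<lambda>k. lcs k = {0}"])
    show "lcs (Suc K) = {0}"
      using lcs_decreasing[of K] subspace_0[OF lcs_subspace[of "Suc K"]] K by (auto simp del: lcs.simps)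
  next
    fix k assume k: "1 \<le> k" and IH: "lcs (Suc k) = {0}"
    have "X = 0" if X: "X \<in> lcs k" for X
    proof -
      have XL: "X \<in> L" using X by (rule lcs_LD)
      have "br Y X = 0" if "Y \<in> L" for Y using br_lcs[OF that X] IH by simp
      then have "br X Y = 0" if "Y \<in> L" for Y using br_swap[of Y X] XL that by simp
      then have "X \<in> center" using XL by (simp add: center_def)
      then have c: "cj X \<in> center" by (rule cj_center)
      have "subspace {Y \<in> L. g Y (cj X) = 0}" using XL by (intro subspaceI) auto
      then have "lcs 1 \<subseteq> {Y \<in> L. g Y (cj X) = 0}"
        unfolding One_nat_def lcs.simps using orth[OF c] by (intro span_minimal) auto
      moreover have "lcs k \<subseteq> lcs 1"
        using lift_Suc_antimono_le[of lcs 1 k] lcs_decreasing k by simp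
      ultimately have "h X X = 0" using X by (auto simp: h_def)
      then show ?thesis using XL h_eq_0D by blast
    qed
    then show "lcs k = {0}" using subspace_0[OF lcs_subspace[of k]] by auto
  qed simp
  moreover have "br X Y \<in> lcs 1" using br_lcs[of X Y 0] XY by simp
  ultimately show ?thesis by simp
qed

end

context chern_hermitian_lie_algebra
begin

lemma torsion_free:
  assumes B: "orthonormal B" "span B = T10" and tor: "\<And>e f. e \<in> B \<Longrightarrow> f \<in> B \<Longrightarrow> tor e f = 0"
    and XY: "X \<in> L" "Y \<in> L"
  shows "tor X Y = 0"
proof -
  have BL: "e \<in> L" if "e \<in> B" for e using B(1) that by (auto simp: orthonormal_def)
  have zero: "tor 0 X = 0" "tor X 0 = 0" if "X \<in> L" for X
    using that by (simp_all add: tor_def)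
  have 1: "tor U f = 0" if "U \<in> T10" "f \<in> B" for U f
  proof -
    have "subspace {U \<in> L. tor U f = 0}" using BL that zero by (intro subspaceI) auto
    then have "span B \<subseteq> {U \<in> L. tor U f = 0}" using that tor BL by (intro span_minimal) auto
    then show ?thesis using that B by auto
  qed
  have 2: "tor U V = 0" if U: "U \<in> T10" and V: "V \<in> T10" for U V
  proof -
    have "subspace {V \<in> L. tor U V = 0}" using U zero by (intro subspaceI) auto
    then have "span B \<subseteq> {V \<in> L. tor U V = 0}" using U 1 BL by (intro span_minimal) auto
    then show ?thesis using V B by auto
  qed
  have 3: "tor U (cj V) = 0" if "U \<in> T10" "V \<in> T10" for U V
    using D_mixed[OF that] by (simp add: tor_def)
  have 4: "tor (cj V) U = 0" if "U \<in> T10" "V \<in> T10" for U V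
    using 3[OF that] tor_swap[of U "cj V"] that by simp
  have 5: "tor (cj U) (cj V) = 0" if "U \<in> T10" "V \<in> T10" for U V
    using 2[OF that] that by (simp add: tor_cj)
  obtain U V where "U \<in> T10" "V \<in> T10" "X = U + cj V" using type_decomposition[OF XY(1)] .
  moreover obtain U' V' where "U' \<in> T10" "V' \<in> T10" "Y = U' + cj V'" using type_decomposition[OF XY(2)] .
  ultimately show ?thesis by (simp add: 2 3 4 5)
qed

text \<open>
  For a torsion-free connection the exterior derivative of \<open>g (J X) Y\<close> is the alternation of its covariant
  derivative, which vanishes since \<open>g\<close> and \<open>J\<close> are parallel.
\<close>

lemma torsion_free_imp_closed:
  assumes tor: "\<And>X Y. X \<in> L \<Longrightarrow> Y \<in> L \<Longrightarrow> tor X Y = 0" and XYZ: "X \<in> L" "Y \<in> L" "Z \<in> L"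
  shows "g (J (br X Y)) Z + g (J (br Y Z)) X + g (J (br Z X)) Y = 0"
proof -
  have br: "br X Y = D X Y - D Y X" if "X \<in> L" "Y \<in> L" for X Y
    using tor[OF that] by (simp add: tor_def)
  have par: "g (J (D X Y)) Z = g (J (D X Z)) Y" if "X \<in> L" "Y \<in> L" "Z \<in> L" for X Y Z
    using D_metric[of X "J Y" Z] that g_J_skew[of Y "D X Z"] g_sym[of Y "J (D X Z)"]
    by (simp add: D_J)
  show ?thesis
    using XYZ par[of X Y Z] par[of Y Z X] par[of Z X Y] by (simp add: br)
qed

theorem static_nilpotent_abelian:
  assumes Fr: "finite Fr" "T10 \<subseteq> span Fr" and K: "lcs K = {0}"
    and W: "W \<in> center" "W \<in> T10" "W \<noteq> 0"
    and x: "x $ 1 \<le> 1" "x $ 2 \<le> 0" "x $ 3 \<le> 0" "x $ 1 + x $ 2 > 0" "x $ 3 + x $ 4 \<ge> 0"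
    and static: "\<And>B U V. \<lbrakk>orthonormal B; span B = T10; U \<in> T10; V \<in> T10\<rbrakk> \<Longrightarrow>
      K_form B x U V = complex_of_real \<mu> * h U V"
    and XY: "X \<in> L" "Y \<in> L"
  shows "br X Y = 0"
proof -
  obtain B where B: "adapted_basis B" using adapted_basis_exists[OF Fr K] .
  then have on: "orthonormal B" "span B = T10" by (auto simp: adapted_basis_def)
  then have BT: "e \<in> T10" if "e \<in> B" for e using that by (auto simp: orthonormal_def)
  have "0 \<le> Re (K_form B x W W)" using K_central_nonneg[OF on W(1,2) x(1-3)] .
  also have "\<dots> = \<mu> * Re (h W W)" using static[OF on W(2,2)] by simp
  finally have mu: "\<mu> \<ge> 0"
    using h_pos[of W] W by (simp add: zero_le_mult_iff)
  let ?N = "\<Sum>u\<in>B. \<Sum>e\<in>B. \<Sum>f\<in>B. (cmod (h (tor u e) f))\<^sup>2"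
  let ?M = "\<Sum>u\<in>B. (cmod (\<Sum>e\<in>B. h (tor u e) e))\<^sup>2"
  have "(\<Sum>u\<in>B. K_form B x u u) = complex_of_real (\<mu> * card B)"
    using static[OF on] BT on(1) by (simp add: orthonormal_def)
  then have "\<mu> * card B = - (x $ 1 + x $ 2) * ?N - (x $ 3 + x $ 4) * ?M"
    unfolding trace_K[OF B] of_real_eq_iff by simp
  moreover have "(x $ 3 + x $ 4) * ?M \<ge> 0" using x by (intro mult_nonneg_nonneg sum_nonneg) auto
  moreover have "\<mu> * card B \<ge> 0" using mu by simp
  ultimately have "(x $ 1 + x $ 2) * ?N \<le> 0" by (simp only: mult_minus_left)
  then have "?N \<le> 0" using x(4) by (simp add: mult_le_0_iff)
  moreover have "?N \<ge> 0" by (intro sum_nonneg) simp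
  ultimately have "?N = 0" by simp
  then have N0: "h (tor u e) f = 0" if "u \<in> B" "e \<in> B" "f \<in> B" for u e f
    using that on(1) by (simp add: sum_nonneg_eq_0_iff sum_nonneg orthonormal_def)
  have "tor u e = 0" if "u \<in> B" "e \<in> B" for u e
    using orthonormal_expansion[OF on(1), of "tor u e"] on(2) that BT N0 by simp
  then have "tor X Y = 0" if "X \<in> L" "Y \<in> L" for X Y
    using torsion_free[OF on] that by blast
  then show ?thesis
    using kaehler_nilpotent_imp_abelian[OF _ B K XY] torsion_free_imp_closed by blast
qed

end

section \<open>Contractions in an arbitrary frame\<close>

context hermitian_lie_algebra
begin

definition sesquilinear :: "('v \<Rightarrow> 'v \<Rightarrow> complex) \<Rightarrow> bool" where
  "sesquilinear \<phi> \<longleftrightarrow> (\<forall>U\<in>T10. \<forall>V\<in>T10. \<forall>W\<in>T10. \<forall>c.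
     \<phi> (U + V) W = \<phi> U W + \<phi> V W \<and> \<phi> W (U + V) = \<phi> W U + \<phi> W V \<and>
     \<phi> (c *\<^sub>C U) W = c * \<phi> U W \<and> \<phi> W (c *\<^sub>C U) = cnj c * \<phi> W U)"

lemma sesquilinearI:
  assumes "\<And>U V W. \<lbrakk>U \<in> T10; V \<in> T10; W \<in> T10\<rbrakk> \<Longrightarrow> \<phi> (U + V) W = \<phi> U W + \<phi> V W"
    and "\<And>U V W. \<lbrakk>U \<in> T10; V \<in> T10; W \<in> T10\<rbrakk> \<Longrightarrow> \<phi> W (U + V) = \<phi> W U + \<phi> W V"
    and "\<And>c U W. \<lbrakk>U \<in> T10; W \<in> T10\<rbrakk> \<Longrightarrow> \<phi> (c *\<^sub>C U) W = c * \<phi> U W"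
    and "\<And>c U W. \<lbrakk>U \<in> T10; W \<in> T10\<rbrakk> \<Longrightarrow> \<phi> W (c *\<^sub>C U) = cnj c * \<phi> W U"
  shows "sesquilinear \<phi>"
  using assms by (simp add: sesquilinear_def)

lemma sesquilinear_h: "sesquilinear h"
  by (rule sesquilinearI) simp_all

lemma sesquilinear_mult: "sesquilinear \<phi> \<Longrightarrow> sesquilinear (\<lambda>U V. c * \<phi> U V)"
  by (simp add: sesquilinear_def algebra_simps)

lemma sesquilinear_add: "sesquilinear \<phi> \<Longrightarrow> sesquilinear \<psi> \<Longrightarrow> sesquilinear (\<lambda>U V. \<phi> U V + \<psi> U V)"
  by (simp add: sesquilinear_def algebra_simps)

lemma sesquilinear_diff: "sesquilinear \<phi> \<Longrightarrow> sesquilinear \<psi> \<Longrightarrow> sesquilinear (\<lambda>U V. \<phi> U V - \<psi> U V)"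
  by (simp add: sesquilinear_def algebra_simps)

lemma sesquilinear_sum:
  assumes "\<And>i. i \<in> I \<Longrightarrow> sesquilinear (\<phi> i)"
  shows "sesquilinear (\<lambda>U V. \<Sum>i\<in>I. \<phi> i U V)"
proof (cases "finite I")
  case True
  then show ?thesis using assms
    by (induction I) (simp_all add: sesquilinear_add, simp add: sesquilinear_def)
qed (simp add: sesquilinear_def)

lemma sesquilinear_expand:
  assumes "sesquilinear \<phi>" "\<And>i. i \<in> I \<Longrightarrow> Z i \<in> T10" "\<And>j. j \<in> I' \<Longrightarrow> Z' j \<in> T10"
  shows "\<phi> (\<Sum>i\<in>I. c i *\<^sub>C Z i) (\<Sum>j\<in>I'. d j *\<^sub>C Z' j) = (\<Sum>i\<in>I. \<Sum>j\<in>I'. c i * cnj (d j) * \<phi> (Z i) (Z' j))"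
proof -
  have zero: "\<phi> 0 W = 0" "\<phi> W 0 = 0" if "W \<in> T10" for W
  proof -
    have "\<phi> (0 *\<^sub>C 0) W = 0 * \<phi> 0 W" "\<phi> W (0 *\<^sub>C 0) = cnj 0 * \<phi> W 0"
      using assms(1) that T10_closed(1) unfolding sesquilinear_def by blast+
    then show "\<phi> 0 W = 0" "\<phi> W 0 = 0" by simp_all
  qed
  have left: "\<phi> (\<Sum>i\<in>I. c i *\<^sub>C Z i) W = (\<Sum>i\<in>I. c i * \<phi> (Z i) W)" if "W \<in> T10" for W
    using assms(2)
  proof (induction I rule: infinite_finite_induct)
    case (insert i I)
    then have "\<phi> (c i *\<^sub>C Z i + (\<Sum>i\<in>I. c i *\<^sub>C Z i)) W = \<phi> (c i *\<^sub>C Z i) W + \<phi> (\<Sum>i\<in>I. c i *\<^sub>C Z i) W"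
      using assms(1) that unfolding sesquilinear_def by simp
    moreover have "\<phi> (c i *\<^sub>C Z i) W = c i * \<phi> (Z i) W"
      using insert.prems assms(1) that unfolding sesquilinear_def by simp
    ultimately show ?case using insert by simp
  qed (use zero that in simp_all)
  have right: "\<phi> W (\<Sum>j\<in>I'. d j *\<^sub>C Z' j) = (\<Sum>j\<in>I'. cnj (d j) * \<phi> W (Z' j))" if "W \<in> T10" for W
    using assms(3)
  proof (induction I' rule: infinite_finite_induct)
    case (insert i I)
    then have "\<phi> W (d i *\<^sub>C Z' i + (\<Sum>i\<in>I. d i *\<^sub>C Z' i)) = \<phi> W (d i *\<^sub>C Z' i) + \<phi> W (\<Sum>i\<in>I. d i *\<^sub>C Z' i)"
      using assms(1) that unfolding sesquilinear_def by simp
    moreover have "\<phi> W (d i *\<^sub>C Z' i) = cnj (d i) * \<phi> W (Z' i)"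
      using insert.prems assms(1) that unfolding sesquilinear_def by simp
    ultimately show ?case using insert by simp
  qed (use zero that in simp_all)
  show ?thesis
    using assms(2,3) by (subst left) (simp_all add: right sum_distrib_left mult.assoc)
qed

lemma sum_delta_scale:
  assumes "j < (n::nat)"
  shows "(\<Sum>i<n. (if j = i then 1 else 0) *\<^sub>C Z i) = Z j"
proof -
  have "(\<Sum>i<n. (if j = i then 1 else 0) *\<^sub>C Z i) = (\<Sum>i<n. if j = i then Z i else 0)"
    by (intro sum.cong refl) simp
  then show ?thesis using assms by simp
qed

lemma span_frame:
  assumes "X \<in> span (Z ` {..<n::nat})"
  obtains c where "X = (\<Sum>i<n. c i *\<^sub>C Z i)"
proof -
  have "subspace (range (\<lambda>c. \<Sum>i<n. c i *\<^sub>C Z i))"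
  proof (rule subspaceI)
    show "0 \<in> range (\<lambda>c. \<Sum>i<n. c i *\<^sub>C Z i)"
      by (rule image_eqI[of _ _ "\<lambda>_. 0"]) simp_all
  next
    fix x y assume "x \<in> range (\<lambda>c. \<Sum>i<n. c i *\<^sub>C Z i)" "y \<in> range (\<lambda>c. \<Sum>i<n. c i *\<^sub>C Z i)"
    then obtain c d where "x = (\<Sum>i<n. c i *\<^sub>C Z i)" "y = (\<Sum>i<n. d i *\<^sub>C Z i)" by auto
    then show "x + y \<in> range (\<lambda>c. \<Sum>i<n. c i *\<^sub>C Z i)"
      by (intro image_eqI[of _ _ "\<lambda>i. c i + d i"]) (simp_all add: scale_left_distrib sum.distrib)
  next
    fix a x assume "x \<in> range (\<lambda>c. \<Sum>i<n. c i *\<^sub>C Z i)"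
    then obtain c where "x = (\<Sum>i<n. c i *\<^sub>C Z i)" by auto
    then show "a *\<^sub>C x \<in> range (\<lambda>c. \<Sum>i<n. c i *\<^sub>C Z i)"
      by (intro image_eqI[of _ _ "\<lambda>i. a * c i"]) (simp_all add: scale_sum_right)
  qed
  moreover have "Z ` {..<n} \<subseteq> range (\<lambda>c. \<Sum>i<n. c i *\<^sub>C Z i)"
  proof safe
    fix j assume "j < n"
    then show "Z j \<in> range (\<lambda>c. \<Sum>i<n. c i *\<^sub>C Z i)"
      by (intro image_eqI[of _ _ "\<lambda>i. if j = i then 1 else 0"]) (simp_all only: sum_delta_scale UNIV_I)
  qed
  ultimately have "X \<in> range (\<lambda>c. \<Sum>i<n. c i *\<^sub>C Z i)"
    using assms span_minimal by blast
  then show ?thesis using that by auto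
qed

lemma sesquilinear_eqI:
  assumes "sesquilinear \<phi>" "sesquilinear \<psi>" "T10 = span (Z ` {..<n::nat})"
    and "\<And>i j. i < n \<Longrightarrow> j < n \<Longrightarrow> \<phi> (Z i) (Z j) = \<psi> (Z i) (Z j)" and "U \<in> T10" "V \<in> T10"
  shows "\<phi> U V = \<psi> U V"
proof -
  have Z: "Z i \<in> T10" if "i < n" for i unfolding assms(3) using that by (intro span_base) simp
  obtain c where c: "U = (\<Sum>i<n. c i *\<^sub>C Z i)" using span_frame assms(3,5) by metis
  obtain d where d: "V = (\<Sum>i<n. d i *\<^sub>C Z i)" using span_frame assms(3,6) by metis
  have "\<phi> U V = (\<Sum>i<n. \<Sum>j<n. c i * cnj (d j) * \<phi> (Z i) (Z j))"
    unfolding c d using Z by (intro sesquilinear_expand[OF assms(1)]) simp_all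
  also have "\<dots> = (\<Sum>i<n. \<Sum>j<n. c i * cnj (d j) * \<psi> (Z i) (Z j))"
    using assms(4) by (intro sum.cong refl) simp
  also have "\<dots> = \<psi> U V"
    unfolding c d using Z by (intro sesquilinear_expand[OF assms(2), symmetric]) simp_all
  finally show ?thesis .
qed

definition frame :: "nat \<Rightarrow> (nat \<Rightarrow> 'v) \<Rightarrow> bool" where
  "frame n Z \<longleftrightarrow> T10 = span (Z ` {..<n}) \<and> (\<forall>c. (\<Sum>i<n. c i *\<^sub>C Z i) = 0 \<longrightarrow> (\<forall>i<n. c i = 0))"

definition inverse_metric :: "nat \<Rightarrow> (nat \<Rightarrow> 'v) \<Rightarrow> (nat \<Rightarrow> nat \<Rightarrow> complex) \<Rightarrow> bool" where
  "inverse_metric n Z H \<longleftrightarrow>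
     (\<forall>i<n. \<forall>k<n. (\<Sum>l<n. H k l * h (Z i) (Z l)) = (if i = k then 1 else 0))"

text \<open>
  If \<open>\<epsilon>\<close> is the matrix that expresses a unitary basis in the frame, then the inverse metric is \<open>\<epsilon>\<close>
  contracted with its conjugate.  In particular it exists and is unique on the indices below \<open>n\<close>.
\<close>

lemma inverse_metric_unitary:
  assumes B: "orthonormal B" "span B = T10" and Z: "frame n Z"
    and eps: "\<And>e. e \<in> B \<Longrightarrow> e = (\<Sum>i<n. \<epsilon> e i *\<^sub>C Z i)"
  shows "inverse_metric n Z H \<longleftrightarrow> (\<forall>k<n. \<forall>l<n. H k l = (\<Sum>e\<in>B. \<epsilon> e k * cnj (\<epsilon> e l)))"
proof -
  have ZT: "Z i \<in> T10" if "i < n" for i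
    using Z that unfolding frame_def by (auto intro: span_base)
  have BT: "e \<in> T10" if "e \<in> B" for e using B(1) that by (auto simp: orthonormal_def)
  have dual: "(\<Sum>e\<in>B. h (Z i) e * \<epsilon> e k) = (if i = k then 1 else 0)" if "i < n" "k < n" for i k
  proof -
    have "Z i = (\<Sum>e\<in>B. h (Z i) e *\<^sub>C e)"
      using orthonormal_expansion[OF B(1)] B(2) ZT that by simp
    also have "\<dots> = (\<Sum>e\<in>B. h (Z i) e *\<^sub>C (\<Sum>k<n. \<epsilon> e k *\<^sub>C Z k))"
      by (intro sum.cong refl arg_cong[where f = "scale _"] eps)
    also have "\<dots> = (\<Sum>e\<in>B. \<Sum>k<n. (h (Z i) e * \<epsilon> e k) *\<^sub>C Z k)"
      by (simp add: scale_sum_right)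
    also have "\<dots> = (\<Sum>k<n. \<Sum>e\<in>B. (h (Z i) e * \<epsilon> e k) *\<^sub>C Z k)"
      by (rule sum.swap)
    also have "\<dots> = (\<Sum>k<n. (\<Sum>e\<in>B. h (Z i) e * \<epsilon> e k) *\<^sub>C Z k)"
      by (simp add: scale_sum_left)
    finally have 1: "Z i = (\<Sum>k<n. (\<Sum>e\<in>B. h (Z i) e * \<epsilon> e k) *\<^sub>C Z k)" .
    have "(\<Sum>k<n. (if i = k then 1 else 0) *\<^sub>C Z k) = Z i"
      using that(1) by (rule sum_delta_scale)
    then have "(\<Sum>k<n. ((\<Sum>e\<in>B. h (Z i) e * \<epsilon> e k) - (if i = k then 1 else 0)) *\<^sub>C Z k) = 0"
      using 1 by (simp add: scale_left_diff_distrib sum_subtractf)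
    then show ?thesis using Z that unfolding frame_def by fastforce
  qed
  have hZe: "(\<Sum>l<n. cnj (\<epsilon> e l) * h (Z i) (Z l)) = h (Z i) e" if "i < n" "e \<in> B" for i e
  proof -
    have "h (Z i) e = h (Z i) (\<Sum>l<n. \<epsilon> e l *\<^sub>C Z l)"
      by (rule arg_cong[OF eps[OF that(2)]])
    also have "\<dots> = (\<Sum>l<n. h (Z i) (\<epsilon> e l *\<^sub>C Z l))"
      using ZT that by (intro h_sum(2)) simp_all
    also have "\<dots> = (\<Sum>l<n. cnj (\<epsilon> e l) * h (Z i) (Z l))"
      using ZT that by (intro sum.cong refl) simp
    finally show ?thesis by simp
  qed
  show ?thesis
  proof
    assume H: "\<forall>k<n. \<forall>l<n. H k l = (\<Sum>e\<in>B. \<epsilon> e k * cnj (\<epsilon> e l))"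
    show "inverse_metric n Z H"
      unfolding inverse_metric_def
    proof (intro allI impI)
      fix i k assume ik: "i < n" "k < n"
      have "(\<Sum>l<n. H k l * h (Z i) (Z l)) = (\<Sum>l<n. \<Sum>e\<in>B. \<epsilon> e k * (cnj (\<epsilon> e l) * h (Z i) (Z l)))"
        using H ik by (intro sum.cong refl) (simp add: sum_distrib_right mult.assoc)
      also have "\<dots> = (\<Sum>e\<in>B. \<Sum>l<n. \<epsilon> e k * (cnj (\<epsilon> e l) * h (Z i) (Z l)))"
        by (rule sum.swap)
      also have "\<dots> = (\<Sum>e\<in>B. h (Z i) e * \<epsilon> e k)"
        using hZe ik by (intro sum.cong refl) (simp add: sum_distrib_left[symmetric] mult.commute)
      finally show "(\<Sum>l<n. H k l * h (Z i) (Z l)) = (if i = k then 1 else 0)"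
        using dual[OF ik] by simp
    qed
  next
    assume H: "inverse_metric n Z H"
    show "\<forall>k<n. \<forall>l<n. H k l = (\<Sum>e\<in>B. \<epsilon> e k * cnj (\<epsilon> e l))"
    proof (intro allI impI)
      fix k l assume kl: "k < n" "l < n"
      have heZ: "h e (Z m) = (\<Sum>i<n. \<epsilon> e i * h (Z i) (Z m))" if "e \<in> B" "m < n" for e m
      proof -
        have "h e (Z m) = cnj (h (Z m) e)" using h_cnj[of "Z m" e] ZT BT that by simp
        also have "\<dots> = (\<Sum>i<n. \<epsilon> e i * cnj (h (Z m) (Z i)))"
          using arg_cong[OF hZe[OF that(2,1)], of cnj] by simp
        also have "\<dots> = (\<Sum>i<n. \<epsilon> e i * h (Z i) (Z m))"
          using ZT that by (intro sum.cong refl) (simp add: h_cnj[of "Z m"])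
        finally show ?thesis .
      qed
      have eps_H: "(\<Sum>m<n. H k m * h e (Z m)) = \<epsilon> e k" if e: "e \<in> B" for e
      proof -
        have "(\<Sum>m<n. H k m * h e (Z m)) = (\<Sum>m<n. \<Sum>i<n. \<epsilon> e i * (H k m * h (Z i) (Z m)))"
          using e by (intro sum.cong refl) (simp add: heZ sum_distrib_left mult.left_commute)
        also have "\<dots> = (\<Sum>i<n. \<Sum>m<n. \<epsilon> e i * (H k m * h (Z i) (Z m)))"
          by (rule sum.swap)
        also have "\<dots> = (\<Sum>i<n. if i = k then \<epsilon> e i else 0)"
          using H kl unfolding inverse_metric_def
          by (intro sum.cong refl) (simp add: sum_distrib_left[symmetric])
        finally show ?thesis using kl by simp
      qed
      have "(\<Sum>e\<in>B. \<epsilon> e k * cnj (\<epsilon> e l)) = (\<Sum>e\<in>B. \<Sum>m<n. H k m * (h e (Z m) * cnj (\<epsilon> e l)))"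
        by (intro sum.cong refl) (simp add: eps_H[symmetric] sum_distrib_right mult.assoc)
      also have "\<dots> = (\<Sum>m<n. \<Sum>e\<in>B. H k m * (h e (Z m) * cnj (\<epsilon> e l)))"
        by (rule sum.swap)
      also have "\<dots> = (\<Sum>m<n. if m = l then H k m else 0)"
      proof (intro sum.cong refl)
        fix m assume "m \<in> {..<n}"
        then have m: "m < n" by simp
        have "(\<Sum>e\<in>B. h e (Z m) * cnj (\<epsilon> e l)) = (\<Sum>e\<in>B. cnj (h (Z m) e * \<epsilon> e l))"
          using ZT[OF m] BT by (intro sum.cong refl) (simp add: h_cnj[of "Z m"])
        also have "\<dots> = cnj (if m = l then 1 else 0)"
          by (simp only: cnj_sum[symmetric] dual[OF m kl(2)])
        finally show "(\<Sum>e\<in>B. H k m * (h e (Z m) * cnj (\<epsilon> e l))) = (if m = l then H k m else 0)"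
          by (simp add: sum_distrib_left[symmetric] split: if_splits)
      qed
      also have "\<dots> = H k l" using kl by simp
      finally show "H k l = (\<Sum>e\<in>B. \<epsilon> e k * cnj (\<epsilon> e l))" by simp
    qed
  qed
qed

lemma frame_T10: "frame n Z \<Longrightarrow> i < n \<Longrightarrow> Z i \<in> T10"
  unfolding frame_def by (auto intro: span_base)

lemma unitary_coefficients:
  assumes B: "orthonormal B" "span B = T10" and Z: "frame n Z"
  obtains \<epsilon> where "\<And>e. e \<in> B \<Longrightarrow> e = (\<Sum>i<n. \<epsilon> e i *\<^sub>C Z i)"
proof -
  have "\<exists>c. e = (\<Sum>i<n. c i *\<^sub>C Z i)" if "e \<in> B" for e
    using span_frame[of e Z n] B Z that unfolding frame_def orthonormal_def by blast
  then show ?thesis using that by metis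
qed

lemma inverse_metric_exists:
  assumes B: "orthonormal B" "span B = T10" and Z: "frame n Z"
  shows "\<exists>H. inverse_metric n Z H"
proof -
  obtain \<epsilon> where "\<And>e. e \<in> B \<Longrightarrow> e = (\<Sum>i<n. \<epsilon> e i *\<^sub>C Z i)"
    using unitary_coefficients[OF B Z] by blast
  then show ?thesis
    using inverse_metric_unitary[OF B Z, of \<epsilon> "\<lambda>k l. \<Sum>e\<in>B. \<epsilon> e k * cnj (\<epsilon> e l)"] by auto
qed

lemma contraction:
  assumes B: "orthonormal B" "span B = T10" and Z: "frame n Z" and H: "inverse_metric n Z H"
    and \<phi>: "sesquilinear \<phi>"
  shows "(\<Sum>k<n. \<Sum>l<n. H k l * \<phi> (Z k) (Z l)) = (\<Sum>e\<in>B. \<phi> e e)"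
proof -
  obtain \<epsilon> where eps: "\<And>e. e \<in> B \<Longrightarrow> e = (\<Sum>i<n. \<epsilon> e i *\<^sub>C Z i)"
    using unitary_coefficients[OF B Z] by blast
  have "(\<Sum>k<n. \<Sum>l<n. H k l * \<phi> (Z k) (Z l))
      = (\<Sum>k<n. \<Sum>l<n. \<Sum>e\<in>B. \<epsilon> e k * cnj (\<epsilon> e l) * \<phi> (Z k) (Z l))"
    using inverse_metric_unitary[OF B Z, of \<epsilon> H] eps H
    by (intro sum.cong refl) (simp add: sum_distrib_right)
  also have "\<dots> = (\<Sum>k<n. \<Sum>e\<in>B. \<Sum>l<n. \<epsilon> e k * cnj (\<epsilon> e l) * \<phi> (Z k) (Z l))"
    by (intro sum.cong refl sum.swap)
  also have "\<dots> = (\<Sum>e\<in>B. \<Sum>k<n. \<Sum>l<n. \<epsilon> e k * cnj (\<epsilon> e l) * \<phi> (Z k) (Z l))"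
    by (rule sum.swap)
  also have "\<dots> = (\<Sum>e\<in>B. \<phi> e e)"
  proof (intro sum.cong refl)
    fix e assume e: "e \<in> B"
    have "\<phi> e e = \<phi> (\<Sum>i<n. \<epsilon> e i *\<^sub>C Z i) (\<Sum>i<n. \<epsilon> e i *\<^sub>C Z i)"
      by (intro arg_cong2[where f = \<phi>] eps e)
    also have "\<dots> = (\<Sum>k<n. \<Sum>l<n. \<epsilon> e k * cnj (\<epsilon> e l) * \<phi> (Z k) (Z l))"
      using frame_T10[OF Z] by (intro sesquilinear_expand[OF \<phi>]) simp_all
    finally show "(\<Sum>k<n. \<Sum>l<n. \<epsilon> e k * cnj (\<epsilon> e l) * \<phi> (Z k) (Z l)) = \<phi> e e" by simp
  qed
  finally show ?thesis .
qed

text \<open>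
  The inner contraction, for fixed outer arguments, replaces both inner arguments by the same basis vector;
  hence the second hypothesis, on which the outer contraction rests, has equal inner arguments.
\<close>

lemma double_contraction:
  assumes B: "orthonormal B" "span B = T10" and Z: "frame n Z" and H: "inverse_metric n Z H"
    and 1: "\<And>U V. U \<in> T10 \<Longrightarrow> V \<in> T10 \<Longrightarrow> sesquilinear (\<Phi> U V)"
    and 2: "\<And>U. U \<in> T10 \<Longrightarrow> sesquilinear (\<lambda>V W. \<Phi> V W U U)"
  shows "(\<Sum>k<n. \<Sum>l<n. \<Sum>m<n. \<Sum>r<n. H k l * H m r * \<Phi> (Z k) (Z l) (Z m) (Z r))
    = (\<Sum>e\<in>B. \<Sum>f\<in>B. \<Phi> e e f f)"
proof -
  have BT: "e \<in> T10" if "e \<in> B" for e using B(1) that by (auto simp: orthonormal_def)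
  have "(\<Sum>k<n. \<Sum>l<n. \<Sum>m<n. \<Sum>r<n. H k l * H m r * \<Phi> (Z k) (Z l) (Z m) (Z r))
    = (\<Sum>k<n. \<Sum>l<n. H k l * (\<Sum>f\<in>B. \<Phi> (Z k) (Z l) f f))"
    using contraction[OF B Z H 1] frame_T10[OF Z]
    by (intro sum.cong refl) (simp add: sum_distrib_left mult.assoc flip: sum_distrib_left)
  also have "\<dots> = (\<Sum>e\<in>B. \<Sum>f\<in>B. \<Phi> e e f f)"
    using 2 BT by (intro contraction[OF B Z H] sesquilinear_sum) simp
  finally show ?thesis .
qed

end

context chern_hermitian_lie_algebra
begin

lemma curv_linear:
  "\<lbrakk>X \<in> L; X' \<in> L; Y \<in> L; W \<in> L\<rbrakk> \<Longrightarrow> curv (X + X') Y W = curv X Y W + curv X' Y W"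
  "\<lbrakk>X \<in> L; X' \<in> L; Y \<in> L; W \<in> L\<rbrakk> \<Longrightarrow> curv Y (X + X') W = curv Y X W + curv Y X' W"
  "\<lbrakk>X \<in> L; X' \<in> L; Y \<in> L; W \<in> L\<rbrakk> \<Longrightarrow> curv Y W (X + X') = curv Y W X + curv Y W X'"
  "\<lbrakk>X \<in> L; Y \<in> L; W \<in> L\<rbrakk> \<Longrightarrow> curv (c *\<^sub>C X) Y W = c *\<^sub>C curv X Y W"
  "\<lbrakk>X \<in> L; Y \<in> L; W \<in> L\<rbrakk> \<Longrightarrow> curv Y (c *\<^sub>C X) W = c *\<^sub>C curv Y X W"
  "\<lbrakk>X \<in> L; Y \<in> L; W \<in> L\<rbrakk> \<Longrightarrow> curv Y W (c *\<^sub>C X) = c *\<^sub>C curv Y W X"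
  by (simp_all add: curv_def scale_right_diff_distrib)

lemma sesquilinear_K_form:
  assumes "orthonormal B"
  shows "sesquilinear (K_form B x)"
proof -
  have BT: "e \<in> T10" if "e \<in> B" for e using assms that by (auto simp: orthonormal_def)
  have "sesquilinear (S_form B)"
    unfolding S_form_def[abs_def]
    by (intro sesquilinear_sum) (auto intro!: sesquilinearI simp: curv_linear BT)
  moreover have "sesquilinear (Q1_form B)"
    unfolding Q1_form_def[abs_def]
    by (intro sesquilinear_sum) (auto intro!: sesquilinearI simp: BT algebra_simps)
  moreover have "sesquilinear (Q2_form B)"
    unfolding Q2_form_def[abs_def]
    by (intro sesquilinear_sum) (auto intro!: sesquilinearI simp: BT algebra_simps)
  moreover have "sesquilinear (Q3_form B)"
    unfolding Q3_form_def[abs_def]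
    by (intro sesquilinear_sum) (auto intro!: sesquilinearI simp: BT algebra_simps)
  moreover have "sesquilinear (Q4_form B)"
    unfolding Q4_form_def[abs_def]
    by (intro sesquilinear_mult sesquilinear_sum) (auto intro!: sesquilinearI simp: BT algebra_simps)
  ultimately show ?thesis
    unfolding K_form_def[abs_def] by (intro sesquilinear_diff sesquilinear_mult)
qed

text \<open>
  The components of the static tensor in a frame, with \<open>l\<close> and \<open>r\<close> as the barred summation indices.
\<close>

definition K_frame :: "nat \<Rightarrow> (nat \<Rightarrow> 'v) \<Rightarrow> (nat \<Rightarrow> nat \<Rightarrow> complex) \<Rightarrow> real ^ 4 \<Rightarrow> nat \<Rightarrow> nat \<Rightarrow> complex" where
  "K_frame n Z H x i j =
     (\<Sum>k<n. \<Sum>l<n. H k l * h (curv (Z k) (cj (Z l)) (Z i)) (Z j))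
     - complex_of_real (x $ 1) * (\<Sum>k<n. \<Sum>l<n. \<Sum>m<n. \<Sum>r<n. H k l * H m r *
         h (tor (Z i) (Z k)) (Z r) * cnj (h (tor (Z j) (Z l)) (Z m)))
     - complex_of_real (x $ 2) * (\<Sum>k<n. \<Sum>l<n. \<Sum>m<n. \<Sum>r<n. H k l * H m r *
         cnj (h (tor (Z l) (Z r)) (Z i)) * h (tor (Z k) (Z m)) (Z j))
     - complex_of_real (x $ 3) * (\<Sum>k<n. \<Sum>l<n. \<Sum>m<n. \<Sum>r<n. H k l * H m r *
         h (tor (Z i) (Z k)) (Z l) * cnj (h (tor (Z j) (Z r)) (Z m)))
     - complex_of_real (x $ 4) * (1 / 2 * (\<Sum>k<n. \<Sum>l<n. \<Sum>m<n. \<Sum>r<n. H k l * H m r *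
         (h (tor (Z m) (Z k)) (Z l) * cnj (h (tor (Z r) (Z j)) (Z i)) +
          cnj (h (tor (Z r) (Z l)) (Z k)) * h (tor (Z m) (Z i)) (Z j))))"

lemma K_frame_eq:
  assumes B: "orthonormal B" "span B = T10" and Z: "frame n Z" and H: "inverse_metric n Z H"
    and i: "i < n" and j: "j < n"
  shows "K_frame n Z H x i j = K_form B x (Z i) (Z j)"
proof -
  have ZT [simp]: "Z i \<in> T10" "Z j \<in> T10" using frame_T10[OF Z] i j by auto
  note dc = double_contraction[OF B Z H]
  have S: "(\<Sum>k<n. \<Sum>l<n. H k l * h (curv (Z k) (cj (Z l)) (Z i)) (Z j)) = S_form B (Z i) (Z j)"
    unfolding S_form_def
    by (rule contraction[OF B Z H]) (rule sesquilinearI; simp add: curv_linear)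
  have Q1: "(\<Sum>k<n. \<Sum>l<n. \<Sum>m<n. \<Sum>r<n. H k l * H m r *
         (h (tor (Z i) (Z k)) (Z r) * cnj (h (tor (Z j) (Z l)) (Z m)))) = Q1_form B (Z i) (Z j)"
    unfolding Q1_form_def
    by (rule dc[of "\<lambda>k l m r. h (tor (Z i) k) r * cnj (h (tor (Z j) l) m)"];
        rule sesquilinearI; simp add: algebra_simps)
  have Q2: "(\<Sum>k<n. \<Sum>l<n. \<Sum>m<n. \<Sum>r<n. H k l * H m r *
         (cnj (h (tor (Z l) (Z r)) (Z i)) * h (tor (Z k) (Z m)) (Z j))) = Q2_form B (Z i) (Z j)"
    unfolding Q2_form_def
    by (rule dc[of "\<lambda>k l m r. cnj (h (tor l r) (Z i)) * h (tor k m) (Z j)"];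
        rule sesquilinearI; simp add: algebra_simps)
  have Q3: "(\<Sum>k<n. \<Sum>l<n. \<Sum>m<n. \<Sum>r<n. H k l * H m r *
         (h (tor (Z i) (Z k)) (Z l) * cnj (h (tor (Z j) (Z r)) (Z m)))) = Q3_form B (Z i) (Z j)"
    unfolding Q3_form_def
    by (rule dc[of "\<lambda>k l m r. h (tor (Z i) k) l * cnj (h (tor (Z j) r) m)"];
        rule sesquilinearI; simp add: algebra_simps)
  have Q4: "(\<Sum>k<n. \<Sum>l<n. \<Sum>m<n. \<Sum>r<n. H k l * H m r *
         (h (tor (Z m) (Z k)) (Z l) * cnj (h (tor (Z r) (Z j)) (Z i)) +
          cnj (h (tor (Z r) (Z l)) (Z k)) * h (tor (Z m) (Z i)) (Z j)))
      = (\<Sum>e\<in>B. \<Sum>f\<in>B. h (tor f e) e * cnj (h (tor f (Z j)) (Z i)) + cnj (h (tor f e) e) * h (tor f (Z i)) (Z j))"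
    by (rule dc[of "\<lambda>k l m r. h (tor m k) l * cnj (h (tor r (Z j)) (Z i)) + cnj (h (tor r l) k) * h (tor m (Z i)) (Z j)"];
        rule sesquilinearI; simp add: algebra_simps)
  show ?thesis
    unfolding K_frame_def K_form_def Q4_form_def
    using S Q1 Q2 Q3 Q4 by (simp only: mult.assoc)
qed

theorem static_frame_abelian:
  assumes Z: "frame n Z" and H: "inverse_metric n Z H" and K: "lcs K = {0}"
    and W: "W \<in> center" "W \<in> T10" "W \<noteq> 0"
    and x: "x $ 1 \<le> 1" "x $ 2 \<le> 0" "x $ 3 \<le> 0" "x $ 1 + x $ 2 > 0" "x $ 3 + x $ 4 \<ge> 0"
    and static: "\<And>i j. \<lbrakk>i < n; j < n\<rbrakk> \<Longrightarrow> K_frame n Z H x i j = complex_of_real \<mu> * h (Z i) (Z j)"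
    and XY: "X \<in> L" "Y \<in> L"
  shows "br X Y = 0"
proof (rule static_nilpotent_abelian[where Fr = "Z ` {..<n}" and x = x and \<mu> = \<mu>])
  show "T10 \<subseteq> span (Z ` {..<n})" using Z by (simp add: frame_def)
  fix B U V assume B: "orthonormal B" "span B = T10" and UV: "U \<in> T10" "V \<in> T10"
  show "K_form B x U V = complex_of_real \<mu> * h U V"
  proof (rule sesquilinear_eqI[where Z = Z and n = n])
    show "sesquilinear (K_form B x)" using B(1) by (rule sesquilinear_K_form)
    show "sesquilinear (\<lambda>U V. complex_of_real \<mu> * h U V)" by (intro sesquilinear_mult sesquilinear_h)
    show "T10 = span (Z ` {..<n})" using Z by (simp add: frame_def)
    fix i j assume "i < n" "j < n"
    then show "K_form B x (Z i) (Z j) = complex_of_real \<mu> * h (Z i) (Z j)"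
      using static K_frame_eq[OF B Z H] by simp
  qed (use UV in auto)
qed (use K W x XY in auto)

end

section \<open>Smooth functions and vector fields\<close>

text \<open>
  Openness makes the derivatives at points of \<open>S\<close> depend on the values in \<open>S\<close> only.
\<close>

lemma Ck_on_cong:
  assumes "open S" "\<And>x. x \<in> S \<Longrightarrow> f x = h x"
  shows "Ck_on k S f \<longleftrightarrow> Ck_on k S h"
  using assms(2)
proof (induction k arbitrary: f h)
  case 0
  then show ?case by (simp cong: continuous_on_cong)
next
  case (Suc k)
  have diff: "f differentiable (at x) \<longleftrightarrow> h differentiable (at x)"
    and fd: "f differentiable (at x) \<Longrightarrow> frechet_derivative f (at x) = frechet_derivative h (at x)"
    if x: "x \<in> S" for x
  proof -
    show "f differentiable (at x) \<longleftrightarrow> h differentiable (at x)"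
      unfolding differentiable_def
      using has_derivative_transform_within_open[OF _ assms(1) x] Suc.prems by metis
    show "frechet_derivative f (at x) = frechet_derivative h (at x)" if "f differentiable (at x)"
      using frechet_derivative_transform_within_open[OF that assms(1) x] Suc.prems by metis
  qed
  show ?case
  proof (cases "\<forall>x\<in>S. f differentiable (at x)")
    case True
    then have "Ck_on k S (\<lambda>x. frechet_derivative f (at x) v) \<longleftrightarrow> Ck_on k S (\<lambda>x. frechet_derivative h (at x) v)" for v
      using fd by (intro Suc.IH) simp
    then show ?thesis using diff by simp
  qed (use diff in auto)
qed

lemma Ck_on_const: "Ck_on k S (\<lambda>_. c)"
  by (induction k arbitrary: c) simp_all

lemma Ck_on_SucD: "Ck_on (Suc k) S f \<Longrightarrow> Ck_on k S f"
proof (induction k arbitrary: f)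
  case 0
  then show ?case
    by (simp add: continuous_at_imp_continuous_on differentiable_imp_continuous_within)
next
  case (Suc k)
  then have "Ck_on (Suc k) S (\<lambda>x. frechet_derivative f (at x) v)" for v by simp
  with Suc show ?case by simp
qed

lemma Ck_on_bounded_linear:
  assumes l: "bounded_linear l" and "open S" "Ck_on k S f"
  shows "Ck_on k S (\<lambda>x. l (f x))"
  using assms(3)
proof (induction k arbitrary: f)
  case 0
  then show ?case using bounded_linear.continuous_on[OF l] by simp
next
  case (Suc k)
  have fd: "((\<lambda>x. l (f x)) has_derivative (\<lambda>v. l (frechet_derivative f (at x) v))) (at x)" if "x \<in> S" for x
    using Suc.prems that by (intro bounded_linear.has_derivative[OF l]) (simp add: frechet_derivative_works)
  have "frechet_derivative (\<lambda>x. l (f x)) (at x) v = l (frechet_derivative f (at x) v)" if "x \<in> S" for x v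
    using frechet_derivative_at[OF fd[OF that]] by metis
  then have "Ck_on k S (\<lambda>x. frechet_derivative (\<lambda>x. l (f x)) (at x) v)" for v
    using Suc by (subst Ck_on_cong[OF assms(2)]) auto
  then show ?case using fd by (auto simp: differentiable_def)
qed

lemma Ck_on_add:
  assumes "open S" "Ck_on k S f" "Ck_on k S h"
  shows "Ck_on k S (\<lambda>x. f x + h x)"
  using assms(2,3)
proof (induction k arbitrary: f h)
  case 0
  then show ?case by (simp add: continuous_on_add)
next
  case (Suc k)
  have fd: "((\<lambda>x. f x + h x) has_derivative
      (\<lambda>v. frechet_derivative f (at x) v + frechet_derivative h (at x) v)) (at x)" if "x \<in> S" for x
    using Suc.prems that by (intro has_derivative_add) (simp_all add: frechet_derivative_works)
  have "frechet_derivative (\<lambda>x. f x + h x) (at x) v = frechet_derivative f (at x) v + frechet_derivative h (at x) v"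
    if "x \<in> S" for x v
    using frechet_derivative_at[OF fd[OF that]] by metis
  then have "Ck_on k S (\<lambda>x. frechet_derivative (\<lambda>x. f x + h x) (at x) v)" for v
    using Suc by (subst Ck_on_cong[OF assms(1)]) auto
  then show ?case using fd by (auto simp: differentiable_def)
qed

text \<open>
  The Leibniz rule involves the functions themselves next to their derivatives, so the induction
  also lowers the order of differentiability of the factors.
\<close>

lemma Ck_on_mult:
  fixes f h :: "'a::real_normed_vector \<Rightarrow> 'b::real_normed_algebra"
  assumes "open S" "Ck_on k S f" "Ck_on k S h"
  shows "Ck_on k S (\<lambda>x. f x * h x)"
  using assms(2,3)
proof (induction k arbitrary: f h)
  case 0
  then show ?case by (simp add: continuous_on_mult)
next
  case (Suc k)
  have fd: "((\<lambda>x. f x * h x) has_derivative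
      (\<lambda>v. f x * frechet_derivative h (at x) v + frechet_derivative f (at x) v * h x)) (at x)" if "x \<in> S" for x
    using Suc.prems that by (intro has_derivative_mult) (simp_all add: frechet_derivative_works)
  have "frechet_derivative (\<lambda>x. f x * h x) (at x) v =
      f x * frechet_derivative h (at x) v + frechet_derivative f (at x) v * h x"
    if "x \<in> S" for x v
    using frechet_derivative_at[OF fd[OF that]] by metis
  moreover have "Ck_on k S (\<lambda>x. f x * frechet_derivative h (at x) v + frechet_derivative f (at x) v * h x)" for v
    using Suc.prems Ck_on_SucD[OF Suc.prems(1)] Ck_on_SucD[OF Suc.prems(2)]
    by (intro Ck_on_add[OF assms(1)] Suc.IH) simp_all
  ultimately have "Ck_on k S (\<lambda>x. frechet_derivative (\<lambda>x. f x * h x) (at x) v)" for v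
    by (subst Ck_on_cong[OF assms(1)]) auto
  then show ?case using fd by (auto simp: differentiable_def)
qed

lemma smooth_funs_const: "(\<lambda>_. c) \<in> smooth_funs A"
  by (auto simp: smooth_funs_def smooth_on_def Ck_on_const)

lemma smooth_funs_0: "0 \<in> smooth_funs A"
  using smooth_funs_const[of 0] by (simp add: zero_fun_def)

lemma smooth_funs_closed:
  assumes A: "smooth_atlas A"
  shows "f \<in> smooth_funs A \<Longrightarrow> h \<in> smooth_funs A \<Longrightarrow> f + h \<in> smooth_funs A"
    and "f \<in> smooth_funs A \<Longrightarrow> h \<in> smooth_funs A \<Longrightarrow> f * h \<in> smooth_funs A"
    and "f \<in> smooth_funs A \<Longrightarrow> cnj_fun f \<in> smooth_funs A"
proof -
  have op: "open (\<phi> ` U)" if "(U, \<phi>) \<in> A" for U \<phi>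
    using A that by (auto simp: smooth_atlas_def)
  show "f \<in> smooth_funs A \<Longrightarrow> h \<in> smooth_funs A \<Longrightarrow> f + h \<in> smooth_funs A"
    using op by (auto simp: smooth_funs_def smooth_on_def intro!: Ck_on_add)
  show "f \<in> smooth_funs A \<Longrightarrow> h \<in> smooth_funs A \<Longrightarrow> f * h \<in> smooth_funs A"
    using op by (auto simp: smooth_funs_def smooth_on_def intro!: Ck_on_mult)
  show "f \<in> smooth_funs A \<Longrightarrow> cnj_fun f \<in> smooth_funs A"
    using op by (auto simp: smooth_funs_def smooth_on_def cnj_fun_def intro!: Ck_on_bounded_linear[OF bounded_linear_cnj])
qed

lemma cnj_fun_cnj_fun [simp]: "cnj_fun (cnj_fun f) = f"
  by (simp add: cnj_fun_def)

lemma cnj_fun_ring [simp]: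
  "cnj_fun (f + h) = cnj_fun f + cnj_fun h" "cnj_fun (f * h) = cnj_fun f * cnj_fun h"
  "cnj_fun (\<lambda>_. c) = (\<lambda>_. cnj c)" "cnj_fun 0 = 0" "cnj_fun (f - h) = cnj_fun f - cnj_fun h"
  by (simp_all add: cnj_fun_def fun_eq_iff)

lemma cnj_field_cnj_field [simp]: "cnj_field (cnj_field X) = X"
  by (simp add: cnj_field_def)

lemma cnj_field_add [simp]: "cnj_field (X + Y) = cnj_field X + cnj_field Y"
  by (simp add: cnj_field_def fun_eq_iff cnj_fun_def)

lemma cnj_field_mult [simp]: "cnj_field (f \<cdot>\<^sub>F X) = cnj_fun f \<cdot>\<^sub>F cnj_field X"
  by (simp add: cnj_field_def fun_eq_iff cnj_fun_def mult_field_def)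

locale atlas =
  fixes A :: "('g::{t2_space, second_countable_topology}, 'e::euclidean_space) chart set"
  assumes atlas: "smooth_atlas A"
begin

lemmas smooth_closed [simp] = smooth_funs_closed[OF atlas] smooth_funs_const smooth_funs_0

lemma smooth_diff [simp]:
  assumes "f \<in> smooth_funs A" "h \<in> smooth_funs A"
  shows "f - h \<in> smooth_funs A"
proof -
  have eq: "f - h = f + (\<lambda>_. -1) * h" by (simp add: fun_eq_iff)
  show ?thesis unfolding eq using assms by simp
qed

lemma cnj_fun_smooth_iff: "cnj_fun f \<in> smooth_funs A \<longleftrightarrow> f \<in> smooth_funs A"
  using smooth_closed(3)[of f] smooth_closed(3)[of "cnj_fun f"] by auto

lemma vector_fieldD:
  assumes "X \<in> vector_fields A"
  shows "f \<in> smooth_funs A \<Longrightarrow> X f \<in> smooth_funs A"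
    and "f \<notin> smooth_funs A \<Longrightarrow> X f = 0"
    and "f \<in> smooth_funs A \<Longrightarrow> h \<in> smooth_funs A \<Longrightarrow> X (f + h) = X f + X h"
    and "f \<in> smooth_funs A \<Longrightarrow> X ((\<lambda>_. c) * f) = (\<lambda>_. c) * X f"
    and "f \<in> smooth_funs A \<Longrightarrow> h \<in> smooth_funs A \<Longrightarrow> X (f * h) = f * X h + h * X f"
  using assms by (auto simp: vector_fields_def)

lemma vector_fieldI:
  assumes "\<And>f. f \<in> smooth_funs A \<Longrightarrow> X f \<in> smooth_funs A"
    and "\<And>f. f \<notin> smooth_funs A \<Longrightarrow> X f = 0"
    and "\<And>f h. f \<in> smooth_funs A \<Longrightarrow> h \<in> smooth_funs A \<Longrightarrow> X (f + h) = X f + X h"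
    and "\<And>c f. f \<in> smooth_funs A \<Longrightarrow> X ((\<lambda>_. c) * f) = (\<lambda>_. c) * X f"
    and "\<And>f h. f \<in> smooth_funs A \<Longrightarrow> h \<in> smooth_funs A \<Longrightarrow> X (f * h) = f * X h + h * X f"
  shows "X \<in> vector_fields A"
  using assms unfolding vector_fields_def by blast

lemma vector_field_zero_fun: "X \<in> vector_fields A \<Longrightarrow> X 0 = 0"
  using vector_fieldD(4)[of X 0 0] by (simp add: fun_eq_iff times_fun_def zero_fun_def)

lemma vector_field_const:
  assumes X: "X \<in> vector_fields A"
  shows "X (\<lambda>_. c) = 0"
proof -
  have one: "(\<lambda>_. 1) * (\<lambda>_. 1) = (\<lambda>_::'g. 1::complex)" by (simp add: fun_eq_iff)
  have "X (\<lambda>_. 1) = X (\<lambda>_. 1) + X (\<lambda>_. 1)"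
    using vector_fieldD(5)[OF X, of "\<lambda>_. 1" "\<lambda>_. 1"] one by (simp add: fun_eq_iff)
  then have "X (\<lambda>_. 1) = 0" by simp
  moreover have "(\<lambda>_. c) * (\<lambda>_. 1) = (\<lambda>_::'g. c)" by (simp add: fun_eq_iff)
  ultimately show ?thesis using vector_fieldD(4)[OF X, of "\<lambda>_. 1" c] by simp
qed

lemma vector_field_diff:
  assumes "X \<in> vector_fields A" "f \<in> smooth_funs A" "h \<in> smooth_funs A"
  shows "X (f - h) = X f - X h"
  using vector_fieldD(3)[OF assms(1), of "f - h" h] assms by (simp add: algebra_simps)

lemma vector_field_closed [simp]:
  "0 \<in> vector_fields A"
  "\<lbrakk>X \<in> vector_fields A; Y \<in> vector_fields A\<rbrakk> \<Longrightarrow> X + Y \<in> vector_fields A"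
  "\<lbrakk>X \<in> vector_fields A; f \<in> smooth_funs A\<rbrakk> \<Longrightarrow> f \<cdot>\<^sub>F X \<in> vector_fields A"
  "X \<in> vector_fields A \<Longrightarrow> cnj_field X \<in> vector_fields A"
  "\<lbrakk>X \<in> vector_fields A; Y \<in> vector_fields A\<rbrakk> \<Longrightarrow> lie_bracket X Y \<in> vector_fields A"
proof -
  show "0 \<in> vector_fields A" by (rule vector_fieldI) (auto simp: fun_eq_iff)
  show "X + Y \<in> vector_fields A" if "X \<in> vector_fields A" "Y \<in> vector_fields A"
    using vector_fieldD[OF that(1)] vector_fieldD[OF that(2)] by (intro vector_fieldI) (simp_all add: algebra_simps)
  show "f \<cdot>\<^sub>F X \<in> vector_fields A" if "X \<in> vector_fields A" "f \<in> smooth_funs A"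
    using vector_fieldD[OF that(1)] that(2) by (intro vector_fieldI) (simp_all add: mult_field_def algebra_simps)
  show "cnj_field X \<in> vector_fields A" if "X \<in> vector_fields A"
    using vector_fieldD[OF that] by (intro vector_fieldI) (simp_all add: cnj_field_def cnj_fun_smooth_iff)
  show "lie_bracket X Y \<in> vector_fields A" if X: "X \<in> vector_fields A" and Y: "Y \<in> vector_fields A"
    using vector_fieldD[OF X] vector_fieldD[OF Y] vector_field_zero_fun[OF X] vector_field_zero_fun[OF Y] vector_field_const[OF X] vector_field_const[OF Y]
    by (intro vector_fieldI) (simp_all add: lie_bracket_def algebra_simps)
qed

end

section \<open>The Lie algebra of a Hermitian Lie group\<close>

definition scaleF :: "complex \<Rightarrow> 'g field \<Rightarrow> 'g field" where
  "scaleF c X = (\<lambda>_. c) \<cdot>\<^sub>F X"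

lemma scaleF_apply: "scaleF c X f p = c * X f p"
  by (simp add: scaleF_def mult_field_def)

lemma vector_space_scaleF: "vector_space scaleF"
  by unfold_locales (simp_all add: fun_eq_iff scaleF_apply algebra_simps)

locale lie_group_manifold =
  fixes N :: "'g::{t2_space, second_countable_topology} monoid"
    and A :: "('g, 'e::euclidean_space) chart set"
  assumes lie_group: "lie_group N A"
begin

sublocale atlas A
  using lie_group by unfold_locales (simp add: lie_group_def)

lemma group_simps [simp]:
  "inv\<^bsub>N\<^esub> a \<otimes>\<^bsub>N\<^esub> (a \<otimes>\<^bsub>N\<^esub> p) = p" "a \<otimes>\<^bsub>N\<^esub> (inv\<^bsub>N\<^esub> a \<otimes>\<^bsub>N\<^esub> p) = p"
  "inv\<^bsub>N\<^esub> a \<otimes>\<^bsub>N\<^esub> a = \<one>\<^bsub>N\<^esub>"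
proof -
  interpret group N using lie_group by (simp add: lie_group_def)
  have c: "x \<in> carrier N" for x using lie_group by (simp add: lie_group_def)
  show "inv\<^bsub>N\<^esub> a \<otimes>\<^bsub>N\<^esub> (a \<otimes>\<^bsub>N\<^esub> p) = p" "a \<otimes>\<^bsub>N\<^esub> (inv\<^bsub>N\<^esub> a \<otimes>\<^bsub>N\<^esub> p) = p" "inv\<^bsub>N\<^esub> a \<otimes>\<^bsub>N\<^esub> a = \<one>\<^bsub>N\<^esub>"
    using c by (simp_all flip: m_assoc)
qed

text \<open>
  This is the complexification of the Lie algebra of the group, which consists of the real fields in it.
\<close>

definition LI :: "'g field set" where
  "LI = {X \<in> vector_fields A. left_invariant_field N X}"

lemma LI_vf [simp]: "X \<in> LI \<Longrightarrow> X \<in> vector_fields A"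
  by (simp add: LI_def)

lemma LI_translate: "X \<in> LI \<Longrightarrow> left_translate N a X = X"
  by (simp add: LI_def left_invariant_field_def del: LI_vf)

lemma LI_I: "X \<in> vector_fields A \<Longrightarrow> (\<And>a. left_translate N a X = X) \<Longrightarrow> X \<in> LI"
  by (simp add: LI_def left_invariant_field_def del: LI_vf)

text \<open>
  Substitute \<open>a q\<close> for the point in the identity that expresses invariance under the translation by \<open>a\<close>.
\<close>

lemma LI_comp_translation:
  assumes "X \<in> LI"
  shows "X (\<lambda>q. f (a \<otimes>\<^bsub>N\<^esub> q)) = (\<lambda>q. X f (a \<otimes>\<^bsub>N\<^esub> q))"
proof
  fix q
  have "X f (a \<otimes>\<^bsub>N\<^esub> q) = left_translate N a X f (a \<otimes>\<^bsub>N\<^esub> q)"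
    using LI_translate[OF assms] by simp
  then show "X (\<lambda>q. f (a \<otimes>\<^bsub>N\<^esub> q)) q = X f (a \<otimes>\<^bsub>N\<^esub> q)"
    by (simp add: left_translate_def)
qed

lemma left_translate_simps [simp]:
  "left_translate N a 0 = 0"
  "left_translate N a (X + Y) = left_translate N a X + left_translate N a Y"
  "left_translate N a (scaleF c X) = scaleF c (left_translate N a X)"
  "left_translate N a (cnj_field X) = cnj_field (left_translate N a X)"
  by (simp_all add: left_translate_def fun_eq_iff scaleF_apply cnj_field_def cnj_fun_def)

lemma scaleF_vf [simp]: "X \<in> vector_fields A \<Longrightarrow> scaleF c X \<in> vector_fields A"
  by (simp add: scaleF_def)

lemma LI_closed [simp]:
  "0 \<in> LI" "X \<in> LI \<Longrightarrow> Y \<in> LI \<Longrightarrow> X + Y \<in> LI" "X \<in> LI \<Longrightarrow> scaleF c X \<in> LI"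
  "X \<in> LI \<Longrightarrow> cnj_field X \<in> LI" "X \<in> LI \<Longrightarrow> Y \<in> LI \<Longrightarrow> lie_bracket X Y \<in> LI"
proof -
  show "lie_bracket X Y \<in> LI" if X: "X \<in> LI" and Y: "Y \<in> LI"
  proof (rule LI_I)
    fix a
    show "left_translate N a (lie_bracket X Y) = lie_bracket X Y"
    proof (intro ext)
      fix f p
      show "left_translate N a (lie_bracket X Y) f p = lie_bracket X Y f p"
        unfolding left_translate_def lie_bracket_def
          LI_comp_translation[OF X, of f a] LI_comp_translation[OF Y, of f a]
        using LI_comp_translation[OF X, of "Y f" a] LI_comp_translation[OF Y, of "X f" a]
        by simp
    qed
  qed (use X Y in simp)
next
  show "0 \<in> LI" "X \<in> LI \<Longrightarrow> Y \<in> LI \<Longrightarrow> X + Y \<in> LI" "X \<in> LI \<Longrightarrow> scaleF c X \<in> LI"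
    "X \<in> LI \<Longrightarrow> cnj_field X \<in> LI"
    by (rule LI_I; simp add: LI_translate)+
qed

lemma lie_algebra_iff: "X \<in> lie_algebra N A \<longleftrightarrow> X \<in> LI \<and> cnj_field X = X"
  by (auto simp: lie_algebra_def LI_def real_field_def simp del: LI_vf)

end

locale hermitian_lie_group = lie_group_manifold N A
  for N :: "'g::{t2_space, second_countable_topology} monoid"
    and A :: "('g, 'e::euclidean_space) chart set" +
  fixes J :: "'g field \<Rightarrow> 'g field" and g :: "'g field \<Rightarrow> 'g field \<Rightarrow> 'g \<Rightarrow> complex"
  assumes complex_structure: "left_invariant_complex_structure N A J"
    and hermitian_metric: "left_invariant_hermitian_metric N A J g"
begin

lemma J_vf:
  shows "X \<in> vector_fields A \<Longrightarrow> J X \<in> vector_fields A"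
    and "X \<in> vector_fields A \<Longrightarrow> Y \<in> vector_fields A \<Longrightarrow> J (X + Y) = J X + J Y"
    and "f \<in> smooth_funs A \<Longrightarrow> X \<in> vector_fields A \<Longrightarrow> J (f \<cdot>\<^sub>F X) = f \<cdot>\<^sub>F J X"
    and "X \<in> vector_fields A \<Longrightarrow> J (cnj_field X) = cnj_field (J X)"
    and "X \<in> vector_fields A \<Longrightarrow> J (J X) = - X"
    and "X \<in> vector_fields A \<Longrightarrow> Y \<in> vector_fields A \<Longrightarrow>
        lie_bracket (J X) (J Y) - J (lie_bracket (J X) Y) - J (lie_bracket X (J Y))
          - lie_bracket X Y = 0"
    and "X \<in> vector_fields A \<Longrightarrow> left_translate N a (J X) = J (left_translate N a X)"
  using complex_structure unfolding left_invariant_complex_structure_def by blast+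

lemma g_vf:
  shows "X \<in> vector_fields A \<Longrightarrow> Y \<in> vector_fields A \<Longrightarrow> g X Y \<in> smooth_funs A"
    and "X \<in> vector_fields A \<Longrightarrow> Y \<in> vector_fields A \<Longrightarrow> g X Y = g Y X"
    and "X \<in> vector_fields A \<Longrightarrow> Y \<in> vector_fields A \<Longrightarrow> W \<in> vector_fields A \<Longrightarrow> g (X + Y) W = g X W + g Y W"
    and "f \<in> smooth_funs A \<Longrightarrow> X \<in> vector_fields A \<Longrightarrow> Y \<in> vector_fields A \<Longrightarrow> g (f \<cdot>\<^sub>F X) Y = f * g X Y"
    and "X \<in> vector_fields A \<Longrightarrow> Y \<in> vector_fields A \<Longrightarrow> g (cnj_field X) (cnj_field Y) = cnj_fun (g X Y)"
    and "X \<in> vector_fields A \<Longrightarrow> real_field X \<Longrightarrow> f \<in> smooth_funs A \<Longrightarrow> X f p \<noteq> 0 \<Longrightarrow> Re (g X X p) > 0"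
    and "X \<in> vector_fields A \<Longrightarrow> Y \<in> vector_fields A \<Longrightarrow> g (J X) (J Y) = g X Y"
    and "X \<in> vector_fields A \<Longrightarrow> Y \<in> vector_fields A \<Longrightarrow>
        g (left_translate N a X) (left_translate N a Y) p = g X Y (inv\<^bsub>N\<^esub> a \<otimes>\<^bsub>N\<^esub> p)"
proof -
  note m1 = hermitian_metric[unfolded left_invariant_hermitian_metric_def]
  note m2 = m1[THEN conjunct2]
  note m3 = m2[THEN conjunct2]
  note m4 = m3[THEN conjunct2]
  note m5 = m4[THEN conjunct2]
  note m6 = m5[THEN conjunct2]
  note m7 = m6[THEN conjunct2]
  note m8 = m7[THEN conjunct2]
  show "X \<in> vector_fields A \<Longrightarrow> Y \<in> vector_fields A \<Longrightarrow> g X Y \<in> smooth_funs A"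
    using m1[THEN conjunct1] by auto
  show "X \<in> vector_fields A \<Longrightarrow> Y \<in> vector_fields A \<Longrightarrow> g X Y = g Y X"
    using m2[THEN conjunct1] by auto
  show "X \<in> vector_fields A \<Longrightarrow> Y \<in> vector_fields A \<Longrightarrow> W \<in> vector_fields A \<Longrightarrow> g (X + Y) W = g X W + g Y W"
    using m3[THEN conjunct1] by auto
  show "f \<in> smooth_funs A \<Longrightarrow> X \<in> vector_fields A \<Longrightarrow> Y \<in> vector_fields A \<Longrightarrow> g (f \<cdot>\<^sub>F X) Y = f * g X Y"
    using m4[THEN conjunct1] by auto
  show "X \<in> vector_fields A \<Longrightarrow> Y \<in> vector_fields A \<Longrightarrow> g (cnj_field X) (cnj_field Y) = cnj_fun (g X Y)"
    using m5[THEN conjunct1] by auto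
  show "X \<in> vector_fields A \<Longrightarrow> real_field X \<Longrightarrow> f \<in> smooth_funs A \<Longrightarrow> X f p \<noteq> 0 \<Longrightarrow> Re (g X X p) > 0"
    using m6[THEN conjunct1] by auto
  show "X \<in> vector_fields A \<Longrightarrow> Y \<in> vector_fields A \<Longrightarrow> g (J X) (J Y) = g X Y"
    using m7[THEN conjunct1] by auto
  show "X \<in> vector_fields A \<Longrightarrow> Y \<in> vector_fields A \<Longrightarrow>
        g (left_translate N a X) (left_translate N a Y) p = g X Y (inv\<^bsub>N\<^esub> a \<otimes>\<^bsub>N\<^esub> p)"
    using m8 by auto
qed

text \<open>
  Translate \<open>p\<close> to the identity.
\<close>

lemma g_LI: "X \<in> LI \<Longrightarrow> Y \<in> LI \<Longrightarrow> g X Y p = g X Y \<one>\<^bsub>N\<^esub>"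
  using g_vf(8)[of X Y p p] LI_translate[of X p] LI_translate[of Y p] by simp

text \<open>
  The value of \<open>g\<close> on left-invariant fields is a constant function, by \<open>g_LI\<close>; the identity serves as
  the point at which it is read off.
\<close>

sublocale hermitian_lie_algebra scaleF LI lie_bracket cnj_field J "\<lambda>X Y. g X Y \<one>\<^bsub>N\<^esub>"
proof -
  interpret vector_space "scaleF :: complex \<Rightarrow> 'g field \<Rightarrow> 'g field" by (rule vector_space_scaleF)
  show "hermitian_lie_algebra scaleF LI lie_bracket cnj_field J (\<lambda>X Y. g X Y \<one>\<^bsub>N\<^esub>)"
  proof
    show "subspace LI" by (rule subspaceI) simp_all
    fix X Y assume X: "X \<in> LI" and Y: "Y \<in> LI"
    show "lie_bracket X Y \<in> LI" "cnj_field X \<in> LI" using X Y by simp_all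
    note XY = vector_fieldD[OF LI_vf[OF X]] vector_fieldD[OF LI_vf[OF Y]]
    show "lie_bracket (scaleF c X) Y = scaleF c (lie_bracket X Y)" for c
    proof (intro ext)
      fix f p
      have "(\<lambda>_. c) * X f = scaleF c X f" by (simp add: fun_eq_iff scaleF_apply)
      then show "lie_bracket (scaleF c X) Y f p = scaleF c (lie_bracket X Y) f p"
        using vector_fieldD(4)[OF LI_vf[OF Y], of "X f" c] XY(1)[of f] XY(2)[of f] XY(7)[of f] vector_field_zero_fun[of Y] Y
        by (cases "f \<in> smooth_funs A") (auto simp: lie_bracket_def scaleF_apply algebra_simps)
    qed
    show "lie_bracket Y X = - lie_bracket X Y" by (simp add: lie_bracket_def fun_eq_iff)
    show "cnj_field (X + Y) = cnj_field X + cnj_field Y" "cnj_field (cnj_field X) = X" by simp_all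
    show "cnj_field (scaleF c X) = scaleF (cnj c) (cnj_field X)" for c by (simp add: scaleF_def)
    show "cnj_field (lie_bracket X Y) = lie_bracket (cnj_field X) (cnj_field Y)"
      by (simp add: lie_bracket_def cnj_field_def fun_eq_iff)
    show "J X \<in> LI" using X J_vf(1,7)[of X] by (intro LI_I) (simp_all add: LI_translate)
    show "J (X + Y) = J X + J Y" "J (J X) = - X" "J (cnj_field X) = cnj_field (J X)"
      "J (scaleF c X) = scaleF c (J X)"
      "lie_bracket (J X) (J Y) - J (lie_bracket (J X) Y) - J (lie_bracket X (J Y)) - lie_bracket X Y = 0" for c
      using X Y J_vf by (simp_all add: scaleF_def)
    show "g X Y \<one>\<^bsub>N\<^esub> = g Y X \<one>\<^bsub>N\<^esub>" "g (scaleF c X) Y \<one>\<^bsub>N\<^esub> = c * g X Y \<one>\<^bsub>N\<^esub>"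
      "g (cnj_field X) (cnj_field Y) \<one>\<^bsub>N\<^esub> = cnj (g X Y \<one>\<^bsub>N\<^esub>)" "g (J X) (J Y) \<one>\<^bsub>N\<^esub> = g X Y \<one>\<^bsub>N\<^esub>" for c
      using X Y g_vf(2)[of X Y] by (simp_all add: scaleF_def g_vf(4,5,7)) (simp add: cnj_fun_def)
    fix W assume W: "W \<in> LI"
    note W' = vector_fieldD[OF LI_vf[OF W]]
    show "lie_bracket (X + Y) W = lie_bracket X W + lie_bracket Y W"
    proof (intro ext)
      fix f p
      show "lie_bracket (X + Y) W f p = (lie_bracket X W + lie_bracket Y W) f p"
        using W'(3)[of "X f" "Y f"] XY(1)[of f] XY(2)[of f] XY(6)[of f] XY(7)[of f] vector_field_zero_fun[of W] W
        by (cases "f \<in> smooth_funs A") (simp_all add: lie_bracket_def algebra_simps)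
    qed
    show "g (X + Y) W \<one>\<^bsub>N\<^esub> = g X W \<one>\<^bsub>N\<^esub> + g Y W \<one>\<^bsub>N\<^esub>" using X Y W by (simp add: g_vf(3))
    show "lie_bracket X (lie_bracket Y W) = lie_bracket (lie_bracket X Y) W + lie_bracket Y (lie_bracket X W)"
    proof (intro ext)
      fix f p
      show "lie_bracket X (lie_bracket Y W) f p = (lie_bracket (lie_bracket X Y) W + lie_bracket Y (lie_bracket X W)) f p"
        using X Y W by (cases "f \<in> smooth_funs A")
          (simp_all add: lie_bracket_def vector_field_diff vector_fieldD(1,2) vector_field_zero_fun)
    qed
  next
    fix X assume X: "X \<in> LI" "cnj_field X = X" "X \<noteq> 0"
    obtain f p where f: "X f p \<noteq> 0" using X(3) by (auto simp: fun_eq_iff)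
    then have "f \<in> smooth_funs A" using vector_fieldD(2)[OF LI_vf[OF X(1)], of f] by (metis zero_fun_apply)
    then have "Re (g X X p) > 0" using X f by (intro g_vf(6)) (simp_all add: real_field_def)
    then show "Re (g X X \<one>\<^bsub>N\<^esub>) > 0" using g_LI[OF X(1,1), of p] by simp
  qed
qed

end

section \<open>The Chern connection of a Hermitian Lie group\<close>

lemma sum_field_apply:
  fixes X :: "'i \<Rightarrow> 'g field"
  shows "(\<Sum>i\<in>I. X i) f p = (\<Sum>i\<in>I. X i f p)"
  by (induction I rule: infinite_finite_induct) simp_all

context hermitian_lie_group
begin

lemma T10_iff: "X \<in> T10 \<longleftrightarrow> X \<in> LI \<and> X \<in> type_10_fields A J"
  by (auto simp: T10_def type_10_fields_def scaleF_def simp del: LI_vf T10_L intro: LI_vf)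

lemma g_sum_vf:
  assumes "\<And>i. i \<in> I \<Longrightarrow> X i \<in> vector_fields A" "Y \<in> vector_fields A"
  shows "g (\<Sum>i\<in>I. X i) Y p = (\<Sum>i\<in>I. g (X i) Y p)"
proof -
  have zero: "g 0 Y = 0"
  proof -
    have "(0 :: 'g \<Rightarrow> complex) \<cdot>\<^sub>F (0 :: 'g field) = 0" by (simp add: mult_field_def fun_eq_iff)
    then show ?thesis using g_vf(4)[of 0 0 Y] assms(2) by simp
  qed
  have vf: "(\<Sum>i\<in>I. X i) \<in> vector_fields A" if "\<And>i. i \<in> I \<Longrightarrow> X i \<in> vector_fields A" for I
    using that by (induction I rule: infinite_finite_induct) simp_all
  show ?thesis using assms(1)
  proof (induction I rule: infinite_finite_induct)
    case (insert i I)
    then have "g (X i + (\<Sum>i\<in>I. X i)) Y = g (X i) Y + g (\<Sum>i\<in>I. X i) Y"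
      using vf[of I] assms(2) by (intro g_vf(3)) auto
    then have "g (X i + (\<Sum>i\<in>I. X i)) Y p = g (X i) Y p + g (\<Sum>i\<in>I. X i) Y p"
      by (simp only: plus_fun_apply)
    also have "g (\<Sum>i\<in>I. X i) Y p = (\<Sum>i\<in>I. g (X i) Y p)" using insert by blast
    finally show ?case
      by (simp only: sum.insert[OF insert(1,2)])
  qed (simp_all add: zero)
qed

lemma lower_central_series_LI: "lower_central_series N A k \<subseteq> LI"
proof (induction k)
  case (Suc k)
  have "X \<in> LI" if "X \<in> real_span {lie_bracket X Y |X Y. X \<in> lie_algebra N A \<and> Y \<in> lower_central_series N A k}" for X
    using that
  proof (induction X rule: real_span.induct)
    case (step X Y c)
    then have "X \<in> LI" using Suc by (auto simp: lie_algebra_iff)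
    then have "scaleF c X + Y \<in> LI" using step by simp
    then show ?case by (simp only: scaleF_def plus_fun_def)
  next
    case zero
    show ?case using LI_closed(1) by (simp only: zero_fun_def)
  qed
  then show ?case by auto
qed (auto simp: lie_algebra_iff)

text \<open>
  Brackets of complex fields are complex combinations of brackets of real ones, so the complex lower
  central series is spanned by the real one and terminates with it.
\<close>

lemma lcs_span: "lcs k \<subseteq> span (lower_central_series N A k)"
proof (induction k)
  case 0
  have "X \<in> span (lie_algebra N A)" if X: "X \<in> LI" for X
  proof -
    obtain U V where UV: "U \<in> LI" "V \<in> LI" "cnj_field U = U" "cnj_field V = V" "X = U + scaleF \<i> V"
      using real_decomposition[OF X] by metis
    then have "U \<in> lie_algebra N A" "V \<in> lie_algebra N A" by (simp_all add: lie_algebra_iff)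
    then show ?thesis unfolding UV(5) by (intro span_add span_scale span_base)
  qed
  then show ?case by auto
next
  case (Suc k)
  let ?C = "lower_central_series N A k" and ?C' = "lower_central_series N A (Suc k)"
  have real: "lie_bracket U Y \<in> span ?C'" if U: "U \<in> lie_algebra N A" and Y: "Y \<in> span ?C" for U Y
  proof -
    have UL: "U \<in> LI" using U by (simp add: lie_algebra_iff)
    have "lie_bracket U W \<in> ?C'" if "W \<in> ?C" for W
    proof -
      have "lie_bracket U W \<in> {lie_bracket X Y |X Y. X \<in> lie_algebra N A \<and> Y \<in> ?C}"
        using U that by blast
      then have "(\<lambda>_. complex_of_real 1) \<cdot>\<^sub>F lie_bracket U W + 0 \<in> ?C'"
        unfolding lower_central_series.simps by (intro real_span.intros)
      moreover have "(\<lambda>_. complex_of_real 1) \<cdot>\<^sub>F lie_bracket U W + 0 = lie_bracket U W"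
        by (simp add: mult_field_def fun_eq_iff)
      ultimately show ?thesis by simp
    qed
    then have "?C \<subseteq> {Y \<in> LI. lie_bracket U Y \<in> span ?C'}"
      using lower_central_series_LI span_base by blast
    moreover have "subspace {Y \<in> LI. lie_bracket U Y \<in> span ?C'}"
      using UL by (intro subspaceI) (simp_all add: span_zero span_add span_scale)
    ultimately have "span ?C \<subseteq> {Y \<in> LI. lie_bracket U Y \<in> span ?C'}" by (rule span_minimal)
    then show ?thesis using Y by auto
  qed
  have "lie_bracket X Y \<in> span ?C'" if X: "X \<in> LI" and Y: "Y \<in> lcs k" for X Y
  proof -
    obtain U V where UV: "U \<in> LI" "V \<in> LI" "cnj_field U = U" "cnj_field V = V" "X = U + scaleF \<i> V"
      using real_decomposition[OF X] by metis
    then have "U \<in> lie_algebra N A" "V \<in> lie_algebra N A" by (simp_all add: lie_algebra_iff)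
    then have "lie_bracket U Y \<in> span ?C'" "lie_bracket V Y \<in> span ?C'"
      using real Y Suc by blast+
    moreover have "lie_bracket X Y = lie_bracket U Y + scaleF \<i> (lie_bracket V Y)"
      using UV(1,2) Y lcs_LD unfolding UV(5) by simp
    ultimately show ?thesis by (simp add: span_add span_scale)
  qed
  then show ?case unfolding lcs.simps by (intro span_minimal subspace_span) auto
qed

lemma nilpotent_lcs:
  assumes "lower_central_series N A k = {0}"
  shows "lcs k = {0}"
  using lcs_span[of k] assms subspace_0[OF lcs_subspace[of k]] by auto

lemma lie_center_center:
  assumes "X \<in> lie_center N A"
  shows "X \<in> center"
proof -
  have X: "X \<in> LI" and c: "\<And>Y. Y \<in> lie_algebra N A \<Longrightarrow> lie_bracket X Y = 0"
    using assms by (auto simp: lie_center_def lie_algebra_iff)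
  have "lie_bracket X Y = 0" if Y: "Y \<in> LI" for Y
  proof -
    obtain U V where UV: "U \<in> LI" "V \<in> LI" "cnj_field U = U" "cnj_field V = V" "Y = U + scaleF \<i> V"
      using real_decomposition[OF Y] by metis
    then show ?thesis using c[of U] c[of V] X by (simp add: lie_algebra_iff)
  qed
  then show ?thesis using X by (simp add: center_def)
qed

text \<open>
  If \<open>X = J Y\<close> with \<open>X\<close>, \<open>Y\<close> central and real, then \<open>J X = - Y\<close> is central too, and so is the (1,0) part of
  \<open>X\<close>.  It is nonzero because \<open>X\<close> is the sum of it and its conjugate.
\<close>

lemma central_T10_exists:
  assumes "lie_center N A \<inter> J ` lie_center N A \<noteq> {0}"
  obtains W where "W \<in> center" "W \<in> T10" "W \<noteq> 0"
proof -
  have "0 \<in> lie_center N A"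
    by (auto simp: lie_center_def lie_algebra_iff cj_simps(3) lie_algebra_def[of N A, symmetric])
  then have "0 \<in> lie_center N A \<inter> J ` lie_center N A" by (auto intro: image_eqI[of _ _ 0])
  then obtain X Y where XY: "X \<in> lie_center N A" "Y \<in> lie_center N A" "X = J Y" "X \<noteq> 0"
    using assms by blast
  have X: "X \<in> center" "Y \<in> center" using XY(1,2) lie_center_center by auto
  have real: "cnj_field X = X" using XY(1) by (auto simp: lie_center_def lie_algebra_iff)
  have L: "X \<in> LI" "Y \<in> LI" using X center_L by auto
  have JX: "J X = - Y" using XY(3) L by simp
  define W where "W = part10 X"
  have W: "W = scaleF (1/2) (X + scaleF \<i> Y)" by (simp add: W_def part10_def JX)
  have "W \<in> center"
    unfolding W using X center_subspace by (intro subspace_scale subspace_add)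
  moreover have "W \<in> T10" using L by (simp add: W_def)
  moreover have "W \<noteq> 0"
  proof
    assume "W = 0"
    have "X = part10 X + cnj_field (part10 X)"
    proof -
      have "cnj_field (part10 X) = scaleF (1/2) (X + scaleF \<i> (J X))"
        using L real by (simp add: part10_def J_cj[symmetric])
      then have "part10 X + cnj_field (part10 X) = scaleF (1/2) X + scaleF (1/2) X"
        by (simp add: part10_def scale_right_distrib scale_right_diff_distrib)
      then show ?thesis using half_add_half[of X] by simp
    qed
    then show False using \<open>W = 0\<close> XY(4) by (simp add: W_def cj_simps(3))
  qed
  ultimately show ?thesis using that by blast
qed

end

locale chern_frame = hermitian_lie_group N A J g
  for N :: "'g::{t2_space, second_countable_topology} monoid"
    and A :: "('g, 'e::euclidean_space) chart set" and J g +
  fixes D :: "'g field \<Rightarrow> 'g field \<Rightarrow> 'g field" and n :: nat and Z :: "nat \<Rightarrow> 'g field"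
  assumes chern: "chern_connection A J g D" and frame_Z: "left_invariant_frame N A J n Z"
begin

lemma D_vf:
  shows "X \<in> vector_fields A \<Longrightarrow> Y \<in> vector_fields A \<Longrightarrow> D X Y \<in> vector_fields A"
    and "X \<in> vector_fields A \<Longrightarrow> Y \<in> vector_fields A \<Longrightarrow> W \<in> vector_fields A \<Longrightarrow> D (X + Y) W = D X W + D Y W"
    and "X \<in> vector_fields A \<Longrightarrow> Y \<in> vector_fields A \<Longrightarrow> W \<in> vector_fields A \<Longrightarrow> D X (Y + W) = D X Y + D X W"
    and "f \<in> smooth_funs A \<Longrightarrow> X \<in> vector_fields A \<Longrightarrow> Y \<in> vector_fields A \<Longrightarrow> D (f \<cdot>\<^sub>F X) Y = f \<cdot>\<^sub>F D X Y"
    and "f \<in> smooth_funs A \<Longrightarrow> X \<in> vector_fields A \<Longrightarrow> Y \<in> vector_fields A \<Longrightarrow> D X (f \<cdot>\<^sub>F Y) = X f \<cdot>\<^sub>F Y + f \<cdot>\<^sub>F D X Y"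
    and "X \<in> vector_fields A \<Longrightarrow> Y \<in> vector_fields A \<Longrightarrow> D (cnj_field X) (cnj_field Y) = cnj_field (D X Y)"
    and "X \<in> vector_fields A \<Longrightarrow> Y \<in> vector_fields A \<Longrightarrow> D X (J Y) = J (D X Y)"
    and "X \<in> vector_fields A \<Longrightarrow> Y \<in> vector_fields A \<Longrightarrow> W \<in> vector_fields A \<Longrightarrow> X (g Y W) = g (D X Y) W + g Y (D X W)"
    and "U \<in> type_10_fields A J \<Longrightarrow> V \<in> type_10_fields A J \<Longrightarrow> torsion D U (cnj_field V) = 0"
  using chern unfolding chern_connection_def affine_connection_def by auto

lemma D_scaleF:
  "\<lbrakk>X \<in> vector_fields A; Y \<in> vector_fields A\<rbrakk> \<Longrightarrow> D (scaleF c X) Y = scaleF c (D X Y)"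
  "\<lbrakk>X \<in> vector_fields A; Y \<in> vector_fields A\<rbrakk> \<Longrightarrow> D X (scaleF c Y) = scaleF c (D X Y)"
proof -
  have "(\<lambda>_. 0) \<cdot>\<^sub>F Y = 0" for Y :: "'g field" by (simp add: mult_field_def fun_eq_iff)
  then show "\<lbrakk>X \<in> vector_fields A; Y \<in> vector_fields A\<rbrakk> \<Longrightarrow> D (scaleF c X) Y = scaleF c (D X Y)"
    "\<lbrakk>X \<in> vector_fields A; Y \<in> vector_fields A\<rbrakk> \<Longrightarrow> D X (scaleF c Y) = scaleF c (D X Y)"
    by (simp_all add: scaleF_def D_vf(4,5) vector_field_const zero_fun_def)
qed

lemma Z_T10:
  assumes "i < n"
  shows "Z i \<in> T10"
proof -
  have Z: "Z i \<in> type_10_fields A J" "left_invariant_field N (Z i)"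
    using frame_Z assms unfolding left_invariant_frame_def by blast+
  then have "Z i \<in> LI" unfolding LI_def type_10_fields_def by blast
  then show ?thesis using Z(1) T10_iff by blast
qed

text \<open>
  The smooth coefficients of \<open>W\<close> with respect to a unitary basis are its components \<open>g W (cj e)\<close>: both sides
  are linear over the smooth functions, and for the fields of the frame this is the usual orthonormal
  expansion.
\<close>

lemma type_10_expansion:
  assumes B: "orthonormal B" "span B = span (Z ` {..<n})" and W: "W \<in> type_10_fields A J"
  shows "W = (\<Sum>e\<in>B. g W (cnj_field e) \<cdot>\<^sub>F e)"
proof (intro ext)
  fix f p
  have BL: "e \<in> LI" if "e \<in> B" for e using B(1) that unfolding orthonormal_def by auto
  obtain c where c: "\<forall>i<n. c i \<in> smooth_funs A" "W = (\<Sum>i<n. c i \<cdot>\<^sub>F Z i)"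
    using frame_Z W unfolding left_invariant_frame_def by blast
  have gW: "g W (cnj_field e) p = (\<Sum>i<n. c i p * h (Z i) e)" if e: "e \<in> B" for e
  proof -
    have "g W (cnj_field e) p = (\<Sum>i<n. g (c i \<cdot>\<^sub>F Z i) (cnj_field e) p)"
      unfolding c(2) using c(1) Z_T10 BL[OF e] by (intro g_sum_vf) simp_all
    also have "\<dots> = (\<Sum>i<n. c i p * h (Z i) e)"
    proof (intro sum.cong refl)
      fix i assume "i \<in> {..<n}"
      then have i: "i < n" by simp
      have "g (c i \<cdot>\<^sub>F Z i) (cnj_field e) = c i * g (Z i) (cnj_field e)"
        using c(1) i Z_T10[OF i] BL[OF e] by (intro g_vf(4)) simp_all
      then show "g (c i \<cdot>\<^sub>F Z i) (cnj_field e) p = c i p * h (Z i) e"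
        using g_LI[of "Z i" "cnj_field e" p] Z_T10[OF i] BL[OF e] by (simp add: h_def)
    qed
    finally show ?thesis .
  qed
  have Zi: "Z i f p = (\<Sum>e\<in>B. h (Z i) e * e f p)" if "i < n" for i
  proof -
    have "Z i \<in> span B" unfolding B(2) using that by (intro span_base) simp
    then have "Z i = (\<Sum>e\<in>B. scaleF (h (Z i) e) e)" by (rule orthonormal_expansion[OF B(1)])
    then have "Z i f p = (\<Sum>e\<in>B. scaleF (h (Z i) e) e) f p" by metis
    then show ?thesis by (simp add: sum_field_apply scaleF_apply)
  qed
  have "W f p = (\<Sum>i<n. c i p * Z i f p)"
    unfolding c(2) by (simp add: sum_field_apply mult_field_def)
  also have "\<dots> = (\<Sum>i<n. \<Sum>e\<in>B. c i p * h (Z i) e * e f p)"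
    by (intro sum.cong refl) (simp add: Zi sum_distrib_left mult.assoc)
  also have "\<dots> = (\<Sum>e\<in>B. \<Sum>i<n. c i p * h (Z i) e * e f p)"
    by (rule sum.swap)
  also have "\<dots> = (\<Sum>e\<in>B. g W (cnj_field e) p * e f p)"
    by (intro sum.cong refl) (simp add: gW sum_distrib_right)
  also have "\<dots> = (\<Sum>e\<in>B. g W (cnj_field e) \<cdot>\<^sub>F e) f p"
    by (simp add: sum_field_apply mult_field_def)
  finally show "W f p = (\<Sum>e\<in>B. g W (cnj_field e) \<cdot>\<^sub>F e) f p" .
qed

text \<open>
  A (1,0) field whose components with respect to a unitary basis are constant is left-invariant.  Applied
  to left-invariant fields, it shows that the frame spans them over the complex numbers; applied to
  covariant derivatives, that the Chern connection is left-invariant.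
\<close>

lemma const_components:
  assumes B: "orthonormal B" "span B = span (Z ` {..<n})" and W: "W \<in> type_10_fields A J"
    and const: "\<And>e p. e \<in> B \<Longrightarrow> g W (cnj_field e) p = g W (cnj_field e) \<one>\<^bsub>N\<^esub>"
  shows "W \<in> T10" "W \<in> span B"
proof -
  have "W = (\<Sum>e\<in>B. g W (cnj_field e) \<cdot>\<^sub>F e)" by (rule type_10_expansion[OF B W])
  also have "\<dots> = (\<Sum>e\<in>B. scaleF (g W (cnj_field e) \<one>\<^bsub>N\<^esub>) e)"
    unfolding scaleF_def by (intro sum.cong refl arg_cong2[where f = mult_field] ext const)
  finally have eq: "W = (\<Sum>e\<in>B. scaleF (g W (cnj_field e) \<one>\<^bsub>N\<^esub>) e)" .
  have "(\<Sum>e\<in>B. scaleF (g W (cnj_field e) \<one>\<^bsub>N\<^esub>) e) \<in> span B"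
    by (intro span_sum span_scale span_base)
  then show "W \<in> span B" using eq by metis
  have "(\<Sum>e\<in>B. scaleF (g W (cnj_field e) \<one>\<^bsub>N\<^esub>) e) \<in> T10"
    using B(1) by (intro T10_sum T10_closed) (auto simp: orthonormal_def)
  then show "W \<in> T10" using eq by metis
qed

text \<open>
  Orthonormalise the frame over the complex numbers.  A left-invariant (1,0) field has constant
  components and hence lies in the complex span of the result.
\<close>

lemma unitary_basis_exists:
  obtains B where "orthonormal B" "span B = T10" "T10 = span (Z ` {..<n})"
proof -
  have ZT: "Z ` {..<n} \<subseteq> T10" using Z_T10 by auto
  obtain B where B: "orthonormal B" "span B = span (Z ` {..<n})"
  proof (rule orthonormal_extension[of "Z ` {..<n}" "span (Z ` {..<n})" "{}"])
    show "span (Z ` {..<n}) \<subseteq> T10" using ZT T10_subspace by (rule span_minimal)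
  qed (use that in \<open>auto simp: orthonormal_def\<close>)
  have BL: "e \<in> LI" if "e \<in> B" for e using B(1) that unfolding orthonormal_def by auto
  have "W \<in> span B" if W: "W \<in> T10" for W
  proof (rule const_components(2)[OF B])
    show "W \<in> type_10_fields A J" using W by (simp add: T10_iff del: T10_L)
    fix e p assume e: "e \<in> B"
    show "g W (cnj_field e) p = g W (cnj_field e) \<one>\<^bsub>N\<^esub>"
      using W BL[OF e] by (intro g_LI) simp_all
  qed
  moreover have "span B \<subseteq> T10" using B(1) T10_subspace by (intro span_minimal) (auto simp: orthonormal_def)
  ultimately have "span B = T10" by auto
  then show ?thesis using that B by metis
qed

text \<open>
  The Chern connection is left-invariant because its components are constant.  In (0,1) directions they are components of brackets, by the vanishing of the (1,1) torsion; in (1,0) directions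
  metric compatibility reduces them to the former.  The remaining cases follow by conjugation.
\<close>

lemma D_LI:
  assumes "X \<in> LI" "Y \<in> LI"
  shows "D X Y \<in> LI"
proof -
  obtain B where B0: "orthonormal B" "span B = T10" "T10 = span (Z ` {..<n})" using unitary_basis_exists .
  then have B: "orthonormal B" "span B = span (Z ` {..<n})" by auto
  have BT: "e \<in> T10" if "e \<in> B" for e using B(1) that by (auto simp: orthonormal_def)
  have t10: "U \<in> type_10_fields A J" if "U \<in> T10" for U using that by (simp add: T10_iff del: T10_L)
  have type: "D X U \<in> type_10_fields A J" if "X \<in> LI" "U \<in> T10" for X U
  proof -
    have "J (D X U) = D X (J U)" using that by (simp add: D_vf(7))
    also have "\<dots> = scaleF \<i> (D X U)" using that by (simp add: J_T10 D_scaleF)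
    finally show ?thesis using that D_vf(1) by (simp add: type_10_fields_def scaleF_def)
  qed
  have gtype: "g (cnj_field U) (cnj_field V) = 0" if U: "U \<in> type_10_fields A J" and V: "V \<in> type_10_fields A J" for U V
  proof -
    have U': "U \<in> vector_fields A" "J U = (\<lambda>_. \<i>) \<cdot>\<^sub>F U" and V': "V \<in> vector_fields A" "J V = (\<lambda>_. \<i>) \<cdot>\<^sub>F V"
      using U V by (auto simp: type_10_fields_def)
    have "g U V = g (J U) (J V)" using g_vf(7)[OF U'(1) V'(1)] by (rule sym)
    also have "\<dots> = (\<lambda>_. \<i>) * g U ((\<lambda>_. \<i>) \<cdot>\<^sub>F V)" unfolding U'(2) V'(2) using U'(1) V'(1) by (simp add: g_vf(4))
    also have "g U ((\<lambda>_. \<i>) \<cdot>\<^sub>F V) = (\<lambda>_. \<i>) * g U V"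
      using g_vf(2)[of U "(\<lambda>_. \<i>) \<cdot>\<^sub>F V"] g_vf(4)[of "\<lambda>_. \<i>" V U] g_vf(2)[of V U] U'(1) V'(1) by simp
    finally have "g U V p = - g U V p" for p by (simp add: fun_eq_iff)
    then have "g U V = 0" by (simp add: fun_eq_iff)
    then show ?thesis using g_vf(5)[of U V] U'(1) V'(1) by simp
  qed
  have bar: "D (cnj_field V) U \<in> T10" if U: "U \<in> T10" and V: "V \<in> T10" for U V
  proof (rule const_components(1)[OF B])
    show "D (cnj_field V) U \<in> type_10_fields A J" using U V by (intro type) simp_all
    fix e p assume e: "e \<in> B"
    have vf: "cnj_field e \<in> vector_fields A" "D (cnj_field V) U \<in> vector_fields A"
      "cnj_field (D (cnj_field U) V) \<in> vector_fields A" "lie_bracket (cnj_field V) U \<in> vector_fields A"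
      using U V BT[OF e] D_vf(1) by simp_all
    have "D U (cnj_field V) = cnj_field (D (cnj_field U) V)"
      using D_vf(6)[of "cnj_field U" V] U V by simp
    then have "D (cnj_field V) U = cnj_field (D (cnj_field U) V) + lie_bracket (cnj_field V) U"
      using D_vf(9)[OF t10[OF U] t10[OF V]] br_swap[of U "cnj_field V"] U V
      by (simp add: torsion_def algebra_simps)
    then have "g (D (cnj_field V) U) (cnj_field e) =
        g (cnj_field (D (cnj_field U) V)) (cnj_field e) + g (lie_bracket (cnj_field V) U) (cnj_field e)"
      using vf by (simp add: g_vf(3))
    also have "g (cnj_field (D (cnj_field U) V)) (cnj_field e) = 0"
      using U V e BT by (intro gtype type t10) simp_all
    finally have "g (D (cnj_field V) U) (cnj_field e) = g (lie_bracket (cnj_field V) U) (cnj_field e)" by simp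
    then show "g (D (cnj_field V) U) (cnj_field e) p = g (D (cnj_field V) U) (cnj_field e) \<one>\<^bsub>N\<^esub>"
      using g_LI[of "lie_bracket (cnj_field V) U" "cnj_field e" p] U V BT[OF e] by simp
  qed
  have pure: "D V U \<in> T10" if U: "U \<in> T10" and V: "V \<in> T10" for U V
  proof (rule const_components(1)[OF B])
    show "D V U \<in> type_10_fields A J" using U V by (intro type) simp_all
    fix e p assume e: "e \<in> B"
    have eT: "e \<in> T10" using BT e .
    have "g U (cnj_field e) = (\<lambda>_. g U (cnj_field e) \<one>\<^bsub>N\<^esub>)"
      using g_LI[of U "cnj_field e"] U eT by (intro ext) simp
    then have "V (g U (cnj_field e)) = 0" using vector_field_const[of V] V by (metis LI_vf T10_L)
    then have "g (D V U) (cnj_field e) q = - g U (D V (cnj_field e)) q" for q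
      using D_vf(8)[of V U "cnj_field e"] U V eT by (simp add: fun_eq_iff eq_neg_iff_add_eq_0)
    moreover have "D V (cnj_field e) \<in> LI"
      using D_vf(6)[of "cnj_field V" e] bar[OF eT V] V eT by simp
    ultimately show "g (D V U) (cnj_field e) p = g (D V U) (cnj_field e) \<one>\<^bsub>N\<^esub>"
      using g_LI[of U "D V (cnj_field e)" p] U by simp
  qed
  have T: "D X U \<in> LI" if X: "X \<in> LI" and U: "U \<in> T10" for X U
  proof -
    obtain V W where VW: "V \<in> T10" "W \<in> T10" "X = V + cnj_field W" using type_decomposition[OF X] .
    then have "D X U = D V U + D (cnj_field W) U" using U by (simp add: D_vf(2))
    then show ?thesis using bar[OF U VW(2)] pure[OF U VW(1)] by simp
  qed
  obtain U V where UV: "U \<in> T10" "V \<in> T10" "Y = U + cnj_field V" using type_decomposition[OF assms(2)] .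
  then have "D X Y = D X U + cnj_field (D (cnj_field X) V)"
    using D_vf(3)[of X U "cnj_field V"] D_vf(6)[of "cnj_field X" V] assms(1) by simp
  then show ?thesis using T[OF assms(1) UV(1)] T[of "cnj_field X" V] assms(1) UV(2) by simp
qed

sublocale chern_hermitian_lie_algebra scaleF LI lie_bracket cnj_field J "\<lambda>X Y. g X Y \<one>\<^bsub>N\<^esub>" D
proof
  fix X Y assume X: "X \<in> LI" and Y: "Y \<in> LI"
  show "D X Y \<in> LI" using X Y by (rule D_LI)
  show "D (scaleF c X) Y = scaleF c (D X Y)" "D X (scaleF c Y) = scaleF c (D X Y)" for c
    using X Y by (simp_all add: D_scaleF)
  show "D (cnj_field X) (cnj_field Y) = cnj_field (D X Y)" "D X (J Y) = J (D X Y)"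
    using X Y by (simp_all add: D_vf(6,7))
  fix W assume W: "W \<in> LI"
  show "D (X + Y) W = D X W + D Y W" "D X (Y + W) = D X Y + D X W"
    using X Y W by (simp_all add: D_vf(2,3))
  have "g Y W = (\<lambda>_. g Y W \<one>\<^bsub>N\<^esub>)" using g_LI[OF Y W] by (intro ext)
  then have "X (g Y W) = 0" using vector_field_const[of X] X by (metis LI_vf)
  then show "g (D X Y) W \<one>\<^bsub>N\<^esub> + g Y (D X W) \<one>\<^bsub>N\<^esub> = 0"
    using D_vf(8)[of X Y W] X Y W by (simp add: fun_eq_iff)
next
  fix U V assume "U \<in> T10" "V \<in> T10"
  then show "D U (cnj_field V) - D (cnj_field V) U - lie_bracket U (cnj_field V) = 0"
    using D_vf(9)[of U V] by (simp add: T10_iff torsion_def del: T10_L)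
qed

lemma frame_Z_T10: "frame n Z"
  unfolding frame_def
proof (intro conjI allI impI)
  show "T10 = span (Z ` {..<n})" using unitary_basis_exists .
  fix c i assume c: "(\<Sum>i<n. scaleF (c i) (Z i)) = 0" and i: "i < n"
  have indep: "\<forall>c. (\<forall>i<n. c i \<in> smooth_funs A) \<longrightarrow> (\<Sum>i<n. c i \<cdot>\<^sub>F Z i) = 0 \<longrightarrow> (\<forall>i<n. c i = 0)"
    using frame_Z unfolding left_invariant_frame_def by blast
  have "(\<lambda>_. c i) = (0 :: 'g \<Rightarrow> complex)"
    using indep[rule_format, of "\<lambda>i _. c i"] c i smooth_funs_const
    unfolding scaleF_def by blast
  then show "c i = 0" by (simp add: fun_eq_iff)
qed

text \<open>
  The matrix chosen by \<open>metric_inv\<close> at the identity.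
\<close>

definition frame_inverse where "frame_inverse = (SOME H. inverse_metric n Z H)"

lemma inverse_metric_frame_inverse: "inverse_metric n Z frame_inverse"
proof -
  obtain B where B: "orthonormal B" "span B = T10" "T10 = span (Z ` {..<n})"
    using unitary_basis_exists .
  show ?thesis
    unfolding frame_inverse_def by (rule someI_ex[OF inverse_metric_exists[OF B(1,2) frame_Z_T10]])
qed

lemma metric_inv_eq: "metric_inv g n Z k l \<one>\<^bsub>N\<^esub> = frame_inverse k l"
  by (simp add: metric_inv_def frame_inverse_def inverse_metric_def metric_comp_def h_def)

lemma K_tensor_eq: "K_tensor g D n Z x i j \<one>\<^bsub>N\<^esub> = K_frame n Z frame_inverse x i j"
  unfolding K_tensor_def S_tensor_def Q1_def Q2_def Q3_def Q4_def torsion_comp_bar_def torsion_comp_def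
    curvature_comp_def K_frame_def metric_inv_eq h_def tor_def curv_def torsion_def curvature_def
  by (rule refl)

end

theorem proposition5p3:
  fixes N :: "'g::{t2_space, second_countable_topology} monoid"
    and A :: "('g, 'e::euclidean_space) chart set"
    and J :: "'g field \<Rightarrow> 'g field"
    and g\<^sub>0 :: "'g field \<Rightarrow> 'g field \<Rightarrow> 'g \<Rightarrow> complex"
    and x :: "real ^ 4"
  assumes "x $ 1 \<le> 1" and "x $ 2 \<le> 0" and "x $ 3 \<le> 0"
    and "x $ 1 + x $ 2 > 0" and "x $ 3 + x $ 4 \<ge> 0"
    and "nilpotent_lie_group N A" and "\<not> abelian_lie_group N A"
    and "left_invariant_complex_structure N A J"
    and "left_invariant_hermitian_metric N A J g\<^sub>0"
    and "lie_center N A \<inter> J ` lie_center N A \<noteq> {0}"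
  shows "\<not> (\<exists>g. left_invariant_hermitian_metric N A J g \<and>
               (\<exists>\<mu>::real. static_equation N A J x g \<mu>))"
proof
  assume "\<exists>g. left_invariant_hermitian_metric N A J g \<and> (\<exists>\<mu>::real. static_equation N A J x g \<mu>)"
  then obtain g \<mu> D n Z where g: "left_invariant_hermitian_metric N A J g"
    and D: "chern_connection A J g D" and Z: "left_invariant_frame N A J n Z"
    and static: "\<And>i j p. i < n \<Longrightarrow> j < n \<Longrightarrow> K_tensor g D n Z x i j p = complex_of_real \<mu> * metric_comp g Z i j p"
    unfolding static_equation_def by blast
  have lie: "lie_group N A" using assms(6) by (simp add: nilpotent_lie_group_def)
  interpret chern_frame N A J g D n Z
    using lie assms(8) g D Z by unfold_locales
  obtain k where "lower_central_series N A k = {0}"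
    using assms(6) by (auto simp: nilpotent_lie_group_def)
  then have K: "lcs k = {0}" by (rule nilpotent_lcs)
  obtain W where W: "W \<in> center" "W \<in> T10" "W \<noteq> 0"
    using central_T10_exists[OF assms(10)] .
  have "K_frame n Z frame_inverse x i j = complex_of_real \<mu> * h (Z i) (Z j)" if "i < n" "j < n" for i j
    using static[OF that, of "\<one>\<^bsub>N\<^esub>"] by (simp add: K_tensor_eq metric_comp_def h_def)
  then have "lie_bracket X Y = 0" if "X \<in> LI" "Y \<in> LI" for X Y
    using static_frame_abelian[OF frame_Z_T10 inverse_metric_frame_inverse K W assms(1-5)] that by blast
  then have "abelian_lie_group N A"
    using lie by (simp add: abelian_lie_group_def lie_algebra_iff)
  then show False using assms(7) by contradiction
qed

end
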